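(* Let $n,N\ge 1$ be integers. Let $f_1,\dots,f_N$ be probability densities on $\mathbb{R}^n$ (with respect to Lebesgue measure), and let $X_1,\dots,X_N$, $X_1^*,\dots,X_N^*$, $Z_1,\dots,Z_N$ be independent random vectors in $\mathbb{R}^n$ on a common probability space $(\Omega,\mathcal{F},\mathbb{P})$ such that $X_i$ has density $f_i$, $X_i^*$ has density $f_i^*$ (the symmetric decreasing rearrangement of $f_i$), and $Z_i$ is uniformly distributed in $\widetilde{B}$, the Euclidean ball in $\mathbb{R}^n$ of volume one centered at the origin. Let $\mathbf{X}=[X_1\cdots X_N]$, $\mathbf{X}^*=[X_1^*\cdots X_N^*]$, $\mathbf{Z}=[Z_1\cdots Z_N]$ be the corresponding $n\times N$ random matrices. Let $C$ be an origin-symmetric convex body in $\mathbb{R}^N$. Let $\nu$ be a radial measure on $\mathbb{R}^n$ with a density $\psi$ (with respect to Lebesgue measure) which is $-1/(n+1)$-concave on $\mathbb{R}^n$. Then for each $\alpha\ge 0$, $$\mathbb{P}\big(\nu((\mathbf{X}C)^\circ)>\alpha\big)\ \le\ \mathbb{P}\big(\nu((\mathbf{X}^*C)^\circ)>\alpha\big).$$ Moreover, if $C$ is $1$-unconditional and $\|f_i\|_\infty\le 1$ for $i=1,\dots,N$, then for each $\alpha\ge 0$, $$\mathbb{P}\big(\nu((\mathbf{X}C)^\circ)>\alpha\big)\ \le\ \mathbb{P}\big(\nu((\mathbf{Z}C)^\circ)>\alpha\big).$$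
   Context: For vectors $x_1,\dots,x_N\in\mathbb{R}^n$ and $C\subseteq\mathbb{R}^N$, $[x_1\cdots x_N]C=\{\sum_{i=1}^N c_i x_i : c=(c_i)\in C\}\subseteq\mathbb{R}^n$. For $K\subseteq\mathbb{R}^n$, $K^\circ=\{y\in\mathbb{R}^n:\langle x,y\rangle\le 1\ \text{for all } x\in K\}$ is the polar. A convex body is a compact convex set with non-empty interior; it is origin-symmetric if $K=-K$. A set $C\subseteq\mathbb{R}^N$ is $1$-unconditional if it is invariant under reflection in each coordinate hyperplane, i.e. $(c_1,\dots,c_N)\in C$ implies $(\pm c_1,\dots,\pm c_N)\in C$ for all choices of signs. For $\gamma<0$, a non-negative, not identically zero function $\psi$ on $\mathbb{R}^n$ is $\gamma$-concave if $\psi^\gamma$ is convex on $\{\psi>0\}$, this set being convex (equivalently, with the convention $0^\gamma=+\infty$, $\psi^\gamma$ is convex on $\mathbb{R}^n$). A radial measure is a rotation-invariant one (its density is a rotation-invariant function). For a Borel set $A\subseteq\mathbb{R}^n$ of finite measure, $A^*$ is the open Euclidean ball centered at the origin with the same measure as $A$; for integrable $f:\mathbb{R}^n\to[0,\infty)$, $f^*(x)=\int_0^\infty \mathbf{1}_{\{f>t\}^*}(x)\,dt$. *)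

theory Defs
  imports "HOL-Probability.Probability"
begin

section \<open>Convex geometry\<close>

text \<open>The set \<open>[x\<^sub>1 \<dots> x\<^sub>N] C\<close>: the image of \<open>C\<close> under the matrix with columns \<open>x\<^sub>i\<close>.\<close>

definition columns_image :: "('N::finite \<Rightarrow> real^'n) \<Rightarrow> (real^'N) set \<Rightarrow> (real^'n) set" where
  "columns_image x C = {\<Sum>i\<in>UNIV. (c $ i) *\<^sub>R x i | c. c \<in> C}"

definition polar :: "'a::real_inner set \<Rightarrow> 'a set" where
  "polar K = {y. \<forall>x\<in>K. x \<bullet> y \<le> 1}"

definition convex_body :: "'a::euclidean_space set \<Rightarrow> bool" where
  "convex_body K \<longleftrightarrow> compact K \<and> convex K \<and> interior K \<noteq> {}"

definition origin_symmetric :: "'a::ab_group_add set \<Rightarrow> bool" where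
  "origin_symmetric K \<longleftrightarrow> K = uminus ` K"

definition one_unconditional :: "(real^'N) set \<Rightarrow> bool" where
  "one_unconditional C \<longleftrightarrow>
     (\<forall>c\<in>C. \<forall>s. (\<forall>i. s i \<in> {-1, 1}) \<longrightarrow> (\<chi> i. s i * c $ i) \<in> C)"


section \<open>Densities\<close>

definition prob_density :: "('a::euclidean_space \<Rightarrow> real) \<Rightarrow> bool" where
  "prob_density f \<longleftrightarrow>
     f \<in> borel_measurable lborel \<and> (\<forall>x. 0 \<le> f x) \<and> (\<integral>\<^sup>+ x. ennreal (f x) \<partial>lborel) = 1"

text \<open>Only used for \<open>\<gamma> < 0\<close>. Convexity of the set \<open>{\<psi> > 0}\<close> is part of \<^const>\<open>convex_on\<close>.\<close>

definition neg_concave :: "real \<Rightarrow> ('a::real_vector \<Rightarrow> real) \<Rightarrow> bool" where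
  "neg_concave \<gamma> \<psi> \<longleftrightarrow> \<gamma> < 0 \<and> (\<forall>x. 0 \<le> \<psi> x) \<and> (\<exists>x. \<psi> x \<noteq> 0) \<and>
     convex_on {x. 0 < \<psi> x} (\<lambda>x. \<psi> x powr \<gamma>)"

text \<open>Invariance under the full orthogonal group, so that in dimension one (where the special
  orthogonal group is trivial) a rotation-invariant function is an even function.\<close>

definition rotation_invariant :: "('a::euclidean_space \<Rightarrow> 'b) \<Rightarrow> bool" where
  "rotation_invariant \<psi> \<longleftrightarrow> (\<forall>T. orthogonal_transformation T \<longrightarrow> (\<forall>x. \<psi> (T x) = \<psi> x))"


section \<open>Rearrangement\<close>

text \<open>The open centred ball with the same measure as \<open>A\<close>; meaningful for \<open>A\<close> of finite measure
  (the empty ball \<open>ball 0 0\<close> when \<open>A\<close> is null).\<close>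

definition set_rearrangement :: "'a::euclidean_space set \<Rightarrow> 'a set" where
  "set_rearrangement A =
     (THE B. (\<exists>r\<ge>0. B = ball 0 r) \<and> emeasure lborel B = emeasure lborel A)"

text \<open>Extended-valued, since \<open>f\<^sup>*\<close> is infinite at the origin when \<open>f\<close> is essentially unbounded.
  The level \<open>t = 0\<close>, where \<open>{f > t}\<close> may have infinite measure, is left out of the integral.\<close>

definition sym_decr_rearrangement :: "('a::euclidean_space \<Rightarrow> real) \<Rightarrow> 'a \<Rightarrow> ennreal" where
  "sym_decr_rearrangement f x =
     (\<integral>\<^sup>+ t\<in>{0<..}. indicator (set_rearrangement {y. f y > t}) x \<partial>lborel)"

definition unit_volume_ball :: "'a::euclidean_space set" where
  "unit_volume_ball = (THE B. (\<exists>r\<ge>0. B = cball 0 r) \<and> emeasure lborel B = 1)"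

lemma exists_radius_of_volume:
  assumes "0 \<le> v"
  obtains r where "0 \<le> r" "unit_ball_vol (real DIM('a::euclidean_space)) * r ^ DIM('a) = v"
proof
  let ?u = "unit_ball_vol (real DIM('a))"
  have u: "0 < ?u" by (rule unit_ball_vol_pos) simp
  show "0 \<le> root DIM('a) (v / ?u)" using assms u by simp
  show "?u * root DIM('a) (v / ?u) ^ DIM('a) = v" using assms u by (simp add: less_imp_neq[OF u, symmetric])
qed

lemma set_rearrangement:
  fixes A :: "'a::euclidean_space set"
  assumes "emeasure lborel A < \<infinity>"
  shows "\<exists>r\<ge>0. set_rearrangement A = ball 0 r"
    and "emeasure lborel (set_rearrangement A) = emeasure lborel A"
proof -
  let ?P = "\<lambda>B::'a set. (\<exists>r\<ge>0. B = ball 0 r) \<and> emeasure lborel B = emeasure lborel A"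
  obtain r where r: "0 \<le> r"
    "unit_ball_vol (real DIM('a)) * r ^ DIM('a) = measure lborel A"
    using exists_radius_of_volume[OF measure_nonneg] by metis
  have "?P (ball 0 r)"
    using r assms emeasure_eq_ennreal_measure[of lborel A] emeasure_ball[OF r(1), of "0::'a"]
    by auto
  moreover have "B = ball 0 r" if B: "?P B" for B
  proof -
    obtain s where s: "0 \<le> s" "B = ball 0 s" using B by auto
    have "emeasure lborel (ball (0::'a) s) = emeasure lborel (ball (0::'a) r)"
      using B s \<open>?P (ball 0 r)\<close> by simp
    then have "s ^ DIM('a) = r ^ DIM('a)"
      using r(1) s(1) less_imp_neq[OF unit_ball_vol_pos[of "real DIM('a)"]]
      by (auto simp: emeasure_ball)
    then have "s = r" using r(1) s(1) by (simp add: power_eq_iff_eq_base)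
    then show ?thesis using s by simp
  qed
  ultimately have "?P (set_rearrangement A)"
    unfolding set_rearrangement_def by (rule theI)
  then show "\<exists>r\<ge>0. set_rearrangement A = ball 0 r"
    "emeasure lborel (set_rearrangement A) = emeasure lborel A" by auto
qed

lemma unit_volume_ball:
  shows "\<exists>r\<ge>0. (unit_volume_ball :: 'a::euclidean_space set) = cball 0 r"
    and "emeasure lborel (unit_volume_ball :: 'a set) = 1"
proof -
  let ?P = "\<lambda>B::'a set. (\<exists>r\<ge>0. B = cball 0 r) \<and> emeasure lborel B = 1"
  obtain r where r: "0 \<le> r" "unit_ball_vol (real DIM('a)) * r ^ DIM('a) = 1"
    using exists_radius_of_volume[of 1] by (metis zero_le_one)
  have "?P (cball 0 r)" using r by (auto simp: emeasure_cball)
  moreover have "B = cball 0 r" if B: "?P B" for B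
  proof -
    obtain s where s: "0 \<le> s" "B = cball 0 s" using B by auto
    have "emeasure lborel (cball (0::'a) s) = emeasure lborel (cball (0::'a) r)"
      using B s \<open>?P (cball 0 r)\<close> by simp
    then have "s ^ DIM('a) = r ^ DIM('a)"
      using r(1) s(1) less_imp_neq[OF unit_ball_vol_pos[of "real DIM('a)"]]
      by (auto simp: emeasure_cball)
    then have "s = r" using r(1) s(1) by (simp add: power_eq_iff_eq_base)
    then show ?thesis using s by simp
  qed
  ultimately have "?P unit_volume_ball"
    unfolding unit_volume_ball_def by (rule theI)
  then show "\<exists>r\<ge>0. (unit_volume_ball :: 'a set) = cball 0 r"
    "emeasure lborel (unit_volume_ball :: 'a set) = 1" by auto
qed

end

theory Submission
  imports Defs
begin

text \<open>The polar of \<open>[x\<^sub>1 \<dots> x\<^sub>N] C\<close> consists of the \<open>v\<close> for which \<open>(x\<^sub>i \<bullet> v)\<^sub>i\<close> lies in the polar \<open>L\<close> of \<open>C\<close>.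
  Move the \<open>x\<^sub>i\<close> along a common direction \<open>e\<close> with speeds \<open>t\<^sub>i\<close> and write \<open>v = u + s e\<close> with \<open>u\<close> orthogonal to \<open>e\<close>.
  In the coordinate \<open>r = 1 / s\<close> the condition on \<open>v\<close> becomes jointly convex, and the Borell--Brascamp--Lieb
  inequality, whose exponent \<open>-1 / (n + 1)\<close> turns into \<open>-1\<close> after \<open>n\<close> integrations, makes the measure of the polar
  a quasi-concave function of \<open>t\<close>; reflection in the hyperplane orthogonal to \<open>e\<close> makes it even when all \<open>x\<^sub>i\<close> start
  in that hyperplane. Hence the superlevel sets \<open>S\<close> have convex symmetric sections along lines, and by the
  one-dimensional Brascamp--Lieb--Luttinger inequality (sliding intervals towards the origin)
  the measure of \<open>S \<inter> (A\<^sub>1 \<times> \<dots> \<times> A\<^sub>N)\<close> does not decrease when all \<open>A\<^sub>i\<close> are Steiner symmetrized in the same direction.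
  Averaging over translations produces a direction in which the total deviation of the \<open>A\<^sub>i\<close> from balls drops by a
  definite amount, so balls are reached in the limit, and the layer cake formula passes from sets to densities.
  If \<open>C\<close> is unconditional, then \<open>S\<close> is star-shaped in each \<open>x\<^sub>i\<close>, and a radially decreasing density bounded by one
  may be replaced by the uniform density on the ball of volume one.\<close>

section \<open>The one-dimensional Brunn--Minkowski inequality and layer cakes\<close>

text \<open>The obstacle to quasi-concavity is that for \<open>v = u + s e\<close> the values
  \<open>y_i \<bullet> u + t_i s\<close> are bilinear in \<open>(t, s)\<close>, so no convexity in
  \<open>t\<close> is visible. For positive heights, the harmonic mean of two values of
  \<open>s\<close> is an arithmetic mean with modified weights, and with these weights the products
  \<open>t_i s\<close> combine exactly as convexity of \<open>L\<close> demands. This accounts for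
  the exponent: with n the dimension, the n - 1 integrations over \<open>u\<close> lower n + 1 to 2,
  at exponent 2 the Jacobian \<open>1 / r^2\<close> converts the modified weights back into the
  original ones, and the integration over \<open>r\<close> leaves 1.

  The passage to balls keeps only the inequality between the measure of a set and that of its target
  ball, so that truncation to bounded sets is harmless. No sequence of directions is followed: the
  infimum of the total deviation over all admissible families is shown to be zero.

  Inequalities between integrals are stated for extended non-negative values, so polars of infinite
  measure need no separate treatment.\<close>

lemma emeasure_lborel_affine:
  fixes c t :: real
  assumes c: "c \<noteq> 0" and [measurable]: "A \<in> sets borel"
  shows "emeasure lborel A = ennreal \<bar>c\<bar> * emeasure lborel {x. t + c * x \<in> A}"
proof -
  have "emeasure lborel A = (\<integral>\<^sup>+x. indicator A x \<partial>lborel)" by simp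
  also have "\<dots> = \<bar>c\<bar> * (\<integral>\<^sup>+x. indicator A (t + c * x) \<partial>lborel)"
    by (rule nn_integral_real_affine) (use c in auto)
  also have "(\<integral>\<^sup>+x. indicator A (t + c * x) \<partial>lborel) = (\<integral>\<^sup>+x. indicator {x. t + c * x \<in> A} x \<partial>lborel)"
    by (intro nn_integral_cong) (auto simp: indicator_def)
  also have "\<dots> = emeasure lborel {x. t + c * x \<in> A}" by simp
  finally show ?thesis .
qed

text \<open>Choose \<open>a\<close> near the top of \<open>A\<close> and \<open>b\<close> near the
  bottom of \<open>B\<close>. The scaled copies of \<open>A\<close> and \<open>B\<close> anchored at
  these points lie on opposite sides of \<open>c\<close> and both inside \<open>Z\<close>, so their
  lengths add. Supremum and infimum need not be attained, which costs the error
  \<open>e\<close>.\<close>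

lemma brunn_minkowski_real_bounded:
  fixes A B Z :: "real set"
  assumes [measurable]: "A \<in> sets borel" "B \<in> sets borel" "Z \<in> sets borel"
    and ne: "A \<noteq> {}" "B \<noteq> {}" and bdd: "bounded A" "bounded B" and \<mu>: "0 < \<mu>" "\<mu> < 1"
    and sub: "\<And>a b. a \<in> A \<Longrightarrow> b \<in> B \<Longrightarrow> (1 - \<mu>) * a + \<mu> * b \<in> Z"
  shows "ennreal (1 - \<mu>) * emeasure lborel A + ennreal \<mu> * emeasure lborel B \<le> emeasure lborel Z"
proof (rule ennreal_le_epsilon)
  fix e :: real assume e: "0 < e"
  have bA: "bdd_above A" and bB: "bdd_below B"
    using bdd by (auto intro: bounded_imp_bdd_above bounded_imp_bdd_below)
  obtain a where a: "a \<in> A" "Sup A - e < a"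
    using less_cSup_iff[OF ne(1) bA, of "Sup A - e"] e by auto
  obtain b where b: "b \<in> B" "b < Inf B + e"
    using cInf_less_iff[OF ne(2) bB, of "Inf B + e"] e by auto
  define A' B' where "A' = A \<inter> {..a}" and "B' = B \<inter> {b..}"
  have [measurable]: "A' \<in> sets borel" "B' \<in> sets borel" by (auto simp: A'_def B'_def)
  have "A \<subseteq> A' \<union> {a..Sup A}" using cSup_upper[OF _ bA] by (auto simp: A'_def)
  then have "emeasure lborel A \<le> emeasure lborel (A' \<union> {a..Sup A})" by (intro emeasure_mono) auto
  also have "\<dots> \<le> emeasure lborel A' + emeasure lborel {a..Sup A}" by (intro emeasure_subadditive) auto
  also have "emeasure lborel {a..Sup A} \<le> ennreal e"
    using a cSup_upper[OF a(1) bA] by (simp add: ennreal_leI)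
  finally have 1: "emeasure lborel A \<le> emeasure lborel A' + ennreal e" by (simp add: add_left_mono)
  have "B \<subseteq> B' \<union> {Inf B..b}" using cInf_lower[OF _ bB] by (auto simp: B'_def)
  then have "emeasure lborel B \<le> emeasure lborel (B' \<union> {Inf B..b})" by (intro emeasure_mono) auto
  also have "\<dots> \<le> emeasure lborel B' + emeasure lborel {Inf B..b}" by (intro emeasure_subadditive) auto
  also have "emeasure lborel {Inf B..b} \<le> ennreal e"
    using b cInf_lower[OF b(1) bB] by (simp add: ennreal_leI)
  finally have 2: "emeasure lborel B \<le> emeasure lborel B' + ennreal e" by (simp add: add_left_mono)
  define c where "c = (1 - \<mu>) * a + \<mu> * b"
  \<comment> \<open>These are the sets \<open>(1 - \<mu>) A' + \<mu> b\<close> and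
    \<open>(1 - \<mu>) a + \<mu> B'\<close>, written as preimages so that the affine change of
    variables applies.\<close>
  let ?A = "{x. - (\<mu> * b) / (1 - \<mu>) + (1 / (1 - \<mu>)) * x \<in> A'}"
  let ?B = "{x. - ((1 - \<mu>) * a) / \<mu> + (1 / \<mu>) * x \<in> B'}"
  have A: "?A \<subseteq> Z \<inter> {..c}"
  proof
    fix x assume "x \<in> ?A"
    then obtain y where y: "y \<in> A'" "y = - (\<mu> * b) / (1 - \<mu>) + (1 / (1 - \<mu>)) * x" by blast
    have "(1 - \<mu>) * y = x - \<mu> * b"
      using \<mu> unfolding y(2) by (simp add: distrib_left right_diff_distrib)
    then have x: "x = (1 - \<mu>) * y + \<mu> * b" by simp
    then show "x \<in> Z \<inter> {..c}" using y(1) sub[OF _ b(1)] \<mu> by (auto simp: A'_def c_def)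
  qed
  have B: "?B \<subseteq> Z \<inter> {c..}"
  proof
    fix x assume "x \<in> ?B"
    then obtain y where y: "y \<in> B'" "y = - ((1 - \<mu>) * a) / \<mu> + (1 / \<mu>) * x" by blast
    have "\<mu> * y = x - (1 - \<mu>) * a"
      using \<mu> unfolding y(2) by (simp add: distrib_left right_diff_distrib)
    then have x: "x = (1 - \<mu>) * a + \<mu> * y" by simp
    then show "x \<in> Z \<inter> {c..}" using y(1) sub[OF a(1)] \<mu> by (auto simp: B'_def c_def)
  qed
  have eA: "ennreal (1 - \<mu>) * emeasure lborel A' = emeasure lborel ?A"
    using \<mu> by (subst emeasure_lborel_affine[of "1 / (1 - \<mu>)" A' "- (\<mu> * b) / (1 - \<mu>)"])
      (auto simp: mult.assoc[symmetric] ennreal_mult[symmetric])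
  have eB: "ennreal \<mu> * emeasure lborel B' = emeasure lborel ?B"
    using \<mu> by (subst emeasure_lborel_affine[of "1 / \<mu>" B' "- ((1 - \<mu>) * a) / \<mu>"])
      (auto simp: mult.assoc[symmetric] ennreal_mult[symmetric])
  have "emeasure lborel ?A + emeasure lborel ?B \<le> emeasure lborel (Z \<inter> {..c}) + emeasure lborel (Z \<inter> {c..})"
    using A B by (intro add_mono emeasure_mono) auto
  \<comment> \<open>The two halves share the point \<open>c\<close>; removing this null set makes
    them disjoint.\<close>
  also have "emeasure lborel (Z \<inter> {..c}) \<le> emeasure lborel ((Z \<inter> {..<c}) \<union> {c})"
    by (intro emeasure_mono) auto
  also have "\<dots> \<le> emeasure lborel (Z \<inter> {..<c}) + emeasure lborel {c}"
    by (intro emeasure_subadditive) auto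
  also have "emeasure lborel (Z \<inter> {..<c}) + emeasure lborel {c} + emeasure lborel (Z \<inter> {c..}) =
      emeasure lborel ((Z \<inter> {..<c}) \<union> (Z \<inter> {c..}))"
    by (subst plus_emeasure[symmetric]) auto
  also have "(Z \<inter> {..<c}) \<union> (Z \<inter> {c..}) = Z" by auto
  finally have 3: "emeasure lborel ?A + emeasure lborel ?B \<le> emeasure lborel Z"
    by (simp add: add_right_mono)
  have "ennreal (1 - \<mu>) * emeasure lborel A + ennreal \<mu> * emeasure lborel B
    \<le> ennreal (1 - \<mu>) * (emeasure lborel A' + ennreal e) + ennreal \<mu> * (emeasure lborel B' + ennreal e)"
    by (intro add_mono mult_left_mono 1 2) auto
  also have "\<dots> = (emeasure lborel ?A + emeasure lborel ?B) + (ennreal (1 - \<mu>) * ennreal e + ennreal \<mu> * ennreal e)"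
    unfolding eA[symmetric] eB[symmetric] by (simp add: algebra_simps)
  also have "ennreal (1 - \<mu>) * ennreal e + ennreal \<mu> * ennreal e = ennreal e"
    using \<mu> e by (simp add: ennreal_mult[symmetric] ennreal_plus[symmetric] algebra_simps del: ennreal_plus)
  also have "(emeasure lborel ?A + emeasure lborel ?B) + ennreal e \<le> emeasure lborel Z + ennreal e"
    by (intro add_right_mono 3)
  finally show "ennreal (1 - \<mu>) * emeasure lborel A + ennreal \<mu> * emeasure lborel B \<le> emeasure lborel Z + ennreal e" .
qed

lemma SUP_emeasure_Int_cball:
  fixes A :: "'a::euclidean_space set"
  assumes [measurable]: "A \<in> sets borel"
  shows "(SUP m. emeasure lborel (A \<inter> cball 0 (real m))) = emeasure lborel A"
proof -
  have "(SUP m. emeasure lborel (A \<inter> cball 0 (real m))) = emeasure lborel (\<Union>m. A \<inter> cball 0 (real m))"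
    by (rule SUP_emeasure_incseq) (auto simp: incseq_def)
  also have "(\<Union>m. A \<inter> cball 0 (real m)) = A"
    by (auto simp: real_arch_simple)
  finally show ?thesis .
qed

lemma brunn_minkowski_real:
  fixes A B Z :: "real set"
  assumes [measurable]: "A \<in> sets borel" "B \<in> sets borel" "Z \<in> sets borel"
    and ne: "A \<noteq> {}" "B \<noteq> {}" and \<mu>: "0 < \<mu>" "\<mu> < 1"
    and sub: "\<And>a b. a \<in> A \<Longrightarrow> b \<in> B \<Longrightarrow> (1 - \<mu>) * a + \<mu> * b \<in> Z"
  shows "ennreal (1 - \<mu>) * emeasure lborel A + ennreal \<mu> * emeasure lborel B \<le> emeasure lborel Z"
proof -
  let ?A = "\<lambda>m. A \<inter> cball 0 (real m)" and ?B = "\<lambda>m. B \<inter> cball 0 (real m)"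
  have inc: "incseq (\<lambda>m. ennreal c * emeasure lborel (E \<inter> cball 0 (real m)))"
    if [measurable]: "E \<in> sets borel" for E :: "real set" and c
    by (auto simp: incseq_def intro!: mult_left_mono emeasure_mono)
  have "ennreal (1 - \<mu>) * emeasure lborel A + ennreal \<mu> * emeasure lborel B =
      (SUP m. ennreal (1 - \<mu>) * emeasure lborel (?A m)) + (SUP m. ennreal \<mu> * emeasure lborel (?B m))"
    by (subst (1 2) SUP_emeasure_Int_cball[symmetric]) (auto simp: SUP_mult_left_ennreal)
  also have "\<dots> = (SUP m. ennreal (1 - \<mu>) * emeasure lborel (?A m) + ennreal \<mu> * emeasure lborel (?B m))"
    by (intro ennreal_SUP_add[symmetric] inc) auto
  also have "\<dots> \<le> emeasure lborel Z"
  proof (rule SUP_least)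
    fix m :: nat
    obtain x y where xy: "x \<in> A" "y \<in> B" using ne by auto
    obtain k where k: "m \<le> k" "\<bar>x\<bar> \<le> real k" "\<bar>y\<bar> \<le> real k"
      by (meson max.bounded_iff order_trans of_nat_le_iff real_arch_simple)
    have "ennreal (1 - \<mu>) * emeasure lborel (?A m) + ennreal \<mu> * emeasure lborel (?B m)
      \<le> ennreal (1 - \<mu>) * emeasure lborel (?A k) + ennreal \<mu> * emeasure lborel (?B k)"
      using k(1) by (intro add_mono mult_left_mono emeasure_mono) auto
    also have "\<dots> \<le> emeasure lborel Z"
      using xy k \<mu> sub by (intro brunn_minkowski_real_bounded) auto
    finally show "ennreal (1 - \<mu>) * emeasure lborel (?A m) + ennreal \<mu> * emeasure lborel (?B m) \<le> emeasure lborel Z" .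
  qed
  finally show ?thesis .
qed

section \<open>Layer-cake formulas\<close>

lemma nn_integral_Ioi_indicator_less:
  "(\<integral>\<^sup>+t. indicator {t. 0 < t \<and> ennreal t < F} t \<partial>lborel) = F"
proof (cases F)
  case (real r)
  then have "{t. 0 < t \<and> ennreal t < F} = {0<..<r}" by (auto simp: ennreal_less_iff)
  then show ?thesis using real by simp
next
  case top
  then have "{t. 0 < t \<and> ennreal t < F} = {0<..}" by auto
  then have "(\<integral>\<^sup>+t. indicator {t. 0 < t \<and> ennreal t < F} t \<partial>lborel) = emeasure lborel {0::real<..}" by simp
  also have "\<dots> = \<infinity>"
  proof -
    have "ennreal (real n) \<le> emeasure lborel {0::real<..}" for n
    proof -
      have "emeasure lborel {0<..<real n} \<le> emeasure lborel {0::real<..}" by (intro emeasure_mono) auto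
      then show ?thesis by simp
    qed
    then have "(SUP n. of_nat n) \<le> emeasure lborel {0::real<..}"
      by (intro SUP_least) (simp add: ennreal_of_nat_eq_real_of_nat)
    then show ?thesis by (simp add: ennreal_SUP_of_nat_eq_top top_unique)
  qed
  finally show ?thesis using top by simp
qed

lemma nn_integral_Ioi_indicator_le:
  "(\<integral>\<^sup>+t. indicator {t. 0 < t \<and> ennreal t \<le> F} t \<partial>lborel) = F"
proof (cases F)
  case (real r)
  then have "{t. 0 < t \<and> ennreal t \<le> F} = {0<..r}" by (auto simp: ennreal_le_iff)
  then show ?thesis using real by simp
next
  case top
  then have "{t. 0 < t \<and> ennreal t \<le> F} = {t. 0 < t \<and> ennreal t < F}" by auto
  then show ?thesis using nn_integral_Ioi_indicator_less by metis
qed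

text \<open>The level relation \<open>Q\<close> is left abstract because both versions are used:
  strict levels for the functions that are bounded below by hypothesis, non-strict ones for the
  function in the conclusion of \<open>power_mean_le\<close>.\<close>

lemma (in sigma_finite_measure) layer_cake:
  assumes [measurable]: "{p \<in> space (M \<Otimes>\<^sub>M lborel). Q (snd p) (fst p)} \<in> sets (M \<Otimes>\<^sub>M lborel)"
    and F: "\<And>x. (\<integral>\<^sup>+t. indicator {t::real. 0 < t \<and> Q t x} t \<partial>lborel) = F x"
  shows "(\<integral>\<^sup>+x. F x \<partial>M) = (\<integral>\<^sup>+t\<in>{0<..}. emeasure M {x\<in>space M. Q t x} \<partial>lborel)"
proof -
  interpret pair_sigma_finite M lborel ..
  let ?E = "{p \<in> space (M \<Otimes>\<^sub>M lborel). Q (snd p) (fst p)}"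
  have "(\<integral>\<^sup>+x. F x \<partial>M) = (\<integral>\<^sup>+x. \<integral>\<^sup>+t. indicator {0<..} t * indicator ?E (x, t) \<partial>lborel \<partial>M)"
    unfolding F[symmetric] by (intro nn_integral_cong) (auto simp: indicator_def space_pair_measure)
  also have "\<dots> = (\<integral>\<^sup>+t. \<integral>\<^sup>+x. indicator {0<..} t * indicator ?E (x, t) \<partial>M \<partial>lborel)"
    by (rule Fubini'[symmetric]) measurable
  also have "\<dots> = (\<integral>\<^sup>+t\<in>{0<..}. emeasure M {x\<in>space M. Q t x} \<partial>lborel)"
  proof (rule nn_integral_cong)
    fix t :: real
    have "(\<lambda>x. (x, t)) -` ?E \<inter> space M = {x\<in>space M. Q t x}" by (auto simp: space_pair_measure)
    then have E: "{x\<in>space M. Q t x} \<in> sets M"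
      using measurable_sets[OF measurable_Pair2'[of t lborel M] assms(1)] by simp
    have "(\<integral>\<^sup>+x. indicator {0<..} t * indicator ?E (x, t) \<partial>M) = (\<integral>\<^sup>+x. indicator {0<..} t * indicator {x\<in>space M. Q t x} x \<partial>M)"
      by (intro nn_integral_cong) (auto simp: indicator_def space_pair_measure)
    then show "(\<integral>\<^sup>+x. indicator {0<..} t * indicator ?E (x, t) \<partial>M) = emeasure M {x\<in>space M. Q t x} * indicator {0<..} t"
      using E by (simp add: nn_integral_cmult_indicator mult.commute)
  qed
  finally show ?thesis .
qed

lemma (in sigma_finite_measure) layer_cake_less:
  assumes [measurable]: "F \<in> borel_measurable M"
  shows "(\<integral>\<^sup>+x. F x \<partial>M) = (\<integral>\<^sup>+t\<in>{0<..}. emeasure M {x\<in>space M. ennreal t < F x} \<partial>lborel)"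
  by (rule layer_cake[OF _ nn_integral_Ioi_indicator_less]) measurable

lemma (in sigma_finite_measure) layer_cake_le:
  assumes [measurable]: "F \<in> borel_measurable M"
  shows "(\<integral>\<^sup>+x. F x \<partial>M) = (\<integral>\<^sup>+t\<in>{0<..}. emeasure M {x\<in>space M. ennreal t \<le> F x} \<partial>lborel)"
  by (rule layer_cake[OF _ nn_integral_Ioi_indicator_le]) measurable

text \<open>\<open>c \<ge> ((1 - \<mu>) a\<^bsup>-1/j\<^esup> + \<mu> b\<^bsup>-1/j\<^esup>)\<^bsup>-j\<^esup>\<close>, in terms of levels \<open>p\<^bsup>-j\<^esup> < a\<close> and \<open>q\<^bsup>-j\<^esup> < b\<close>
  so that the values \<open>0\<close> and \<open>\<infinity>\<close> need no special treatment.\<close>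

definition power_mean_le :: "nat \<Rightarrow> real \<Rightarrow> ennreal \<Rightarrow> ennreal \<Rightarrow> ennreal \<Rightarrow> bool" where
  "power_mean_le j \<mu> a b c \<longleftrightarrow>
     (\<forall>p>0. \<forall>q>0. ennreal (1 / p ^ j) < a \<longrightarrow> ennreal (1 / q ^ j) < b \<longrightarrow>
        ennreal (1 / ((1 - \<mu>) * p + \<mu> * q) ^ j) \<le> c)"

lemma convex_on_power_nonneg: "convex_on {0::real..} (\<lambda>x. x ^ j)"
  using convex_power_odd[of j] convex_on_subset[OF convex_power_even[of j], of "{0..}"] by (cases "even j") auto

text \<open>The function \<open>x ^ Suc j / P ^ j\<close> is the perspective of the convex function
  \<open>x ^ Suc j\<close>, hence jointly convex. Concretely this is convexity at the points
  \<open>a / P\<close> and \<open>b / Q\<close>, with weights proportional to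
  \<open>(1 - \<mu>) * P\<close> and \<open>\<mu> * Q\<close>.\<close>

lemma perspective_power_le:
  fixes a b P Q \<mu> :: real
  assumes pos: "0 < a" "0 < b" "0 < P" "0 < Q" and \<mu>: "0 < \<mu>" "\<mu> < 1"
  shows "((1 - \<mu>) * a + \<mu> * b) ^ Suc j / ((1 - \<mu>) * P + \<mu> * Q) ^ j
    \<le> (1 - \<mu>) * (a ^ Suc j / P ^ j) + \<mu> * (b ^ Suc j / Q ^ j)"
proof -
  define W where "W = (1 - \<mu>) * P + \<mu> * Q"
  have W: "0 < W" using pos \<mu> by (simp add: W_def add_pos_pos)
  let ?u = "\<mu> * Q / W"
  have u: "1 - ?u = (1 - \<mu>) * P / W" using W by (simp add: W_def field_simps)
  have "((1 - ?u) * (a / P) + ?u * (b / Q)) ^ Suc j \<le> (1 - ?u) * (a / P) ^ Suc j + ?u * (b / Q) ^ Suc j"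
  proof -
    have "?u \<le> 1" using W pos \<mu> by (simp add: W_def)
    moreover have "0 \<le> ?u" using W pos \<mu> by simp
    ultimately show ?thesis
      using convex_onD[OF convex_on_power_nonneg[of "Suc j"], of ?u "a / P" "b / Q"] pos by simp
  qed
  also have "(1 - ?u) * (a / P) + ?u * (b / Q) = ((1 - \<mu>) * a + \<mu> * b) / W"
    unfolding u using pos W by (simp add: add_divide_distrib)
  also have "(1 - ?u) * (a / P) ^ Suc j + ?u * (b / Q) ^ Suc j
    = ((1 - \<mu>) * (a ^ Suc j / P ^ j) + \<mu> * (b ^ Suc j / Q ^ j)) / W"
    unfolding u using pos W by (simp add: power_divide field_simps)
  finally have "(((1 - \<mu>) * a + \<mu> * b) / W) ^ Suc j * W
    \<le> (1 - \<mu>) * (a ^ Suc j / P ^ j) + \<mu> * (b ^ Suc j / Q ^ j)"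
    using W by (simp add: pos_le_divide_eq)
  moreover have "(((1 - \<mu>) * a + \<mu> * b) / W) ^ Suc j * W = ((1 - \<mu>) * a + \<mu> * b) ^ Suc j / W ^ j"
    using W by (simp add: power_divide)
  ultimately show ?thesis by (simp add: W_def)
qed

lemma nn_integral_min_of_nat:
  assumes [measurable]: "f \<in> borel_measurable M"
  shows "(\<integral>\<^sup>+x. f x \<partial>M) = (SUP n. \<integral>\<^sup>+x. min (f x) (of_nat n) \<partial>M)"
proof -
  have "(SUP n. min y (of_nat n)) = y" for y :: ennreal
  proof (rule antisym)
    show "(SUP n. min y (of_nat n)) \<le> y" by (rule SUP_least) simp
    show "y \<le> (SUP n. min y (of_nat n))"
    proof (cases "y = top")
      case True then show ?thesis by (simp add: min_def ennreal_SUP_of_nat_eq_top top_unique)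
    next
      case False
      then obtain n where "y < of_nat n" using ennreal_Ex_less_of_nat[of y] by (auto simp: less_top)
      then show ?thesis by (intro SUP_upper2[of n]) (auto simp: min_def)
    qed
  qed
  moreover have "(\<integral>\<^sup>+x. (SUP n. min (f x) (of_nat n)) \<partial>M) = (SUP n. \<integral>\<^sup>+x. min (f x) (of_nat n) \<partial>M)"
    by (rule nn_integral_monotone_convergence_SUP) (auto simp: incseq_def le_fun_def min_def intro: order_trans)
  ultimately show ?thesis by simp
qed

text \<open>Measuring levels in units of the bound lets two functions with different suprema be
  compared at the same \<open>t\<close> in (0,1), where both superlevel sets are non-empty if the
  bounds are the suprema.\<close>

lemma layer_cake_normalized:
  fixes f :: "real \<Rightarrow> ennreal"
  assumes [measurable]: "f \<in> borel_measurable borel" and A: "0 < A" and le: "\<And>x. f x \<le> ennreal A"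
  shows "(\<integral>\<^sup>+x. f x \<partial>lborel) = ennreal A * (\<integral>\<^sup>+t\<in>{0<..<1}. emeasure lborel {x. ennreal (A * t) < f x} \<partial>lborel)"
proof -
  have "(\<integral>\<^sup>+x. f x \<partial>lborel) = (\<integral>\<^sup>+t\<in>{0<..}. emeasure lborel {x. ennreal t < f x} \<partial>lborel)"
    by (subst lborel.layer_cake_less) auto
  also have "\<dots> = ennreal \<bar>A\<bar> * (\<integral>\<^sup>+t. emeasure lborel {x. ennreal (0 + A * t) < f x} * indicator {0<..} (0 + A * t) \<partial>lborel)"
    using A by (intro nn_integral_real_affine) auto
  also have "(\<integral>\<^sup>+t. emeasure lborel {x. ennreal (0 + A * t) < f x} * indicator {0<..} (0 + A * t) \<partial>lborel)
    = (\<integral>\<^sup>+t\<in>{0<..<1}. emeasure lborel {x. ennreal (A * t) < f x} \<partial>lborel)"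
  proof (intro nn_integral_cong)
    fix t :: real
    have "{x. ennreal (A * t) < f x} = {}" if "1 \<le> t"
    proof -
      have "ennreal A \<le> ennreal (A * t)" using A that by (intro ennreal_leI) simp
      then show ?thesis using le by (auto simp: not_less intro: order_trans)
    qed
    then show "emeasure lborel {x. ennreal (0 + A * t) < f x} * indicator {0<..} (0 + A * t)
      = emeasure lborel {x. ennreal (A * t) < f x} * indicator {0<..<1} t"
      using A by (cases "1 \<le> t") (auto simp: indicator_def zero_less_mult_iff)
  qed
  finally show ?thesis using A by simp
qed

section \<open>The Borell--Brascamp--Lieb inequality\<close>

lemma power_mean_leD:
  "power_mean_le j \<mu> a b c \<Longrightarrow> 0 < p \<Longrightarrow> 0 < q \<Longrightarrow> ennreal (1 / p ^ j) < a \<Longrightarrow> ennreal (1 / q ^ j) < b \<Longrightarrow>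
    ennreal (1 / ((1 - \<mu>) * p + \<mu> * q) ^ j) \<le> c"
  by (simp add: power_mean_le_def)

text \<open>Relative levels require a finite positive supremum. Cutting off at a large height
  provides one without dropping the integral to \<open>v\<close> or below, and writing it as
  \<open>1 / a ^ Suc j\<close> puts it in the form in which \<open>power_mean_le\<close> expresses
  levels.\<close>

lemma obtain_bounded_truncation:
  fixes f :: "real \<Rightarrow> ennreal"
  assumes [measurable]: "f \<in> borel_measurable borel" and less: "v < (\<integral>\<^sup>+x. f x \<partial>lborel)"
  obtains F a where "F \<in> borel_measurable borel" "\<And>x. F x \<le> f x" "v < (\<integral>\<^sup>+x. F x \<partial>lborel)"
    "0 < a" "(SUP x. F x) = ennreal (1 / a ^ Suc j)"
proof -
  obtain n where n: "v < (\<integral>\<^sup>+x. min (f x) (of_nat n) \<partial>lborel)"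
    using less nn_integral_min_of_nat[of f lborel] by (auto simp: less_SUP_iff)
  let ?F = "\<lambda>x. min (f x) (of_nat n)"
  have "(SUP x. ?F x) \<le> ennreal (real n)"
    by (rule SUP_least) (simp add: ennreal_of_nat_eq_real_of_nat)
  then obtain A where A: "0 \<le> A" "(SUP x. ?F x) = ennreal A"
    by (cases "SUP x. ?F x") (auto simp: top_unique)
  have "A \<noteq> 0"
  proof
    assume "A = 0"
    then have "?F x = 0" for x using A(2) SUP_upper[of x UNIV ?F] by simp
    then show False using n by simp
  qed
  then have A0: "0 < A" using A by simp
  let ?a = "root (Suc j) (1 / A)"
  show thesis
  proof (rule that[of ?F ?a])
    show "(SUP x. ?F x) = ennreal (1 / ?a ^ Suc j)"
      using A A0 by (simp del: power_Suc)
  qed (use n A0 in \<open>auto simp del: power_Suc\<close>)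
qed

text \<open>At relative level \<open>t\<close>, Brunn--Minkowski bounds the length of
  \<open>{h \<ge> H t}\<close> below by the weighted mean of the lengths for \<open>F\<close> and
  \<open>G\<close>, where \<open>H\<close> is the power mean of the two suprema. Integration over
  \<open>t\<close> gives a linear inequality, and the perspective inequality trades it for the power
  mean of the integrals at the cost of one power.\<close>

lemma borell_brascamp_lieb_real:
  fixes f g h :: "real \<Rightarrow> ennreal"
  assumes [measurable]: "f \<in> borel_measurable borel" "g \<in> borel_measurable borel" "h \<in> borel_measurable borel"
    and \<mu>: "0 < \<mu>" "\<mu> < 1"
    and le: "\<And>x y. power_mean_le (Suc j) \<mu> (f x) (g y) (h ((1 - \<mu>) * x + \<mu> * y))"
  shows "power_mean_le j \<mu> (\<integral>\<^sup>+x. f x \<partial>lborel) (\<integral>\<^sup>+x. g x \<partial>lborel) (\<integral>\<^sup>+x. h x \<partial>lborel)"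
  unfolding power_mean_le_def
proof (intro allI impI)
  fix P Q :: real
  assume PQ: "0 < P" "0 < Q"
    and lf: "ennreal (1 / P ^ j) < (\<integral>\<^sup>+x. f x \<partial>lborel)" and lg: "ennreal (1 / Q ^ j) < (\<integral>\<^sup>+x. g x \<partial>lborel)"
  obtain F a where F[measurable]: "F \<in> borel_measurable borel" and Ff: "\<And>x. F x \<le> f x"
    and lF: "ennreal (1 / P ^ j) < (\<integral>\<^sup>+x. F x \<partial>lborel)" and a: "0 < a" "(SUP x. F x) = ennreal (1 / a ^ Suc j)"
    using obtain_bounded_truncation[OF assms(1) lf] by metis
  obtain G b where G[measurable]: "G \<in> borel_measurable borel" and Gg: "\<And>x. G x \<le> g x"
    and lG: "ennreal (1 / Q ^ j) < (\<integral>\<^sup>+x. G x \<partial>lborel)" and b: "0 < b" "(SUP x. G x) = ennreal (1 / b ^ Suc j)"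
    using obtain_bounded_truncation[OF assms(2) lg] by metis
  define A B c where "A = 1 / a ^ Suc j" and "B = 1 / b ^ Suc j" and "c = (1 - \<mu>) * a + \<mu> * b"
  have pos: "0 < A" "0 < B" "0 < c"
    using a b \<mu> by (auto simp: A_def B_def c_def add_pos_pos simp del: power_Suc)
  define H where "H = 1 / c ^ Suc j"
  have H: "0 < H" using pos by (simp add: H_def del: power_Suc)
  have FA: "F x \<le> ennreal A" and GB: "G x \<le> ennreal B" for x
    using SUP_upper[of x UNIV F] SUP_upper[of x UNIV G] a b by (auto simp: A_def B_def)
  define \<phi> \<gamma> where "\<phi> = (\<lambda>t. emeasure lborel {x. ennreal (A * t) < F x})"
    and "\<gamma> = (\<lambda>t. emeasure lborel {x. ennreal (B * t) < G x})"
  have [measurable]: "\<phi> \<in> borel_measurable borel" "\<gamma> \<in> borel_measurable borel"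
    unfolding \<phi>_def \<gamma>_def by measurable
  have intF: "(\<integral>\<^sup>+x. F x \<partial>lborel) = ennreal A * (\<integral>\<^sup>+t\<in>{0<..<1}. \<phi> t \<partial>lborel)"
    unfolding \<phi>_def by (rule layer_cake_normalized) (use pos FA in auto)
  have intG: "(\<integral>\<^sup>+x. G x \<partial>lborel) = ennreal B * (\<integral>\<^sup>+t\<in>{0<..<1}. \<gamma> t \<partial>lborel)"
    unfolding \<gamma>_def by (rule layer_cake_normalized) (use pos GB in auto)
  have key: "ennreal (1 - \<mu>) * \<phi> t + ennreal \<mu> * \<gamma> t \<le> emeasure lborel {x. ennreal (H * t) \<le> h x}"
    if t: "0 < t" "t < 1" for t
    unfolding \<phi>_def \<gamma>_def
  proof (rule brunn_minkowski_real)
    have "ennreal (A * t) < ennreal A" using pos t by (intro ennreal_lessI) auto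
    then show "{x. ennreal (A * t) < F x} \<noteq> {}"
      using less_SUP_iff[of "ennreal (A * t)" F UNIV] a(2) by (auto simp: A_def simp del: power_Suc)
    have "ennreal (B * t) < ennreal B" using pos t by (intro ennreal_lessI) auto
    then show "{x. ennreal (B * t) < G x} \<noteq> {}"
      using less_SUP_iff[of "ennreal (B * t)" G UNIV] b(2) by (auto simp: B_def simp del: power_Suc)
    fix x y assume x: "x \<in> {x. ennreal (A * t) < F x}" and y: "y \<in> {x. ennreal (B * t) < G x}"
    \<comment> \<open>Since \<open>\<sigma> ^ Suc j = 1 / t\<close>, passing to relative level
      \<open>t\<close> multiplies \<open>a\<close>, \<open>b\<close> and hence their mean
      \<open>c\<close> by the same factor \<open>\<sigma>\<close>.\<close>
    define \<sigma> where "\<sigma> = root (Suc j) (1 / t)"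
    have \<sigma>: "0 < \<sigma>" "\<sigma> ^ Suc j = 1 / t" using t by (auto simp: \<sigma>_def simp del: power_Suc)
    have e: "1 / (z * \<sigma>) ^ Suc j = 1 / z ^ Suc j * t" for z
      using \<sigma> t by (simp add: power_mult_distrib del: power_Suc)
    have "ennreal (1 / (a * \<sigma>) ^ Suc j) < f x"
      unfolding e using x Ff[of x] by (auto simp: A_def simp del: power_Suc)
    moreover have "ennreal (1 / (b * \<sigma>) ^ Suc j) < g y"
      unfolding e using y Gg[of y] by (auto simp: B_def simp del: power_Suc)
    ultimately have "ennreal (1 / ((1 - \<mu>) * (a * \<sigma>) + \<mu> * (b * \<sigma>)) ^ Suc j) \<le> h ((1 - \<mu>) * x + \<mu> * y)"
      using a b \<sigma> by (intro power_mean_leD[OF le]) auto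
    also have "(1 - \<mu>) * (a * \<sigma>) + \<mu> * (b * \<sigma>) = c * \<sigma>" by (simp add: c_def algebra_simps)
    finally show "(1 - \<mu>) * x + \<mu> * y \<in> {x. ennreal (H * t) \<le> h x}"
      unfolding e by (simp add: H_def del: power_Suc)
  qed (use \<mu> in auto)
  have "ennreal H * ((\<integral>\<^sup>+t\<in>{0<..<1}. (ennreal (1 - \<mu>) * \<phi> t + ennreal \<mu> * \<gamma> t) \<partial>lborel))
      \<le> ennreal \<bar>H\<bar> * (\<integral>\<^sup>+t. emeasure lborel {x. ennreal (0 + H * t) \<le> h x} * indicator {0<..} (0 + H * t) \<partial>lborel)"
  proof (rule mult_mono)
    show "(\<integral>\<^sup>+t\<in>{0<..<1}. (ennreal (1 - \<mu>) * \<phi> t + ennreal \<mu> * \<gamma> t) \<partial>lborel)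
      \<le> (\<integral>\<^sup>+t. emeasure lborel {x. ennreal (0 + H * t) \<le> h x} * indicator {0<..} (0 + H * t) \<partial>lborel)"
      using H key by (intro nn_integral_mono) (auto simp: indicator_def)
  qed (use H in auto)
  also have "\<dots> = (\<integral>\<^sup>+t\<in>{0<..}. emeasure lborel {x. ennreal t \<le> h x} \<partial>lborel)"
    using H by (intro nn_integral_real_affine[symmetric]) auto
  also have "\<dots> = (\<integral>\<^sup>+x. h x \<partial>lborel)"
    by (subst lborel.layer_cake_le) auto
  finally have h: "ennreal H * ((\<integral>\<^sup>+t\<in>{0<..<1}. (ennreal (1 - \<mu>) * \<phi> t + ennreal \<mu> * \<gamma> t) \<partial>lborel)) \<le> (\<integral>\<^sup>+x. h x \<partial>lborel)" .
  \<comment> \<open>The perspective inequality has \<open>c ^ Suc j\<close> in its numerator, which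
    is exactly \<open>1 / H\<close>.\<close>
  have "ennreal (1 / ((1 - \<mu>) * P + \<mu> * Q) ^ j)
      \<le> ennreal (H * ((1 - \<mu>) * (a ^ Suc j / P ^ j) + \<mu> * (b ^ Suc j / Q ^ j)))"
    using perspective_power_le[OF a(1) b(1) PQ \<mu>, of j] pos(3)
    by (intro ennreal_leI) (simp add: H_def c_def[symmetric] pos_le_divide_eq del: power_Suc)
  also have "\<dots> = ennreal H * (ennreal (1 - \<mu>) * (ennreal (a ^ Suc j) * ennreal (1 / P ^ j))
       + ennreal \<mu> * (ennreal (b ^ Suc j) * ennreal (1 / Q ^ j)))"
    using H \<mu> a b PQ by (simp add: ennreal_mult[symmetric] ennreal_plus[symmetric] del: ennreal_plus power_Suc)
  also have "\<dots> \<le> ennreal H * (ennreal (1 - \<mu>) * (\<integral>\<^sup>+t\<in>{0<..<1}. \<phi> t \<partial>lborel)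
       + ennreal \<mu> * (\<integral>\<^sup>+t\<in>{0<..<1}. \<gamma> t \<partial>lborel))"
  proof (intro mult_left_mono add_mono)
    have 1: "ennreal (z ^ Suc j) * (ennreal (1 / z ^ Suc j) * w) = w" if "0 < z" for z w
      using that by (simp add: mult.assoc[symmetric] ennreal_mult[symmetric] del: power_Suc)
    show "ennreal (a ^ Suc j) * ennreal (1 / P ^ j) \<le> (\<integral>\<^sup>+t\<in>{0<..<1}. \<phi> t \<partial>lborel)"
      using mult_left_mono[OF less_imp_le[OF lF], of "ennreal (a ^ Suc j)"] unfolding intF A_def 1[OF a(1)] by simp
    show "ennreal (b ^ Suc j) * ennreal (1 / Q ^ j) \<le> (\<integral>\<^sup>+t\<in>{0<..<1}. \<gamma> t \<partial>lborel)"
      using mult_left_mono[OF less_imp_le[OF lG], of "ennreal (b ^ Suc j)"] unfolding intG B_def 1[OF b(1)] by simp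
  qed auto
  also have "ennreal (1 - \<mu>) * (\<integral>\<^sup>+t\<in>{0<..<1}. \<phi> t \<partial>lborel) + ennreal \<mu> * (\<integral>\<^sup>+t\<in>{0<..<1}. \<gamma> t \<partial>lborel)
      = (\<integral>\<^sup>+t\<in>{0<..<1}. (ennreal (1 - \<mu>) * \<phi> t + ennreal \<mu> * \<gamma> t) \<partial>lborel)"
    by (simp add: nn_integral_cmult[symmetric] nn_integral_add[symmetric] distrib_right mult.assoc)
  finally show "ennreal (1 / ((1 - \<mu>) * P + \<mu> * Q) ^ j) \<le> (\<integral>\<^sup>+x. h x \<partial>lborel)"
    using h by (rule order_trans)
qed

interpretation lborel_PiM: product_sigma_finite "\<lambda>_. lborel :: 'a::euclidean_space measure" ..

text \<open>Induction on the coordinates: each inner integration is an instance of the inequality on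
  the line and lowers the exponent by one. The hypothesis is asked for extensional functions only,
  these being the points of the product space.\<close>

lemma borell_brascamp_lieb_PiM:
  fixes f g h :: "('i \<Rightarrow> real) \<Rightarrow> ennreal"
  assumes "finite I"
    and "f \<in> borel_measurable (Pi\<^sub>M I (\<lambda>_. lborel))" "g \<in> borel_measurable (Pi\<^sub>M I (\<lambda>_. lborel))"
      "h \<in> borel_measurable (Pi\<^sub>M I (\<lambda>_. lborel))"
    and \<mu>: "0 < \<mu>" "\<mu> < 1"
    and "\<And>x y. x \<in> extensional I \<Longrightarrow> y \<in> extensional I \<Longrightarrow>
      power_mean_le (card I + j) \<mu> (f x) (g y) (h (\<lambda>i. (1 - \<mu>) * x i + \<mu> * y i))"
  shows "power_mean_le j \<mu> (\<integral>\<^sup>+x. f x \<partial>Pi\<^sub>M I (\<lambda>_. lborel)) (\<integral>\<^sup>+x. g x \<partial>Pi\<^sub>M I (\<lambda>_. lborel))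
    (\<integral>\<^sup>+x. h x \<partial>Pi\<^sub>M I (\<lambda>_. lborel))"
  using assms(1-4,7)
proof (induction I arbitrary: f g h rule: finite_induct)
  case empty
  \<comment> \<open>A convex combination of \<open>undefined\<close> with itself is
    \<open>undefined\<close>, so combinations of extensional functions stay extensional.\<close>
  have "(\<lambda>i. (1 - \<mu>) * undefined + \<mu> * undefined) = (\<lambda>i::'i. undefined :: real)"
    by (simp add: algebra_simps)
  then show ?case using empty(4)[of "\<lambda>_. undefined" "\<lambda>_. undefined"]
    by (simp add: PiM_empty nn_integral_count_space_finite)
next
  case (insert i I)
  note [measurable] = insert.prems(1-3)
  have comb: "(\<lambda>k. (1 - \<mu>) * x k + \<mu> * y k)(i := (1 - \<mu>) * s + \<mu> * t) =
      (\<lambda>k. (1 - \<mu>) * (x(i := s)) k + \<mu> * (y(i := t)) k)" for x y :: "'i \<Rightarrow> real" and s t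
    by auto
  have upd: "(\<lambda>s. F (x(i := s))) \<in> borel_measurable borel"
    if x: "x \<in> extensional I" and [measurable]: "F \<in> borel_measurable (Pi\<^sub>M (insert i I) (\<lambda>_. lborel))"
    for x :: "'i \<Rightarrow> real" and F :: "_ \<Rightarrow> ennreal"
  proof -
    have "(\<lambda>s. x(i := s)) \<in> measurable borel (Pi\<^sub>M (insert i I) (\<lambda>_. lborel))"
      using x by (intro measurable_PiM_single') (auto simp: extensional_def PiE_iff)
    then show ?thesis by measurable
  qed
  have ext: "(\<lambda>k. (1 - \<mu>) * x k + \<mu> * y k) \<in> extensional I"
    if "x \<in> extensional I" "y \<in> extensional I" for x y :: "'i \<Rightarrow> real"
    using that by (auto simp: extensional_def algebra_simps)
  have "power_mean_le j \<mu>
      (\<integral>\<^sup>+x. (\<integral>\<^sup>+s. f (x(i := s)) \<partial>lborel) \<partial>Pi\<^sub>M I (\<lambda>_. lborel))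
      (\<integral>\<^sup>+x. (\<integral>\<^sup>+s. g (x(i := s)) \<partial>lborel) \<partial>Pi\<^sub>M I (\<lambda>_. lborel))
      (\<integral>\<^sup>+x. (\<integral>\<^sup>+s. h (x(i := s)) \<partial>lborel) \<partial>Pi\<^sub>M I (\<lambda>_. lborel))"
  proof (rule insert.IH)
    fix x y :: "'i \<Rightarrow> real" assume xy: "x \<in> extensional I" "y \<in> extensional I"
    show "power_mean_le (card I + j) \<mu> (\<integral>\<^sup>+s. f (x(i := s)) \<partial>lborel) (\<integral>\<^sup>+s. g (y(i := s)) \<partial>lborel)
      (\<integral>\<^sup>+s. h ((\<lambda>k. (1 - \<mu>) * x k + \<mu> * y k)(i := s)) \<partial>lborel)"
    proof (rule borell_brascamp_lieb_real)
      fix s t :: real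
      have "x(i := s) \<in> extensional (insert i I)" "y(i := t) \<in> extensional (insert i I)"
        using xy by (auto simp: extensional_def)
      from insert.prems(4)[OF this] show "power_mean_le (Suc (card I + j)) \<mu> (f (x(i := s))) (g (y(i := t)))
        (h ((\<lambda>k. (1 - \<mu>) * x k + \<mu> * y k)(i := (1 - \<mu>) * s + \<mu> * t)))"
        unfolding comb using insert.hyps by (simp add: fun_upd_def)
    qed (use \<mu> xy ext upd insert.prems in auto)
  qed measurable
  then show ?case
    using insert.hyps by (simp add: lborel_PiM.product_nn_integral_insert)
qed

text \<open>For \<open>p = q\<close> the mean is \<open>p\<close> itself, and since \<open>j\<close>
  is positive every positive level has the form \<open>1 / p ^ j\<close>.\<close>

lemma power_mean_le_min:
  assumes le: "power_mean_le j \<mu> a b c" and j: "0 < j" and \<mu>: "0 < \<mu>" "\<mu> < 1"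
  shows "min a b \<le> c"
proof (rule dense_le)
  fix v assume v: "v < min a b"
  show "v \<le> c"
  proof (cases v)
    case (real r)
    show ?thesis
    proof (cases "r = 0")
      case False
      then have r: "0 < r" using real by simp
      let ?p = "root j (1 / r)"
      have p: "0 < ?p" "1 / ?p ^ j = r" using r j by auto
      have "(1 - \<mu>) * ?p + \<mu> * ?p = ?p" by (simp add: algebra_simps)
      then show ?thesis
        using power_mean_leD[OF le p(1) p(1)] p(2) v real by (simp add: min_less_iff_conj)
    qed (use real in simp)
  qed (use v in auto)
qed

section \<open>Fubini along lines\<close>

lemma nn_integral_lborel_translate:
  fixes F :: "'a::euclidean_space \<Rightarrow> ennreal"
  assumes [measurable]: "F \<in> borel_measurable borel"
  shows "(\<integral>\<^sup>+x. F (c + x) \<partial>lborel) = (\<integral>\<^sup>+x. F x \<partial>lborel)"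
  using nn_integral_distr[of "(+) c" lborel borel F] by (simp add: lborel_distr_plus)

lemma nn_integral_lborel_reflect:
  fixes F :: "'a::euclidean_space \<Rightarrow> ennreal"
  assumes [measurable]: "F \<in> borel_measurable borel"
  shows "(\<integral>\<^sup>+x. F (c - x) \<partial>lborel) = (\<integral>\<^sup>+x. F x \<partial>lborel)"
proof -
  have "distr lborel borel (\<lambda>x. c - x) = (lborel :: 'a measure)"
    using lborel_affine[of "-1" c] by (simp add: density_1)
  then show ?thesis
    using nn_integral_distr[of "\<lambda>x. c - x" lborel borel F] by simp
qed

text \<open>Uniqueness of Haar measure, by comparing both measures with the unit ball through a double integral.\<close>

lemma emeasure_lborel_orthogonal_vimage:
  fixes T :: "'a::euclidean_space \<Rightarrow> 'a"
  assumes T: "orthogonal_transformation T" and A[measurable]: "A \<in> sets borel"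
  shows "emeasure lborel {x. T x \<in> A} = emeasure lborel A"
proof -
  have lin: "linear T" using T by (rule orthogonal_transformation_linear)
  have surj: "surj T"
    using lin orthogonal_transformation_inj[OF T] by (rule linear_inj_imp_surj)
  have [measurable]: "T \<in> borel_measurable borel"
    using lin by (intro borel_measurable_continuous_onI linear_continuous_on linear_conv_bounded_linear[THEN iffD1])
  let ?B = "ball (0::'a) 1"
  have [measurable]: "?B \<in> sets borel" by simp
  have TB: "indicator ?B (T x) = (indicator ?B x :: ennreal)" for x
    using orthogonal_transformation_norm[OF T] by (simp add: indicator_def)
  have "emeasure lborel ?B * emeasure lborel {x. T x \<in> A} =
      (\<integral>\<^sup>+z. indicator A (T z) * (\<integral>\<^sup>+y. indicator ?B y \<partial>lborel) \<partial>lborel)"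
  proof -
    have "(\<integral>\<^sup>+z. indicator A (T z) \<partial>lborel) = (\<integral>\<^sup>+z. indicator {x. T x \<in> A} z \<partial>lborel)"
      by (intro nn_integral_cong) (simp add: indicator_def)
    then show ?thesis by (simp add: nn_integral_multc mult.commute)
  qed
  also have "\<dots> = (\<integral>\<^sup>+z. indicator A (T z) * (\<integral>\<^sup>+y. indicator ?B (T z - y) \<partial>lborel) \<partial>lborel)"
    by (subst nn_integral_lborel_reflect) (auto intro: borel_measurable_indicator)
  also have "\<dots> = (\<integral>\<^sup>+z. \<integral>\<^sup>+y. indicator A (T z) * indicator ?B (T z - y) \<partial>lborel \<partial>lborel)"
    by (intro nn_integral_cong nn_integral_cmult[symmetric]) measurable
  also have "\<dots> = (\<integral>\<^sup>+y. \<integral>\<^sup>+z. indicator A (T z) * indicator ?B (T z - y) \<partial>lborel \<partial>lborel)"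
    by (rule lborel_pair.Fubini') measurable
  also have "\<dots> = (\<integral>\<^sup>+y. \<integral>\<^sup>+z. indicator A (y + T z) * indicator ?B z \<partial>lborel \<partial>lborel)"
  proof (rule nn_integral_cong)
    fix y
    obtain c where c: "y = T c" using surj by auto
    have "(\<integral>\<^sup>+z. indicator A (T z) * indicator ?B (T z - y) \<partial>lborel) =
      (\<integral>\<^sup>+z. indicator A (T (c + z)) * indicator ?B (T (c + z) - y) \<partial>lborel)"
      by (subst nn_integral_lborel_translate[where c=c]) auto
    then show "(\<integral>\<^sup>+z. indicator A (T z) * indicator ?B (T z - y) \<partial>lborel) =
      (\<integral>\<^sup>+z. indicator A (y + T z) * indicator ?B z \<partial>lborel)"
      by (simp add: c linear_add[OF lin] TB)
  qed
  also have "\<dots> = (\<integral>\<^sup>+z. \<integral>\<^sup>+y. indicator A (y + T z) * indicator ?B z \<partial>lborel \<partial>lborel)"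
    by (rule lborel_pair.Fubini') measurable
  also have "\<dots> = (\<integral>\<^sup>+z. (\<integral>\<^sup>+y. indicator A (T z + y) \<partial>lborel) * indicator ?B z \<partial>lborel)"
    by (simp add: nn_integral_multc add.commute)
  also have "\<dots> = emeasure lborel A * emeasure lborel ?B"
    by (subst nn_integral_lborel_translate) (auto simp: nn_integral_cmult)
  finally have eq: "emeasure lborel ?B * emeasure lborel {x. T x \<in> A} = emeasure lborel ?B * emeasure lborel A"
    by (simp add: mult.commute)
  have "unit_ball_vol (real DIM('a)) \<noteq> 0"
    using unit_ball_vol_pos[of "real DIM('a)"] by (metis less_irrefl of_nat_0_le_iff)
  then have "emeasure lborel ?B \<noteq> 0"
    using emeasure_ball[of 1 "0::'a"] by simp
  moreover have "emeasure lborel ?B \<noteq> top"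
    using emeasure_ball[of 1 "0::'a"] by simp
  ultimately show ?thesis using eq by (auto simp: ennreal_mult_cancel_left)
qed

lemma borel_measurable_orthogonal:
  fixes T :: "'a::euclidean_space \<Rightarrow> 'a"
  assumes "orthogonal_transformation T"
  shows "T \<in> borel_measurable borel"
  using orthogonal_transformation_linear[OF assms]
  by (intro borel_measurable_continuous_onI linear_continuous_on linear_conv_bounded_linear[THEN iffD1])

lemma nn_integral_lborel_orthogonal:
  fixes T :: "'a::euclidean_space \<Rightarrow> 'a"
  assumes T: "orthogonal_transformation T" and [measurable]: "F \<in> borel_measurable borel"
  shows "(\<integral>\<^sup>+x. F (T x) \<partial>lborel) = (\<integral>\<^sup>+x. F x \<partial>lborel)"
proof -
  note [measurable] = borel_measurable_orthogonal[OF T]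
  have "distr lborel borel T = lborel"
    by (rule measure_eqI) (auto simp: emeasure_distr vimage_def emeasure_lborel_orthogonal_vimage[OF T])
  then show ?thesis
    using nn_integral_distr[of T lborel borel F] by simp
qed

text \<open>The Householder reflection, for \<open>a\<close> of any length. Division by zero makes
  it the identity for \<open>a = 0\<close>, so that it is orthogonal without exception.\<close>

definition reflect_along :: "'a::euclidean_space \<Rightarrow> 'a \<Rightarrow> 'a" where
  "reflect_along a x = x - (2 * (x \<bullet> a) / (a \<bullet> a)) *\<^sub>R a"

lemma orthogonal_reflect_along: "orthogonal_transformation (reflect_along a)"
  unfolding orthogonal_transformation_def
proof (intro conjI allI)
  show "linear (reflect_along a)"
    unfolding reflect_along_def
    by (rule linearI) (simp_all add: inner_left_distrib distrib_left add_divide_distrib scaleR_left_distrib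
      scaleR_right_diff_distrib mult.left_commute)
  fix v w
  show "reflect_along a v \<bullet> reflect_along a w = v \<bullet> w"
    by (cases "a = 0") (simp_all add: reflect_along_def inner_diff_left inner_diff_right inner_commute)
qed

text \<open>Equal lengths give \<open>(b - e) \<bullet> (b - e) = 2 * (b \<bullet> (b - e))\<close>,
  so the coefficient of \<open>b - e\<close> is one. This supplies an orthogonal map from a basis
  vector to any prescribed unit vector.\<close>

lemma reflect_along_swap:
  assumes "norm b = norm e"
  shows "reflect_along (b - e) b = e"
proof (cases "b = e")
  case False
  have bb: "b \<bullet> b = e \<bullet> e" using assms by (simp add: norm_eq)
  have "(b - e) \<bullet> (b - e) = 2 * (b \<bullet> (b - e))"
    using bb by (simp add: inner_diff_left inner_diff_right inner_commute)
  moreover have "(b - e) \<bullet> (b - e) \<noteq> 0" using False by simp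
  ultimately show ?thesis by (simp add: reflect_along_def)
qed (simp add: reflect_along_def)

text \<open>Fubini along the lines parallel to the unit vector \<open>e\<close>: \<open>\<phi>\<close> parametrises the hyperplane
  orthogonal to \<open>e\<close> by the product space over \<open>U\<close>.\<close>

locale line_split =
  fixes e :: "'a::euclidean_space" and U :: "'a set" and \<phi> :: "('a \<Rightarrow> real) \<Rightarrow> 'a"
  assumes norm_e: "norm e = 1"
    and finite_U: "finite U" and card_U: "Suc (card U) = DIM('a)"
    and \<phi>_inner: "\<phi> u \<bullet> e = 0"
    and \<phi>_linear: "\<phi> (\<lambda>i. a * u i + b * v i) = a *\<^sub>R \<phi> u + b *\<^sub>R \<phi> v"
    and \<phi>_measurable [measurable]: "\<phi> \<in> borel_measurable (Pi\<^sub>M U (\<lambda>_. lborel))"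
    and nn_integral_split: "F \<in> borel_measurable borel \<Longrightarrow>
      (\<integral>\<^sup>+x. F x \<partial>lborel) = (\<integral>\<^sup>+u. \<integral>\<^sup>+s. F (\<phi> u + s *\<^sub>R e) \<partial>lborel \<partial>Pi\<^sub>M U (\<lambda>_. lborel))"

lemma nn_integral_lborel_PiM_Basis:
  fixes F :: "'a::euclidean_space \<Rightarrow> ennreal"
  assumes [measurable]: "F \<in> borel_measurable borel"
  shows "(\<integral>\<^sup>+x. F x \<partial>lborel) = (\<integral>\<^sup>+f. F (\<Sum>b\<in>Basis. f b *\<^sub>R b) \<partial>Pi\<^sub>M Basis (\<lambda>_. lborel))"
  unfolding lborel_def[where 'a='a] lborel_eq_real[symmetric] by (subst nn_integral_distr) auto

text \<open>Reflect a basis vector onto \<open>e\<close>. The images of the other basis vectors span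
  the orthogonal hyperplane, and invariance of Lebesgue measure under the reflection turns Fubini in
  coordinates into Fubini along \<open>e\<close>.\<close>

lemma line_split_exists:
  fixes e :: "'a::euclidean_space"
  assumes e: "norm e = 1"
  shows "\<exists>U \<phi>. line_split e U \<phi>"
proof -
  obtain b :: 'a where b: "b \<in> Basis" using nonempty_Basis by blast
  define T where "T = reflect_along (b - e)"
  have T: "orthogonal_transformation T" and Tb: "T b = e"
    using e b by (auto simp: T_def orthogonal_reflect_along reflect_along_swap)
  have lin: "linear T" using T by (rule orthogonal_transformation_linear)
  note [measurable] = borel_measurable_orthogonal[OF T]
  define U where "U = Basis - {b}"
  define \<phi> where "\<phi> = (\<lambda>u. \<Sum>c\<in>U. u c *\<^sub>R T c)"
  have Ub: "insert b U = Basis" "b \<notin> U" "finite U" using b by (auto simp: U_def)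
  have "line_split e U \<phi>"
  proof
    show "norm e = 1" "finite U" using e Ub by auto
    show "Suc (card U) = DIM('a)" using Ub by (metis card_insert_disjoint)
    show "\<phi> u \<bullet> e = 0" for u
    proof -
      have "T c \<bullet> e = 0" if "c \<in> U" for c
        using T that b unfolding Tb[symmetric] orthogonal_transformation_def by (auto simp: U_def inner_not_same_Basis)
      then show ?thesis by (simp add: \<phi>_def inner_sum_left)
    qed
    show "\<phi> (\<lambda>i. x * u i + y * v i) = x *\<^sub>R \<phi> u + y *\<^sub>R \<phi> v" for x y u v
      by (simp add: \<phi>_def scaleR_sum_right sum.distrib scaleR_add_left)
    show [measurable]: "\<phi> \<in> borel_measurable (Pi\<^sub>M U (\<lambda>_. lborel))"
      unfolding \<phi>_def by (intro borel_measurable_sum borel_measurable_scaleR) auto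
    fix F :: "'a \<Rightarrow> ennreal" assume [measurable]: "F \<in> borel_measurable borel"
    have "(\<integral>\<^sup>+x. F x \<partial>lborel) = (\<integral>\<^sup>+x. F (T x) \<partial>lborel)"
      by (rule nn_integral_lborel_orthogonal[symmetric, OF T]) simp
    also have "\<dots> = (\<integral>\<^sup>+f. F (T (\<Sum>b\<in>Basis. f b *\<^sub>R b)) \<partial>Pi\<^sub>M (insert b U) (\<lambda>_. lborel))"
      unfolding Ub by (rule nn_integral_lborel_PiM_Basis) simp
    also have "\<dots> = (\<integral>\<^sup>+u. \<integral>\<^sup>+s. F (T (\<Sum>c\<in>Basis. (u(b := s)) c *\<^sub>R c)) \<partial>lborel \<partial>Pi\<^sub>M U (\<lambda>_. lborel))"
    proof (rule lborel_PiM.product_nn_integral_insert)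
      show "(\<lambda>f. F (T (\<Sum>b\<in>Basis. f b *\<^sub>R b))) \<in> borel_measurable (Pi\<^sub>M (insert b U) (\<lambda>_. lborel))"
        unfolding Ub by measurable
    qed (use Ub in auto)
    also have "\<dots> = (\<integral>\<^sup>+u. \<integral>\<^sup>+s. F (\<phi> u + s *\<^sub>R e) \<partial>lborel \<partial>Pi\<^sub>M U (\<lambda>_. lborel))"
    proof -
      have "T (\<Sum>c\<in>Basis. (u(b := s)) c *\<^sub>R c) = \<phi> u + s *\<^sub>R e" for u s
      proof -
      have "(\<Sum>c\<in>Basis. (u(b := s)) c *\<^sub>R c) = s *\<^sub>R b + (\<Sum>c\<in>U. u c *\<^sub>R c)"
        unfolding Ub(1)[symmetric] using Ub(2,3) by (auto intro!: sum.cong)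
        then show ?thesis
          by (simp add: linear_add[OF lin] linear_scale[OF lin] linear_sum[OF lin] Tb \<phi>_def)
      qed
      then show ?thesis by simp
    qed
    finally show "(\<integral>\<^sup>+x. F x \<partial>lborel) = (\<integral>\<^sup>+u. \<integral>\<^sup>+s. F (\<phi> u + s *\<^sub>R e) \<partial>lborel \<partial>Pi\<^sub>M U (\<lambda>_. lborel))" .
  qed
  then show ?thesis by blast
qed

context line_split begin

sublocale U: finite_product_sigma_finite "\<lambda>_. lborel :: real measure" U
  by standard (rule finite_U)

interpretation PU: product_sigma_finite "\<lambda>_::'k. Pi\<^sub>M U (\<lambda>_. lborel :: real measure)"
  by standard

lemma e_inner_e: "e \<bullet> e = 1"
  using norm_e by (simp add: norm_eq_1)

lemma measurable_PiM_line [measurable]: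
  "(\<lambda>(Y, t) i. \<phi> (Y i) + t i *\<^sub>R e) \<in> measurable
    (Pi\<^sub>M (UNIV::'k::finite set) (\<lambda>_. Pi\<^sub>M U (\<lambda>_. lborel)) \<Otimes>\<^sub>M Pi\<^sub>M UNIV (\<lambda>_. lborel)) (Pi\<^sub>M UNIV (\<lambda>_. lborel))"
proof (rule measurable_PiM_single')
  fix i :: 'k
  have 1: "(\<lambda>p. fst p i) \<in> measurable (Pi\<^sub>M (UNIV::'k set) (\<lambda>_. Pi\<^sub>M U (\<lambda>_. lborel)) \<Otimes>\<^sub>M Pi\<^sub>M (UNIV::'k set) (\<lambda>_. lborel::real measure))
      (Pi\<^sub>M U (\<lambda>_. lborel :: real measure))"
    by measurable
  have 2: "(\<lambda>p. snd p i) \<in> borel_measurable (Pi\<^sub>M (UNIV::'k set) (\<lambda>_. Pi\<^sub>M U (\<lambda>_. lborel :: real measure)) \<Otimes>\<^sub>M Pi\<^sub>M (UNIV::'k set) (\<lambda>_. lborel::real measure))"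
    by measurable
  show "(\<lambda>p. (case p of (Y, t) \<Rightarrow> \<lambda>i. \<phi> (Y i) + t i *\<^sub>R e) i) \<in> measurable
    (Pi\<^sub>M (UNIV::'k set) (\<lambda>_. Pi\<^sub>M U (\<lambda>_. lborel)) \<Otimes>\<^sub>M Pi\<^sub>M UNIV (\<lambda>_. lborel)) lborel"
    using measurable_compose[OF 1 \<phi>_measurable] 2 by (simp add: case_prod_beta)
qed auto

text \<open>All vectors of the family are split simultaneously. It suffices to compare measures on
  boxes, where both sides factor and each factor is the splitting of a single vector.\<close>

lemma nn_integral_PiM_split:
  fixes F :: "('k::finite \<Rightarrow> 'a) \<Rightarrow> ennreal"
  assumes [measurable]: "F \<in> borel_measurable (Pi\<^sub>M UNIV (\<lambda>_. lborel))"
  shows "(\<integral>\<^sup>+x. F x \<partial>Pi\<^sub>M UNIV (\<lambda>_. lborel)) =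
    (\<integral>\<^sup>+Y. \<integral>\<^sup>+t. F (\<lambda>i. \<phi> (Y i) + t i *\<^sub>R e) \<partial>Pi\<^sub>M UNIV (\<lambda>_. lborel) \<partial>Pi\<^sub>M UNIV (\<lambda>_. Pi\<^sub>M U (\<lambda>_. lborel)))"
proof -
  let ?V = "UNIV :: 'k set"
  let ?M = "Pi\<^sub>M ?V (\<lambda>_. Pi\<^sub>M U (\<lambda>_. lborel :: real measure))" and ?K = "Pi\<^sub>M ?V (\<lambda>_. lborel :: real measure)"
  let ?q = "\<lambda>(Y, t) i. \<phi> (Y i) + t i *\<^sub>R e"
  interpret K: finite_product_sigma_finite "\<lambda>_. lborel :: real measure" ?V by standard simp
  have q[measurable]: "?q \<in> measurable (?M \<Otimes>\<^sub>M ?K) (Pi\<^sub>M ?V (\<lambda>_. lborel))" by (rule measurable_PiM_line)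
  have "distr (?M \<Otimes>\<^sub>M ?K) (Pi\<^sub>M ?V (\<lambda>_. lborel)) ?q = Pi\<^sub>M ?V (\<lambda>_. lborel)"
  proof (rule lborel_PiM.PiM_eqI)
    fix A :: "'k \<Rightarrow> 'a set" assume A: "\<And>i. i \<in> ?V \<Longrightarrow> A i \<in> sets lborel"
    then have [measurable]: "A i \<in> sets borel" for i by simp
    have [measurable]: "Pi\<^sub>E ?V A \<in> sets (Pi\<^sub>M ?V (\<lambda>_. lborel))" using A by (intro sets_PiM_I_finite) auto
    have ind: "indicator (Pi\<^sub>E ?V A) x = (\<Prod>i\<in>?V. indicator (A i) (x i) :: ennreal)" for x
      by (auto simp: indicator_def PiE_iff)
    have "emeasure (distr (?M \<Otimes>\<^sub>M ?K) (Pi\<^sub>M ?V (\<lambda>_. lborel)) ?q) (Pi\<^sub>E ?V A)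
      = (\<integral>\<^sup>+z. indicator (Pi\<^sub>E ?V A) (?q z) \<partial>(?M \<Otimes>\<^sub>M ?K))"
      by (subst nn_integral_distr[OF q, symmetric]) auto
    also have "\<dots> = (\<integral>\<^sup>+Y. \<integral>\<^sup>+t. indicator (Pi\<^sub>E ?V A) (?q (Y, t)) \<partial>?K \<partial>?M)"
      by (rule K.nn_integral_fst[symmetric]) measurable
    also have "\<dots> = (\<integral>\<^sup>+Y. (\<Prod>i\<in>?V. \<integral>\<^sup>+s. indicator (A i) (\<phi> (Y i) + s *\<^sub>R e) \<partial>lborel) \<partial>?M)"
      unfolding ind by (auto intro!: nn_integral_cong lborel_PiM.product_nn_integral_prod)
    also have "\<dots> = (\<Prod>i\<in>?V. \<integral>\<^sup>+u. (\<integral>\<^sup>+s. indicator (A i) (\<phi> u + s *\<^sub>R e) \<partial>lborel) \<partial>Pi\<^sub>M U (\<lambda>_. lborel))"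
      by (rule PU.product_nn_integral_prod) auto
    also have "\<dots> = (\<Prod>i\<in>?V. emeasure lborel (A i))"
      by (intro prod.cong) (auto simp: nn_integral_split[symmetric])
    finally show "emeasure (distr (?M \<Otimes>\<^sub>M ?K) (Pi\<^sub>M ?V (\<lambda>_. lborel)) ?q) (Pi\<^sub>E ?V A) = (\<Prod>i\<in>?V. emeasure lborel (A i))" .
  qed auto
  then have "(\<integral>\<^sup>+x. F x \<partial>Pi\<^sub>M UNIV (\<lambda>_. lborel)) = (\<integral>\<^sup>+x. F x \<partial>distr (?M \<Otimes>\<^sub>M ?K) (Pi\<^sub>M ?V (\<lambda>_. lborel)) ?q)"
    by simp
  also have "\<dots> = (\<integral>\<^sup>+z. F (?q z) \<partial>(?M \<Otimes>\<^sub>M ?K))"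
    by (rule nn_integral_distr) auto
  also have "\<dots> = (\<integral>\<^sup>+Y. \<integral>\<^sup>+t. F (?q (Y, t)) \<partial>?K \<partial>?M)"
    by (rule K.nn_integral_fst[symmetric]) measurable
  finally show ?thesis by simp
qed

end

section \<open>Quasi-concavity of the measure of the polar\<close>

text \<open>The substitution is made on compact intervals away from zero, which exhaust the
  half-line.\<close>

lemma nn_integral_Ioi_inverse:
  fixes K :: "real \<Rightarrow> ennreal"
  assumes [measurable]: "K \<in> borel_measurable borel"
  shows "(\<integral>\<^sup>+s\<in>{0<..}. K s \<partial>lborel) = (\<integral>\<^sup>+r\<in>{0<..}. K (1 / r) * ennreal (1 / r\<^sup>2) \<partial>lborel)"
proof -
  define I where "I m = {1 / (real m + 2)..real m + 2}" for m
  have [measurable]: "I m \<in> sets borel" for m by (simp add: I_def)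
  have Ioi: "(\<Union>m. I m) = {0<..}"
  proof (intro equalityI subsetI)
    fix x :: real assume "x \<in> {0<..}"
    then have x: "0 < x" by simp
    obtain m where m: "max x (1 / x) \<le> real m" using real_arch_simple by blast
    have "1 / (real m + 2) \<le> x" using m x by (simp add: field_simps)
    then show "x \<in> (\<Union>m. I m)" using m by (auto simp: I_def intro!: exI[of _ m])
  qed (auto simp: I_def intro: less_le_trans[rotated])
  have inc: "incseq I"
    by (auto simp: incseq_def I_def field_simps intro: order_trans[rotated])
  have mono: "(\<integral>\<^sup>+x\<in>{0<..}. F x \<partial>lborel) = (SUP m. \<integral>\<^sup>+x\<in>I m. F x \<partial>lborel)"
    if [measurable]: "F \<in> borel_measurable borel" for F :: "real \<Rightarrow> ennreal"
  proof -
    have "(SUP m. F x * indicator (I m) x) = F x * indicator {0<..} x" for x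
    proof (rule antisym)
      show "(SUP m. F x * indicator (I m) x) \<le> F x * indicator {0<..} x"
        unfolding Ioi[symmetric] by (rule SUP_least) (auto simp: indicator_def)
      show "F x * indicator {0<..} x \<le> (SUP m. F x * indicator (I m) x)"
      proof (cases "x \<in> {0<..}")
        case True
        then obtain m where "x \<in> I m" unfolding Ioi[symmetric] by blast
        then show ?thesis using True by (intro SUP_upper2[of m]) auto
      qed simp
    qed
    moreover have "(\<integral>\<^sup>+x. (SUP m. F x * indicator (I m) x) \<partial>lborel) = (SUP m. \<integral>\<^sup>+x\<in>I m. F x \<partial>lborel)"
      using inc by (intro nn_integral_monotone_convergence_SUP)
        (auto simp: incseq_def le_fun_def indicator_def subset_iff)
    ultimately show ?thesis by simp
  qed
  have "(\<integral>\<^sup>+s\<in>I m. K s \<partial>lborel) = (\<integral>\<^sup>+r\<in>I m. K (1 / r) * ennreal (1 / r\<^sup>2) \<partial>lborel)" for m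
  proof -
    let ?a = "1 / (real m + 2)" and ?b = "real m + 2" and ?g = "\<lambda>x::real. - 1 / x"
    \<comment> \<open>The substitution rule takes a map with non-negative derivative; the sign
      change replaces the decreasing \<open>1 / x\<close> by the increasing
      \<open>- 1 / x\<close>.\<close>
    have "(\<integral>\<^sup>+s\<in>I m. K s \<partial>lborel) = (\<integral>\<^sup>+s. K (0 - s) * indicator (I m) (0 - s) \<partial>lborel)"
      by (rule nn_integral_lborel_reflect[symmetric]) measurable
    also have "\<dots> = (\<integral>\<^sup>+x. K (- x) * indicator {?g ?a..?g ?b} x \<partial>lborel)"
      by (intro nn_integral_cong) (auto simp: I_def indicator_def field_simps)
    also have "\<dots> = (\<integral>\<^sup>+x. K (- ?g x) * ennreal (1 / x\<^sup>2) * indicator {?a..?b} x \<partial>lborel)"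
    proof (rule nn_integral_substitution_aux)
      have "1 / (real m + 2) \<le> 1 / 2" by (simp add: field_simps)
      then show "?a < ?b" by linarith
      fix x assume x: "x \<in> {?a..?b}"
      have "0 < ?a" by simp
      then have "0 < x" using x by (meson atLeastAtMost_iff less_le_trans)
      then show "(?g has_real_derivative 1 / x\<^sup>2) (at x)"
        by (auto intro!: derivative_eq_intros simp: power2_eq_square)
    next
      have "0 \<notin> {?a..?b}" by (simp add: not_le)
      then show "continuous_on {?a..?b} (\<lambda>x. 1 / x\<^sup>2)"
        by (intro continuous_intros) auto
    qed auto
    finally show ?thesis by (simp add: I_def)
  qed
  then show ?thesis by (simp add: mono)
qed

lemma measurable_inner_family [measurable]:
  fixes x :: "'k::finite \<Rightarrow> 'a::euclidean_space"
  shows "(\<lambda>v i. x i \<bullet> v) \<in> measurable borel (Pi\<^sub>M UNIV (\<lambda>_. borel))"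
  by (rule measurable_PiM_single') auto

text \<open>With \<open>L\<close> the polar of \<open>C\<close> and \<open>\<psi>\<close> the
  density of the measure, this is the measure of the polar of
  \<open>[x_1 ... x_N] C\<close>.\<close>

definition slab_mass :: "('a::euclidean_space \<Rightarrow> ennreal) \<Rightarrow> ('k \<Rightarrow> real) set \<Rightarrow> ('k \<Rightarrow> 'a) \<Rightarrow> ennreal" where
  "slab_mass \<psi> L x = (\<integral>\<^sup>+v. \<psi> v * indicator L (\<lambda>i. x i \<bullet> v) \<partial>lborel)"

text \<open>Formulated for plain functions, because these are the points of the product measures to
  which it is applied.\<close>

definition convex_family :: "('k \<Rightarrow> real) set \<Rightarrow> bool" where
  "convex_family L \<longleftrightarrow> (\<forall>z\<in>L. \<forall>w\<in>L. \<forall>\<mu>. 0 < \<mu> \<longrightarrow> \<mu> < 1 \<longrightarrow> (\<lambda>i. (1 - \<mu>) * z i + \<mu> * w i) \<in> L)"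

lemma convex_familyD:
  "convex_family L \<Longrightarrow> z \<in> L \<Longrightarrow> w \<in> L \<Longrightarrow> 0 < \<mu> \<Longrightarrow> \<mu> < 1 \<Longrightarrow> (\<lambda>i. (1 - \<mu>) * z i + \<mu> * w i) \<in> L"
  by (simp add: convex_family_def)

definition symmetric_family :: "('k \<Rightarrow> real) set \<Rightarrow> bool" where
  "symmetric_family L \<longleftrightarrow> (\<forall>z\<in>L. (\<lambda>i. - z i) \<in> L)"

lemma symmetric_family_iff:
  assumes "symmetric_family L"
  shows "(\<lambda>i. - z i) \<in> L \<longleftrightarrow> z \<in> L"
proof
  assume "(\<lambda>i. - z i) \<in> L"
  from bspec[OF assms[unfolded symmetric_family_def] this] show "z \<in> L" by simp
qed (use assms in \<open>auto simp: symmetric_family_def\<close>)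

lemma slab_mass_orthogonal:
  fixes \<psi> :: "'a::euclidean_space \<Rightarrow> ennreal" and L :: "('k::finite \<Rightarrow> real) set"
  assumes T: "orthogonal_transformation T" and inv: "\<And>v. \<psi> (T v) = \<psi> v"
    and [measurable]: "\<psi> \<in> borel_measurable borel" "L \<in> sets (Pi\<^sub>M UNIV (\<lambda>_. borel))"
  shows "slab_mass \<psi> L (\<lambda>i. T (x i)) = slab_mass \<psi> L x"
proof -
  have "slab_mass \<psi> L (\<lambda>i. T (x i)) = (\<integral>\<^sup>+v. \<psi> (T v) * indicator L (\<lambda>i. T (x i) \<bullet> T v) \<partial>lborel)"
    unfolding slab_mass_def by (rule nn_integral_lborel_orthogonal[OF T, symmetric]) measurable
  then show ?thesis
    using T by (simp add: slab_mass_def inv orthogonal_transformation_def)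
qed

context line_split begin

text \<open>Evenness folds the two half-spaces together, leaving positive heights \<open>s\<close>
  only, where \<open>r = 1 / s\<close> is a legitimate coordinate. The height becomes the outer
  variable so that the hyperplane can be integrated out first.\<close>

lemma nn_integral_even_split:
  fixes G :: "'a \<Rightarrow> ennreal"
  assumes [measurable]: "G \<in> borel_measurable borel" and even: "\<And>v. G (- v) = G v"
  shows "(\<integral>\<^sup>+v. G v \<partial>lborel) = 2 * (\<integral>\<^sup>+s\<in>{0<..}. (\<integral>\<^sup>+u. G (\<phi> u + s *\<^sub>R e) \<partial>Pi\<^sub>M U (\<lambda>_. lborel)) \<partial>lborel)"
proof -
  have inner: "(\<phi> u + s *\<^sub>R e) \<bullet> e = s" for u s
    by (simp add: inner_add_left \<phi>_inner e_inner_e)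
  let ?H = "\<lambda>v. G v * indicator {v. 0 < v \<bullet> e} v + G v * indicator {v. v \<bullet> e < 0} v"
  have "(\<integral>\<^sup>+v. G v \<partial>lborel) = (\<integral>\<^sup>+u. \<integral>\<^sup>+s. G (\<phi> u + s *\<^sub>R e) \<partial>lborel \<partial>Pi\<^sub>M U (\<lambda>_. lborel))"
    by (rule nn_integral_split) measurable
  also have "\<dots> = (\<integral>\<^sup>+u. \<integral>\<^sup>+s. ?H (\<phi> u + s *\<^sub>R e) \<partial>lborel \<partial>Pi\<^sub>M U (\<lambda>_. lborel))"
    by (rule nn_integral_cong, rule nn_integral_cong_AE, rule eventually_mono[OF AE_lborel_singleton[of "0::real"]])
      (auto simp: inner indicator_def)
  also have "\<dots> = (\<integral>\<^sup>+v. ?H v \<partial>lborel)"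
    by (rule nn_integral_split[symmetric]) measurable
  also have "\<dots> = (\<integral>\<^sup>+v. G v * indicator {v. 0 < v \<bullet> e} v \<partial>lborel) + (\<integral>\<^sup>+v. G v * indicator {v. v \<bullet> e < 0} v \<partial>lborel)"
    by (rule nn_integral_add) measurable
  also have "(\<integral>\<^sup>+v. G v * indicator {v. v \<bullet> e < 0} v \<partial>lborel) = (\<integral>\<^sup>+v. G (0 - v) * indicator {v. v \<bullet> e < 0} (0 - v) \<partial>lborel)"
    by (rule nn_integral_lborel_reflect[symmetric]) measurable
  also have "\<dots> = (\<integral>\<^sup>+v. G v * indicator {v. 0 < v \<bullet> e} v \<partial>lborel)"
    by (intro nn_integral_cong) (auto simp: even indicator_def)
  also have "(\<integral>\<^sup>+v. G v * indicator {v. 0 < v \<bullet> e} v \<partial>lborel) =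
      (\<integral>\<^sup>+u. \<integral>\<^sup>+s. G (\<phi> u + s *\<^sub>R e) * indicator {0<..} s \<partial>lborel \<partial>Pi\<^sub>M U (\<lambda>_. lborel))"
    by (subst nn_integral_split) (auto intro!: nn_integral_cong simp: inner indicator_def)
  also have "\<dots> = (\<integral>\<^sup>+s. \<integral>\<^sup>+u. G (\<phi> u + s *\<^sub>R e) * indicator {0<..} s \<partial>Pi\<^sub>M U (\<lambda>_. lborel) \<partial>lborel)"
  proof (rule pair_sigma_finite.Fubini')
    show "pair_sigma_finite lborel (Pi\<^sub>M U (\<lambda>_. lborel :: real measure))" ..
  qed measurable
  also have "\<dots> = (\<integral>\<^sup>+s\<in>{0<..}. (\<integral>\<^sup>+u. G (\<phi> u + s *\<^sub>R e) \<partial>Pi\<^sub>M U (\<lambda>_. lborel)) \<partial>lborel)"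
    by (intro nn_integral_cong nn_integral_multc) measurable
  finally show ?thesis by (simp add: mult_2)
qed

text \<open>\<open>K\<close> is the integral over the slice at height \<open>s\<close>, and
  \<open>H\<close> is its transform under \<open>r = 1 / s\<close> with the Jacobian included. The
  slices satisfy the inequality at exponent 2 for weights depending on the heights; for
  \<open>H\<close> the weights become the constant \<open>\<theta>\<close>, so one more integration
  is possible.\<close>

lemma slab_mass_quasi_concave:
  fixes \<psi> :: "'a \<Rightarrow> ennreal" and L :: "('k::finite \<Rightarrow> real) set" and y :: "'k \<Rightarrow> 'a"
  assumes [measurable]: "\<psi> \<in> borel_measurable borel" "L \<in> sets (Pi\<^sub>M UNIV (\<lambda>_. borel))"
    and L: "convex_family L" "symmetric_family L" and even: "\<And>v. \<psi> (- v) = \<psi> v"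
    and conc: "\<And>\<mu> v w. 0 < \<mu> \<Longrightarrow> \<mu> < 1 \<Longrightarrow>
      power_mean_le (Suc DIM('a)) \<mu> (\<psi> v) (\<psi> w) (\<psi> ((1 - \<mu>) *\<^sub>R v + \<mu> *\<^sub>R w))"
    and \<theta>: "0 < \<theta>" "\<theta> < 1"
  shows "min (slab_mass \<psi> L (\<lambda>i. y i + t i *\<^sub>R e)) (slab_mass \<psi> L (\<lambda>i. y i + t' i *\<^sub>R e))
    \<le> slab_mass \<psi> L (\<lambda>i. y i + ((1 - \<theta>) * t i + \<theta> * t' i) *\<^sub>R e)"
proof -
  define G where "G \<tau> v = \<psi> v * indicator L (\<lambda>i. (y i + \<tau> i *\<^sub>R e) \<bullet> v)" for \<tau> :: "'k \<Rightarrow> real" and v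
  define K where "K \<tau> s = (\<integral>\<^sup>+u. G \<tau> (\<phi> u + s *\<^sub>R e) \<partial>Pi\<^sub>M U (\<lambda>_. lborel))" for \<tau> and s :: real
  define H where "H \<tau> r = K \<tau> (1 / r) * ennreal (1 / r\<^sup>2) * indicator {0<..} r" for \<tau> r
  have G_meas[measurable]: "G \<tau> \<in> borel_measurable borel" for \<tau>
    unfolding G_def by measurable
  have K_meas[measurable]: "K \<tau> \<in> borel_measurable borel" for \<tau>
    unfolding K_def by measurable
  have H_meas: "H \<tau> \<in> borel_measurable borel" for \<tau>
    unfolding H_def by measurable
  have "G \<tau> (- v) = G \<tau> v" for \<tau> v
    by (simp add: G_def even indicator_def inner_minus_right symmetric_family_iff[OF L(2)])
  then have slab: "slab_mass \<psi> L (\<lambda>i. y i + \<tau> i *\<^sub>R e) = 2 * (\<integral>\<^sup>+r. H \<tau> r \<partial>lborel)" for \<tau>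
    unfolding slab_mass_def using nn_integral_even_split[of "G \<tau>"] nn_integral_Ioi_inverse[of "K \<tau>"]
    by (simp add: G_def[symmetric] K_def[symmetric] H_def)
  define \<tau> where "\<tau> i = (1 - \<theta>) * t i + \<theta> * t' i" for i
  have inner: "(\<phi> u + s *\<^sub>R e) \<bullet> e = s" for u s
    by (simp add: inner_add_left \<phi>_inner e_inner_e)
  \<comment> \<open>The conditions \<open>w\<close> say that the contributions
    \<open>(1 - m) * s\<close> and \<open>m * s'\<close> divide the mean height in the ratio of
    \<open>1 - \<theta>\<close> to \<open>\<theta>\<close>. Then \<open>\<tau> i\<close> times the
    mean height equals \<open>(1 - m) * t i * s + m * t' i * s'\<close>, and the two points of
    \<open>L\<close> combine with weights \<open>1 - m\<close> and \<open>m\<close>.\<close>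
  have K: "power_mean_le 2 m (K t s) (K t' s') (K \<tau> ((1 - m) * s + m * s'))"
    if m: "0 < m" "m < 1" and w: "(1 - m) * s = (1 - \<theta>) * ((1 - m) * s + m * s')" "m * s' = \<theta> * ((1 - m) * s + m * s')"
    for m s s'
    unfolding K_def
  proof (rule borell_brascamp_lieb_PiM[OF finite_U _ _ _ m])
    fix u u' :: "'a \<Rightarrow> real"
    let ?v = "\<phi> u + s *\<^sub>R e" and ?v' = "\<phi> u' + s' *\<^sub>R e" and ?s = "(1 - m) * s + m * s'"
    have v: "\<phi> (\<lambda>i. (1 - m) * u i + m * u' i) + ?s *\<^sub>R e = (1 - m) *\<^sub>R ?v + m *\<^sub>R ?v'"
      by (simp add: \<phi>_linear scaleR_right_distrib scaleR_left_distrib)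
    have *: "(\<lambda>i. (y i + \<tau> i *\<^sub>R e) \<bullet> ((1 - m) *\<^sub>R ?v + m *\<^sub>R ?v')) =
      (\<lambda>i. (1 - m) * ((y i + t i *\<^sub>R e) \<bullet> ?v) + m * ((y i + t' i *\<^sub>R e) \<bullet> ?v'))"
    proof
      fix i
      define v v' where "v = ?v" and "v' = ?v'"
      have "e \<bullet> v = s" "e \<bullet> v' = s'" by (simp_all add: v_def v'_def inner inner_commute[of e])
      then have a: "(y i + c *\<^sub>R e) \<bullet> v = y i \<bullet> v + c * s" "(y i + c *\<^sub>R e) \<bullet> v' = y i \<bullet> v' + c * s'" for c
        by (simp_all add: inner_add_left)
      have "\<tau> i * ?s = t i * ((1 - \<theta>) * ?s) + t' i * (\<theta> * ?s)"
        by (simp add: \<tau>_def algebra_simps)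
      also have "\<dots> = t i * ((1 - m) * s) + t' i * (m * s')"
        using w by simp
      finally have "(1 - m) * (y i \<bullet> v + \<tau> i * s) + m * (y i \<bullet> v' + \<tau> i * s') =
          (1 - m) * (y i \<bullet> v + t i * s) + m * (y i \<bullet> v' + t' i * s')"
        by (simp add: algebra_simps)
      then have "(y i + \<tau> i *\<^sub>R e) \<bullet> ((1 - m) *\<^sub>R v + m *\<^sub>R v') =
          (1 - m) * ((y i + t i *\<^sub>R e) \<bullet> v) + m * ((y i + t' i *\<^sub>R e) \<bullet> v')"
        unfolding inner_add_right[of _ "(1 - m) *\<^sub>R v"] inner_scaleR_right a .
      then show "(y i + \<tau> i *\<^sub>R e) \<bullet> ((1 - m) *\<^sub>R ?v + m *\<^sub>R ?v') =
          (1 - m) * ((y i + t i *\<^sub>R e) \<bullet> ?v) + m * ((y i + t' i *\<^sub>R e) \<bullet> ?v')"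
        by (simp only: v_def v'_def)
    qed
    show "power_mean_le (card U + 2) m (G t ?v) (G t' ?v') (G \<tau> (\<phi> (\<lambda>i. (1 - m) * u i + m * u' i) + ?s *\<^sub>R e))"
      unfolding v power_mean_le_def
    proof (intro allI impI)
      fix p q :: real
      assume pq: "0 < p" "0 < q" and p: "ennreal (1 / p ^ (card U + 2)) < G t ?v"
        and q: "ennreal (1 / q ^ (card U + 2)) < G t' ?v'"
      have 1: "(\<lambda>i. (y i + t i *\<^sub>R e) \<bullet> ?v) \<in> L" "ennreal (1 / p ^ (card U + 2)) < \<psi> ?v"
        using p by (auto simp: G_def split: split_indicator_asm)
      have 2: "(\<lambda>i. (y i + t' i *\<^sub>R e) \<bullet> ?v') \<in> L" "ennreal (1 / q ^ (card U + 2)) < \<psi> ?v'"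
        using q by (auto simp: G_def split: split_indicator_asm)
      have "(\<lambda>i. (y i + \<tau> i *\<^sub>R e) \<bullet> ((1 - m) *\<^sub>R ?v + m *\<^sub>R ?v')) \<in> L"
        unfolding * by (rule convex_familyD[OF L(1) 1(1) 2(1) m])
      moreover have "card U + 2 = Suc DIM('a)" using card_U by simp
      ultimately show "ennreal (1 / ((1 - m) * p + m * q) ^ (card U + 2)) \<le> G \<tau> ((1 - m) *\<^sub>R ?v + m *\<^sub>R ?v')"
        using power_mean_leD[OF conc[OF m] pq] 1(2) 2(2) by (simp add: G_def del: power_Suc)
    qed
  qed measurable
  have "power_mean_le 1 \<theta> (\<integral>\<^sup>+r. H t r \<partial>lborel) (\<integral>\<^sup>+r. H t' r \<partial>lborel) (\<integral>\<^sup>+r. H \<tau> r \<partial>lborel)"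
  proof (rule borell_brascamp_lieb_real[OF H_meas H_meas H_meas \<theta>])
    fix r r' :: real
    let ?r = "(1 - \<theta>) * r + \<theta> * r'"
    show "power_mean_le (Suc 1) \<theta> (H t r) (H t' r') (H \<tau> ?r)"
      unfolding power_mean_le_def
    proof (intro allI impI)
      fix p q :: real
      assume pq: "0 < p" "0 < q" and p: "ennreal (1 / p ^ Suc 1) < H t r" and q: "ennreal (1 / q ^ Suc 1) < H t' r'"
      have r: "0 < r" "0 < r'" using p q by (auto simp: H_def split: split_indicator_asm)
      then have r0: "0 < ?r" using \<theta> by (simp add: add_pos_pos)
      \<comment> \<open>Moves the Jacobian out of the value and into the level:
        \<open>1 / z^2\<close> for \<open>k / \<rho>^2\<close> is the level
        \<open>z / \<rho>\<close> for \<open>k\<close>.\<close>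
      have scale: "ennreal (1 / (z / \<rho>) ^ 2) < k"
        if "ennreal (1 / z ^ Suc 1) < k * ennreal (1 / \<rho>\<^sup>2)" "0 < \<rho>" "0 < z" for z \<rho> k
      proof (rule ccontr)
        assume "\<not> ennreal (1 / (z / \<rho>) ^ 2) < k"
        then have "k * ennreal (1 / \<rho>\<^sup>2) \<le> ennreal (1 / (z / \<rho>) ^ 2) * ennreal (1 / \<rho>\<^sup>2)"
          by (intro mult_right_mono) auto
        also have "\<dots> = ennreal (1 / z ^ Suc 1)"
          using that by (simp add: ennreal_mult[symmetric] power2_eq_square)
        finally show False using that(1) by simp
      qed
      \<comment> \<open>The weight for which the mean of \<open>1 / r\<close> and
        \<open>1 / r'\<close> is \<open>1 / ?r\<close>, split between the two terms as
        \<open>1 - \<theta>\<close> and \<open>\<theta>\<close>.\<close>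
      define m where "m = \<theta> * r' / ?r"
      have m1: "1 - m = (1 - \<theta>) * r / ?r" using r0 by (simp add: m_def field_simps)
      have "0 < 1 - m" unfolding m1 using \<theta> r r0 by simp
      then have m: "0 < m" "m < 1" using \<theta> r r0 by (auto simp: m_def)
      have e1: "(1 - m) * (1 / r) = (1 - \<theta>) * (1 / ?r)" using r unfolding m1 by simp
      have e2: "m * (1 / r') = \<theta> * (1 / ?r)" using r by (simp add: m_def)
      have e3: "(1 - m) * (1 / r) + m * (1 / r') = 1 / ?r"
      proof -
        have "(1 - \<theta>) * z + \<theta> * z = z" for z :: real by (simp add: algebra_simps)
        then show ?thesis unfolding e1 e2 .
      qed
      have "ennreal (1 / ((1 - m) * (p / r) + m * (q / r')) ^ 2) \<le> K \<tau> ((1 - m) * (1 / r) + m * (1 / r'))"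
      proof (rule power_mean_leD[OF K[OF m]])
        show "ennreal (1 / (p / r)\<^sup>2) < K t (1 / r)" "ennreal (1 / (q / r')\<^sup>2) < K t' (1 / r')"
          using p q r pq by (auto intro!: scale simp: H_def)
        show "(1 - m) * (1 / r) = (1 - \<theta>) * ((1 - m) * (1 / r) + m * (1 / r'))"
          unfolding e3 by (rule e1)
        show "m * (1 / r') = \<theta> * ((1 - m) * (1 / r) + m * (1 / r'))"
          unfolding e3 by (rule e2)
      qed (use pq r in auto)
      \<comment> \<open>The modified weights cancel the denominators \<open>r\<close> and
        \<open>r'\<close>, leaving the original mean of \<open>p\<close> and \<open>q\<close> over
        \<open>?r\<close>; the Jacobian at \<open>?r\<close> then removes that denominator
        too.\<close>
      moreover have "(1 - m) * (p / r) + m * (q / r') = ((1 - \<theta>) * p + \<theta> * q) / ?r"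
        unfolding m1 using r by (simp add: m_def add_divide_distrib)
      ultimately have "ennreal (1 / (((1 - \<theta>) * p + \<theta> * q) / ?r) ^ 2) \<le> K \<tau> (1 / ?r)"
        unfolding e3 by simp
      then have "ennreal (1 / (((1 - \<theta>) * p + \<theta> * q) / ?r) ^ 2) * ennreal (1 / ?r\<^sup>2) \<le> H \<tau> ?r"
        using r0 by (simp add: H_def mult_right_mono)
      also have "ennreal (1 / (((1 - \<theta>) * p + \<theta> * q) / ?r) ^ 2) * ennreal (1 / ?r\<^sup>2) = ennreal (1 / ((1 - \<theta>) * p + \<theta> * q) ^ Suc 1)"
        using r0 by (simp add: ennreal_mult[symmetric] power2_eq_square del: distrib_left_numeral)
      finally show "ennreal (1 / ((1 - \<theta>) * p + \<theta> * q) ^ Suc 1) \<le> H \<tau> ?r" .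
    qed
  qed
  from power_mean_le_min[OF this _ \<theta>] have "min (\<integral>\<^sup>+r. H t r \<partial>lborel) (\<integral>\<^sup>+r. H t' r \<partial>lborel) \<le> (\<integral>\<^sup>+r. H \<tau> r \<partial>lborel)"
    by simp
  then have "min (2 * (\<integral>\<^sup>+r. H t r \<partial>lborel)) (2 * (\<integral>\<^sup>+r. H t' r \<partial>lborel)) \<le> 2 * (\<integral>\<^sup>+r. H \<tau> r \<partial>lborel)"
    by (auto simp: min_le_iff_disj intro: mult_left_mono)
  then show ?thesis unfolding slab[symmetric] by (simp add: \<tau>_def)
qed

end

section \<open>Rearrangement on the line\<close>

lemma sets_PiM_lborel: "sets (Pi\<^sub>M I (\<lambda>_. lborel)) = sets (Pi\<^sub>M I (\<lambda>_. borel))"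
  by (rule sets_PiM_cong) auto

lemma sets_PiE_UNIV [measurable]:
  fixes A :: "'k::finite \<Rightarrow> 'a::euclidean_space set"
  assumes "\<And>i. A i \<in> sets borel"
  shows "Pi\<^sub>E UNIV A \<in> sets (Pi\<^sub>M UNIV (\<lambda>_. lborel))"
  using assms by (intro sets_PiM_I_finite) auto

text \<open>A point of the larger box that misses the smaller one has some coordinate in
  \<open>B i - A i\<close>, while its other coordinates range over sets of measure at most
  \<open>M\<close>. The union bound makes approximation in each factor sufficient.\<close>

lemma emeasure_PiM_Int_PiE_le:
  fixes A B :: "'k::finite \<Rightarrow> 'a::euclidean_space set"
  assumes [measurable]: "S \<in> sets (Pi\<^sub>M UNIV (\<lambda>_. lborel))" "\<And>i. A i \<in> sets borel" "\<And>i. B i \<in> sets borel"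
    and M: "\<And>i. emeasure lborel (B i) \<le> ennreal M" and \<epsilon>: "\<And>i. emeasure lborel (B i - A i) \<le> ennreal \<epsilon>"
    and nn: "0 \<le> M" "0 \<le> \<epsilon>"
  shows "emeasure (Pi\<^sub>M UNIV (\<lambda>_. lborel)) (S \<inter> Pi\<^sub>E UNIV B)
    \<le> emeasure (Pi\<^sub>M UNIV (\<lambda>_. lborel)) (S \<inter> Pi\<^sub>E UNIV A) + ennreal (real CARD('k) * (\<epsilon> * M ^ (CARD('k) - 1)))"
proof -
  let ?P = "Pi\<^sub>M (UNIV::'k set) (\<lambda>_. lborel :: 'a measure)"
  let ?E = "\<lambda>i. Pi\<^sub>E UNIV (B(i := B i - A i))"
  have E[measurable]: "?E i \<in> sets ?P" for i by (intro sets_PiE_UNIV) auto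
  have "emeasure ?P (S \<inter> Pi\<^sub>E UNIV B) \<le> emeasure ?P ((S \<inter> Pi\<^sub>E UNIV A) \<union> (\<Union>i. ?E i))"
  proof (rule emeasure_mono)
    show "S \<inter> Pi\<^sub>E UNIV B \<subseteq> (S \<inter> Pi\<^sub>E UNIV A) \<union> (\<Union>i. ?E i)"
    proof
      fix x assume x: "x \<in> S \<inter> Pi\<^sub>E UNIV B"
      show "x \<in> (S \<inter> Pi\<^sub>E UNIV A) \<union> (\<Union>i. ?E i)"
      proof (cases "\<forall>i. x i \<in> A i")
        case True then show ?thesis using x by (simp add: PiE_iff)
      next
        case False
        then obtain i where "x i \<notin> A i" by blast
        then have "x \<in> ?E i" using x by (simp add: PiE_iff)
        then show ?thesis by blast
      qed
    qed
  qed measurable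
  also have "\<dots> \<le> emeasure ?P (S \<inter> Pi\<^sub>E UNIV A) + emeasure ?P (\<Union>i. ?E i)"
    by (intro emeasure_subadditive) auto
  also have "emeasure ?P (\<Union>i. ?E i) \<le> (\<Sum>i\<in>UNIV. emeasure ?P (?E i))"
    by (intro emeasure_subadditive_finite) auto
  also have "\<dots> \<le> (\<Sum>i\<in>(UNIV::'k set). ennreal (\<epsilon> * M ^ (CARD('k) - 1)))"
  proof (rule sum_mono)
    fix i :: 'k
    have "emeasure ?P (?E i) = (\<Prod>j\<in>UNIV. emeasure lborel ((B(i := B i - A i)) j))"
      by (intro lborel_PiM.emeasure_PiM) auto
    also have "\<dots> = emeasure lborel (B i - A i) * (\<Prod>j\<in>UNIV - {i}. emeasure lborel (B j))"
      by (subst prod.remove[of _ i]) auto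
    also have "\<dots> \<le> ennreal \<epsilon> * (\<Prod>j\<in>UNIV - {i}. ennreal M)"
      by (intro mult_mono \<epsilon> prod_mono_ennreal M) auto
    also have "\<dots> = ennreal (\<epsilon> * M ^ (CARD('k) - 1))"
      using nn by (simp add: ennreal_mult ennreal_power card_Diff_singleton)
    finally show "emeasure ?P (?E i) \<le> ennreal (\<epsilon> * M ^ (CARD('k) - 1))" .
  qed
  also have "\<dots> = ennreal (real CARD('k) * (\<epsilon> * M ^ (CARD('k) - 1)))"
    using nn by (simp add: ennreal_mult ennreal_of_nat_eq_real_of_nat)
  finally show ?thesis by (simp add: add_left_mono)
qed

lemma emeasure_PiM_uminus_vimage:
  fixes A :: "('k::finite \<Rightarrow> real) set"
  assumes A: "A \<in> sets (Pi\<^sub>M UNIV (\<lambda>_. lborel))"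
  shows "emeasure (Pi\<^sub>M UNIV (\<lambda>_. lborel)) {x. (\<lambda>i. - x i) \<in> A} = emeasure (Pi\<^sub>M UNIV (\<lambda>_. lborel)) A"
proof -
  let ?P = "Pi\<^sub>M (UNIV::'k set) (\<lambda>_. lborel :: real measure)"
  have m[measurable]: "(\<lambda>x i. - x i) \<in> measurable ?P ?P"
    by (rule measurable_PiM_single') auto
  have "distr ?P ?P (\<lambda>x i. - x i) = ?P"
  proof (rule lborel_PiM.PiM_eqI)
    fix B :: "'k \<Rightarrow> real set" assume B: "\<And>i. i \<in> UNIV \<Longrightarrow> B i \<in> sets lborel"
    then have [measurable]: "B i \<in> sets borel" for i by simp
    have [measurable]: "Pi\<^sub>E UNIV B \<in> sets ?P" by (intro sets_PiE_UNIV) auto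
    have vim: "(\<lambda>x i. - x i) -` Pi\<^sub>E UNIV B \<inter> space ?P = Pi\<^sub>E UNIV (\<lambda>i. {x. - x \<in> B i})"
      by (simp add: space_PiM PiE_UNIV_domain Pi_def vimage_def)
    have "emeasure (distr ?P ?P (\<lambda>x i. - x i)) (Pi\<^sub>E UNIV B) = emeasure ?P (Pi\<^sub>E UNIV (\<lambda>i. {x. - x \<in> B i}))"
      unfolding vim[symmetric] by (rule emeasure_distr) measurable
    also have "\<dots> = (\<Prod>i\<in>UNIV. emeasure lborel {x. - x \<in> B i})"
      by (intro lborel_PiM.emeasure_PiM) auto
    also have "\<dots> = (\<Prod>i\<in>UNIV. emeasure lborel (B i))"
    proof (rule prod.cong[OF refl])
      fix i
      show "emeasure lborel {x. - x \<in> B i} = emeasure lborel (B i)"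
        using emeasure_lborel_affine[of "-1" "B i" 0] by simp
    qed
    finally show "emeasure (distr ?P ?P (\<lambda>x i. - x i)) (Pi\<^sub>E UNIV B) = (\<Prod>i\<in>UNIV. emeasure lborel (B i))" .
  qed auto
  then show ?thesis
    using emeasure_distr[OF m A] by (simp add: space_PiM vimage_def)
qed

text \<open>The Borell--Brascamp--Lieb inequality for indicators, read at the level of
  minima.\<close>

lemma brunn_minkowski_PiM:
  fixes A B Z :: "('k::finite \<Rightarrow> real) set"
  assumes [measurable]: "A \<in> sets (Pi\<^sub>M UNIV (\<lambda>_. lborel))" "B \<in> sets (Pi\<^sub>M UNIV (\<lambda>_. lborel))"
      "Z \<in> sets (Pi\<^sub>M UNIV (\<lambda>_. lborel))"
    and \<mu>: "0 < \<mu>" "\<mu> < 1" and sub: "\<And>a b. a \<in> A \<Longrightarrow> b \<in> B \<Longrightarrow> (\<lambda>i. (1 - \<mu>) * a i + \<mu> * b i) \<in> Z"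
  shows "min (emeasure (Pi\<^sub>M UNIV (\<lambda>_. lborel)) A) (emeasure (Pi\<^sub>M UNIV (\<lambda>_. lborel)) B)
    \<le> emeasure (Pi\<^sub>M UNIV (\<lambda>_. lborel)) Z"
proof -
  let ?P = "Pi\<^sub>M (UNIV::'k set) (\<lambda>_. lborel :: real measure)"
  have "power_mean_le 1 \<mu> (\<integral>\<^sup>+x. indicator A x \<partial>?P) (\<integral>\<^sup>+x. indicator B x \<partial>?P) (\<integral>\<^sup>+x. indicator Z x \<partial>?P)"
  proof (rule borell_brascamp_lieb_PiM[OF finite _ _ _ \<mu>])
    fix x y :: "'k \<Rightarrow> real"
    show "power_mean_le (CARD('k) + 1) \<mu> (indicator A x) (indicator B y) (indicator Z (\<lambda>i. (1 - \<mu>) * x i + \<mu> * y i))"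
      unfolding power_mean_le_def
    proof (intro allI impI)
      fix p q :: real
      let ?j = "CARD('k) + 1"
      assume pq: "0 < p" "0 < q" "ennreal (1 / p ^ ?j) < indicator A x" "ennreal (1 / q ^ ?j) < indicator B y"
      then have "x \<in> A" "y \<in> B" by (auto split: split_indicator_asm)
      then have Z: "(\<lambda>i. (1 - \<mu>) * x i + \<mu> * y i) \<in> Z" by (rule sub)
      \<comment> \<open>An indicator exceeds \<open>1 / z ^ ?j\<close> only for \<open>z\<close> at
        least one; means of such numbers are again at least one, so the level asked of
        \<open>Z\<close> is at most one.\<close>
      have big: "1 \<le> z" if "ennreal (1 / z ^ ?j) < 1" "0 < z" for z
      proof (rule ccontr)
        assume "\<not> 1 \<le> z"
        then have "z ^ ?j \<le> 1" using that by (intro power_le_one) auto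
        then have "1 \<le> 1 / z ^ ?j" using that by simp
        then show False using that(1) by (metis ennreal_1 ennreal_leI not_less)
      qed
      have "1 \<le> p" "1 \<le> q" using pq \<open>x \<in> A\<close> \<open>y \<in> B\<close> by (auto intro!: big)
      then have "1 \<le> (1 - \<mu>) * p + \<mu> * q"
        using convex_bound_le[of "-p" "-1" "-q" "1 - \<mu>" \<mu>] \<mu> by simp
      then have "1 \<le> ((1 - \<mu>) * p + \<mu> * q) ^ ?j" by (rule one_le_power)
      then have "1 / ((1 - \<mu>) * p + \<mu> * q) ^ ?j \<le> 1" by (simp add: divide_le_eq_1)
      then show "ennreal (1 / ((1 - \<mu>) * p + \<mu> * q) ^ ?j) \<le> indicator Z (\<lambda>i. (1 - \<mu>) * x i + \<mu> * y i)"
        using Z by (simp add: ennreal_le_1)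
    qed
  qed auto
  from power_mean_le_min[OF this _ \<mu>] show ?thesis by simp
qed

text \<open>An argument in the style of Anderson: averaging the box at \<open>c\<close> and the box
  at \<open>-c\<close> with weight \<open>\<mu> = (1 - s) / 2\<close> lands in the box at
  \<open>s * c\<close>. The sections of \<open>K\<close> by the first two boxes have equal measure
  by symmetry, so their minimum is either one.\<close>

lemma emeasure_Int_box_slide:
  fixes K :: "('k::finite \<Rightarrow> real) set" and c l :: "'k \<Rightarrow> real"
  assumes K[measurable]: "K \<in> sets (Pi\<^sub>M UNIV (\<lambda>_. lborel))" and conv: "convex_family K" "symmetric_family K"
    and s: "0 \<le> s" "s \<le> 1"
  shows "emeasure (Pi\<^sub>M UNIV (\<lambda>_. lborel)) (K \<inter> Pi\<^sub>E UNIV (\<lambda>i. {x. \<bar>x - c i\<bar> < l i}))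
    \<le> emeasure (Pi\<^sub>M UNIV (\<lambda>_. lborel)) (K \<inter> Pi\<^sub>E UNIV (\<lambda>i. {x. \<bar>x - s * c i\<bar> < l i}))"
proof (cases "s = 1")
  case False
  let ?P = "Pi\<^sub>M (UNIV::'k set) (\<lambda>_. lborel :: real measure)"
  let ?D = "\<lambda>c. K \<inter> Pi\<^sub>E UNIV (\<lambda>i. {x. \<bar>x - c i\<bar> < l i})"
  define \<mu> where "\<mu> = (1 - s) / 2"
  have \<mu>: "0 < \<mu>" "\<mu> < 1" using s False by (auto simp: \<mu>_def)
  have [measurable]: "?D c \<in> sets ?P" for c by measurable
  have neg: "{x. (\<lambda>i. - x i) \<in> ?D c} = ?D (\<lambda>i. - c i)"
  proof -
    have "\<bar>- x - c i\<bar> = \<bar>x - - c i\<bar>" for x i by linarith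
    then show ?thesis by (auto simp: PiE_iff symmetric_family_iff[OF conv(2)])
  qed
  have "min (emeasure ?P (?D c)) (emeasure ?P (?D (\<lambda>i. - c i))) \<le> emeasure ?P (?D (\<lambda>i. s * c i))"
  proof (rule brunn_minkowski_PiM[OF _ _ _ \<mu>])
    fix a b assume a: "a \<in> ?D c" and b: "b \<in> ?D (\<lambda>i. - c i)"
    have "\<bar>(1 - \<mu>) * a i + \<mu> * b i - s * c i\<bar> < l i" for i
    proof -
      have "(1 - \<mu>) * a i + \<mu> * b i - s * c i = (1 - \<mu>) * (a i - c i) + \<mu> * (b i - - c i)"
        by (simp add: \<mu>_def field_simps)
      also have "\<bar>\<dots>\<bar> \<le> (1 - \<mu>) * \<bar>a i - c i\<bar> + \<mu> * \<bar>b i - - c i\<bar>"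
        using \<mu> abs_triangle_ineq[of "(1 - \<mu>) * (a i - c i)" "\<mu> * (b i - - c i)"] by (simp add: abs_mult)
      also have "\<dots> < l i" using a b \<mu> by (intro convex_bound_lt) (auto simp: PiE_iff)
      finally show ?thesis .
    qed
    then show "(\<lambda>i. (1 - \<mu>) * a i + \<mu> * b i) \<in> ?D (\<lambda>i. s * c i)"
      using a b convex_familyD[OF conv(1) _ _ \<mu>] by (auto simp: PiE_iff)
  qed measurable
  moreover have "emeasure ?P (?D (\<lambda>i. - c i)) = emeasure ?P (?D c)"
    unfolding neg[symmetric] by (rule emeasure_PiM_uminus_vimage) measurable
  ultimately show ?thesis by simp
qed simp

text \<open>A pair is a centre and a half-length, so that sliding towards the origin rescales the
  first component and keeps the second.\<close>

definition intervals :: "(real \<times> real) set \<Rightarrow> real set" where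
  "intervals J = {x. \<exists>p\<in>J. \<bar>x - fst p\<bar> < snd p}"

text \<open>Contact is permitted: touching open intervals are still disjoint, and contact is the
  moment at which they get merged.\<close>

definition separated :: "(real \<times> real) set \<Rightarrow> bool" where
  "separated J \<longleftrightarrow> finite J \<and> (\<forall>p\<in>J. 0 < snd p) \<and> (\<forall>p\<in>J. \<forall>q\<in>J. p \<noteq> q \<longrightarrow> snd p + snd q \<le> \<bar>fst p - fst q\<bar>)"

lemma intervals_eq_UN: "intervals J = (\<Union>p\<in>J. {x. \<bar>x - fst p\<bar> < snd p})"
  by (auto simp: intervals_def)

lemma intervals_borel: "finite J \<Longrightarrow> intervals J \<in> sets borel"
  unfolding intervals_eq_UN by (intro sets.finite_UN) auto

lemma emeasure_interval:
  assumes "0 \<le> l"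
  shows "emeasure lborel {x::real. \<bar>x - c\<bar> < l} = ennreal (2 * l)"
proof -
  have "{x. \<bar>x - c\<bar> < l} = {c - l<..<c + l}" by auto
  then show ?thesis using assms by simp
qed

lemma separated_disjoint:
  assumes "separated J" "p \<in> J" "q \<in> J" "p \<noteq> q" "\<bar>x - fst p\<bar> < snd p" "\<bar>x - fst q\<bar> < snd q"
  shows False
proof -
  have "snd p + snd q \<le> \<bar>fst p - fst q\<bar>" using assms by (auto simp: separated_def)
  then show False using assms(5,6) by linarith
qed

lemma emeasure_intervals:
  assumes J: "separated J"
  shows "emeasure lborel (intervals J) = ennreal (2 * (\<Sum>p\<in>J. snd p))"
proof -
  have "emeasure lborel (intervals J) = (\<Sum>p\<in>J. emeasure lborel {x. \<bar>x - fst p\<bar> < snd p})"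
    unfolding intervals_eq_UN
    using J by (intro sum_emeasure[symmetric])
      (auto simp: disjoint_family_on_def separated_def[of J] dest: separated_disjoint[OF J])
  also have "\<dots> = (\<Sum>p\<in>J. ennreal (2 * snd p))"
    using J by (intro sum.cong) (auto simp: separated_def emeasure_interval less_imp_le)
  also have "\<dots> = ennreal (2 * (\<Sum>p\<in>J. snd p))"
    using J by (subst sum_ennreal) (auto simp: separated_def less_imp_le sum_distrib_left)
  finally show ?thesis .
qed

text \<open>The merged interval gains only the common endpoint, so the total length is unchanged
  while the number of intervals drops.\<close>

lemma merge_touching:
  assumes J: "separated J" and ab: "a \<in> J" "b \<in> J" "a \<noteq> b" and touch: "snd a + snd b = fst b - fst a"
  obtains J' where "separated J'" "intervals J \<subseteq> intervals J'" "card J' < card J"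
    "(\<Sum>p\<in>J'. snd p) = (\<Sum>p\<in>J. snd p)"
proof
  \<comment> \<open>Contact gives \<open>fst b = fst a + snd a + snd b\<close>, so the midpoint of
    the two outer ends is \<open>fst a + snd b\<close>.\<close>
  let ?m = "(fst a + snd b, snd a + snd b)"
  define R where "R = J - {a, b}"
  have J_eq: "J = insert a (insert b R)" and aR: "a \<notin> insert b R" and bR: "b \<notin> R" and RJ: "R \<subseteq> J"
    using ab by (auto simp: R_def)
  have fin: "finite J" and pos: "\<And>p. p \<in> J \<Longrightarrow> 0 < snd p"
    and sep: "\<And>p q. p \<in> J \<Longrightarrow> q \<in> J \<Longrightarrow> p \<noteq> q \<Longrightarrow> snd p + snd q \<le> \<bar>fst p - fst q\<bar>"
    using J by (auto simp: separated_def)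
  have finR: "finite R" using fin by (simp add: R_def)
  note posab = pos[OF ab(1)] pos[OF ab(2)]
  \<comment> \<open>A third interval cannot fit between two that touch, so it lies to one side of
    both.\<close>
  have far: "snd ?m + snd q \<le> \<bar>fst ?m - fst q\<bar>" if q: "q \<in> R" for q
  proof -
    have "q \<in> J" "a \<noteq> q" "b \<noteq> q" using q by (auto simp: R_def)
    then have "snd a + snd q \<le> \<bar>fst a - fst q\<bar>" "snd b + snd q \<le> \<bar>fst b - fst q\<bar>" "0 < snd q"
      using sep ab pos by blast+
    then have "snd a + snd b + snd q \<le> \<bar>fst a + snd b - fst q\<bar>" using posab touch by linarith
    then show ?thesis by simp
  qed
  have notin: "?m \<notin> R"
  proof
    assume m: "?m \<in> R"
    show False using far[OF m] posab by simp
  qed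
  show "card (insert ?m R) < card J"
    unfolding J_eq using finR notin aR bR by simp
  show "(\<Sum>p\<in>insert ?m R. snd p) = (\<Sum>p\<in>J. snd p)"
    unfolding J_eq using finR notin aR bR by simp
  show "separated (insert ?m R)"
    unfolding separated_def
  proof (intro conjI ballI impI)
    show "finite (insert ?m R)" using finR by simp
    show "0 < snd p" if p: "p \<in> insert ?m R" for p
    proof (cases "p = ?m")
      case True then show ?thesis using posab by simp
    next
      case False
      then have "p \<in> J" using p RJ by blast
      then show ?thesis by (rule pos)
    qed
    show "snd p + snd q \<le> \<bar>fst p - fst q\<bar>" if pq: "p \<in> insert ?m R" "q \<in> insert ?m R" "p \<noteq> q" for p q
    proof (cases "p = ?m")
      case True then show ?thesis using far[of q] pq by auto
    next
      case p: False
      show ?thesis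
      proof (cases "q = ?m")
        case True
        have "snd ?m + snd p \<le> \<bar>fst ?m - fst p\<bar>" using far[of p] pq p by blast
        then show ?thesis unfolding True by linarith
      qed (use p pq sep RJ in blast)
    qed
  qed
  show "intervals J \<subseteq> intervals (insert ?m R)"
  proof
    fix x assume "x \<in> intervals J"
    then obtain p where p: "p \<in> J" "\<bar>x - fst p\<bar> < snd p" by (auto simp: intervals_def)
    show "x \<in> intervals (insert ?m R)"
    proof (cases "p \<in> R")
      case False
      then have "p = a \<or> p = b" using p(1) by (auto simp: J_eq)
      then have "\<bar>x - fst ?m\<bar> < snd ?m" using p(2) posab touch by auto
      then show ?thesis by (auto simp: intervals_def)
    qed (use p in \<open>auto simp: intervals_def\<close>)
  qed
qed

lemma PiE_intervals_eq_UN: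
  "Pi\<^sub>E UNIV (\<lambda>i. intervals (J i)) = (\<Union>h\<in>Pi\<^sub>E UNIV J. Pi\<^sub>E UNIV (\<lambda>i. {x. \<bar>x - fst (h i)\<bar> < snd (h i)}))"
proof -
  have "(\<forall>i. \<exists>p\<in>J i. \<bar>x i - fst p\<bar> < snd p) \<longleftrightarrow> (\<exists>h. \<forall>i. h i \<in> J i \<and> \<bar>x i - fst (h i)\<bar> < snd (h i))" for x
    by metis
  then show ?thesis by (auto simp: PiE_UNIV_domain Pi_def intervals_def)
qed

text \<open>The product of unions is a union of boxes, one for each choice of intervals.
  Subadditivity bounds the measure before the slide, each box gains by sliding, and disjointness of
  the boxes afterwards turns the sum back into a measure.\<close>

lemma emeasure_Int_intervals_slide:
  fixes K :: "('k::finite \<Rightarrow> real) set" and J :: "'k \<Rightarrow> (real \<times> real) set"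
  assumes K[measurable]: "K \<in> sets (Pi\<^sub>M UNIV (\<lambda>_. lborel))" and conv: "convex_family K" "symmetric_family K"
    and J: "\<And>i. separated (J i)" and s: "0 < s" "s \<le> 1"
    and sJ: "\<And>i. separated ((\<lambda>p. (s * fst p, snd p)) ` J i)"
  shows "emeasure (Pi\<^sub>M UNIV (\<lambda>_. lborel)) (K \<inter> Pi\<^sub>E UNIV (\<lambda>i. intervals (J i)))
    \<le> emeasure (Pi\<^sub>M UNIV (\<lambda>_. lborel)) (K \<inter> Pi\<^sub>E UNIV (\<lambda>i. intervals ((\<lambda>p. (s * fst p, snd p)) ` J i)))"
proof -
  let ?P = "Pi\<^sub>M (UNIV::'k set) (\<lambda>_. lborel :: real measure)"
  let ?H = "Pi\<^sub>E UNIV J"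
  let ?D = "\<lambda>s h. Pi\<^sub>E UNIV (\<lambda>i. {x. \<bar>x - s * fst (h i)\<bar> < snd (h i)})"
  let ?sJ = "\<lambda>i. (\<lambda>p. (s * fst p, snd p)) ` J i"
  have fin: "finite ?H" using J by (intro finite_PiE) (auto simp: separated_def)
  have D[measurable]: "?D s h \<in> sets ?P" for s h by (intro sets_PiE_UNIV) measurable
  have [measurable]: "Pi\<^sub>E UNIV (\<lambda>i. intervals (?sJ i)) \<in> sets ?P"
    using sJ by (intro sets_PiE_UNIV intervals_borel) (auto simp: separated_def)
  have "K \<inter> Pi\<^sub>E UNIV (\<lambda>i. intervals (J i)) = (\<Union>h\<in>?H. K \<inter> ?D 1 h)"
    unfolding PiE_intervals_eq_UN by auto
  moreover have "emeasure ?P (\<Union>h\<in>?H. K \<inter> ?D 1 h) \<le> (\<Sum>h\<in>?H. emeasure ?P (K \<inter> ?D 1 h))"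
    by (rule emeasure_subadditive_finite[OF fin]) auto
  ultimately have "emeasure ?P (K \<inter> Pi\<^sub>E UNIV (\<lambda>i. intervals (J i))) \<le> (\<Sum>h\<in>?H. emeasure ?P (K \<inter> ?D 1 h))"
    by simp
  also have "\<dots> \<le> (\<Sum>h\<in>?H. emeasure ?P (K \<inter> ?D s h))"
    using emeasure_Int_box_slide[OF K conv, of s] s by (intro sum_mono) auto
  also have "\<dots> = emeasure ?P (\<Union>h\<in>?H. K \<inter> ?D s h)"
  proof (rule sum_emeasure)
    show "disjoint_family_on (\<lambda>h. K \<inter> ?D s h) ?H"
      unfolding disjoint_family_on_def
    proof (intro ballI impI)
      fix g h assume gh: "g \<in> ?H" "h \<in> ?H" "g \<noteq> h"
      then obtain i where i: "g i \<noteq> h i" by (meson ext)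
      let ?g = "(s * fst (g i), snd (g i))" and ?h = "(s * fst (h i), snd (h i))"
      have mem: "?g \<in> ?sJ i" "?h \<in> ?sJ i" using gh by (auto simp: PiE_iff)
      have ne: "?g \<noteq> ?h" using i s by (auto simp: prod_eq_iff)
      have False if x: "x \<in> ?D s g" "x \<in> ?D s h" for x
        using separated_disjoint[OF sJ mem ne, of "x i"] x by (auto simp: PiE_iff)
      then show "(K \<inter> ?D s g) \<inter> (K \<inter> ?D s h) = {}" by blast
    qed
  qed (use fin in auto)
  also have "\<dots> \<le> emeasure ?P (K \<inter> Pi\<^sub>E UNIV (\<lambda>i. intervals (?sJ i)))"
  proof (rule emeasure_mono)
    show "(\<Union>h\<in>?H. K \<inter> ?D s h) \<subseteq> K \<inter> Pi\<^sub>E UNIV (\<lambda>i. intervals (?sJ i))"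
      by (fastforce simp: PiE_UNIV_domain Pi_def intervals_def)
  qed measurable
  finally show ?thesis .
qed

text \<open>All families slide with a common factor until two intervals of one family touch; merging
  these lowers the total number of intervals, which drives the induction.\<close>

lemma emeasure_Int_intervals_le:
  fixes K :: "('k::finite \<Rightarrow> real) set" and J :: "'k \<Rightarrow> (real \<times> real) set"
  assumes K[measurable]: "K \<in> sets (Pi\<^sub>M UNIV (\<lambda>_. lborel))" and conv: "convex_family K" "symmetric_family K"
    and J: "\<And>i. separated (J i)"
  shows "emeasure (Pi\<^sub>M UNIV (\<lambda>_. lborel)) (K \<inter> Pi\<^sub>E UNIV (\<lambda>i. intervals (J i)))
    \<le> emeasure (Pi\<^sub>M UNIV (\<lambda>_. lborel)) (K \<inter> Pi\<^sub>E UNIV (\<lambda>i. {x. \<bar>x\<bar> < (\<Sum>p\<in>J i. snd p)}))"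
  using J
proof (induction "\<Sum>i\<in>UNIV. card (J i)" arbitrary: J rule: less_induct)
  case less
  let ?P = "Pi\<^sub>M (UNIV::'k set) (\<lambda>_. lborel :: real measure)"
  have fin: "finite (J i)" for i using less.prems by (auto simp: separated_def)
  have pos: "0 < snd p" if "p \<in> J i" for p i using less.prems that by (auto simp: separated_def)
  have sep: "snd p + snd q \<le> \<bar>fst p - fst q\<bar>" if "p \<in> J i" "q \<in> J i" "p \<noteq> q" for p q i
    using less.prems[of i] that by (auto simp: separated_def)
  show ?case
  proof (cases "\<forall>i. \<exists>p. J i \<subseteq> {p}")
    case True
    show ?thesis
    proof (cases "\<exists>i. J i = {}")
      case True
      then have "Pi\<^sub>E UNIV (\<lambda>i. intervals (J i)) = {}" by (auto simp: PiE_eq_empty_iff intervals_def)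
      then show ?thesis by simp
    next
      case False
      then have "\<forall>i. \<exists>p. J i = {p}" using True by (metis subset_singletonD)
      then obtain h where h: "\<And>i. J i = {h i}" by metis
      \<comment> \<open>With one interval in each family nothing can collide, and the boxes slide to
        the origin at once.\<close>
      show ?thesis
        using emeasure_Int_box_slide[OF K conv, of 0 "\<lambda>i. fst (h i)" "\<lambda>i. snd (h i)"]
        by (simp add: h intervals_def)
    qed
  next
    case False
    \<comment> \<open>The factor at which \<open>p\<close> and \<open>q\<close> touch, since
      half-lengths stay fixed while the distance of the centres shrinks.\<close>
    let ?r = "\<lambda>p q. (snd p + snd q) / \<bar>fst p - fst q\<bar> :: real"
    define T where "T = {t. \<exists>i. \<exists>p\<in>J i. \<exists>q\<in>J i. p \<noteq> q \<and> t = ?r p q}"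
    have T: "?r p q \<in> T" if "p \<in> J i" "q \<in> J i" "p \<noteq> q" for i p q
      unfolding T_def using that by blast
    have "T \<subseteq> (\<Union>i. (\<lambda>(p, q). ?r p q) ` (J i \<times> J i))" unfolding T_def by fastforce
    then have finT: "finite T" by (rule finite_subset) (use fin in auto)
    have "T \<noteq> {}"
    proof -
      obtain i where i: "\<And>p. \<not> J i \<subseteq> {p}" using False by blast
      obtain p where p: "p \<in> J i" using i by blast
      obtain q where "q \<in> J i" "q \<noteq> p" using i[of p] by blast
      then show ?thesis using T[OF p] by blast
    qed
    \<comment> \<open>As the factor decreases from one, the largest ratio is the first to be met;
      separation keeps it at most one.\<close>
    define s where "s = Max T"
    have sT: "s \<in> T" "\<And>t. t \<in> T \<Longrightarrow> t \<le> s"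
      using finT \<open>T \<noteq> {}\<close> by (auto simp: s_def)
    obtain i p q where pq: "p \<in> J i" "q \<in> J i" "p \<noteq> q" and seq: "s = (snd p + snd q) / \<bar>fst p - fst q\<bar>"
      using sT(1) unfolding T_def by blast
    have d: "0 < \<bar>fst p - fst q\<bar>" if "p \<in> J i" "q \<in> J i" "p \<noteq> q" for p q i
      using sep[OF that] pos[OF that(1)] pos[OF that(2)] by linarith
    have s: "0 < s" "s \<le> 1"
      using d[OF pq] sep[OF pq] pos[OF pq(1)] pos[OF pq(2)] unfolding seq by (simp_all add: add_pos_pos)
    let ?f = "\<lambda>p. (s * fst p, snd p)"
    have inj: "inj ?f" using s by (auto simp: inj_def prod_eq_iff)
    have sJ: "separated (?f ` J j)" for j
      unfolding separated_def
    proof (intro conjI ballI impI)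
      fix a b assume ab: "a \<in> ?f ` J j" "b \<in> ?f ` J j" "a \<noteq> b"
      then obtain a' b' where a': "a = ?f a'" "b = ?f b'" "a' \<in> J j" "b' \<in> J j" "a' \<noteq> b'" by auto
      from sT(2)[OF T[OF a'(3,4,5)]] have "snd a' + snd b' \<le> s * \<bar>fst a' - fst b'\<bar>"
        using d[OF a'(3,4,5)] by (simp add: divide_le_eq)
      also have "\<dots> = \<bar>s * fst a' - s * fst b'\<bar>"
        using s by (simp add: abs_mult right_diff_distrib[symmetric])
      finally show "snd a + snd b \<le> \<bar>fst a - fst b\<bar>" using a' by simp
    qed (use fin pos in auto)
    have "s * \<bar>fst p - fst q\<bar> = snd p + snd q" using d[OF pq] unfolding seq by simp
    then have touch: "\<bar>s * fst p - s * fst q\<bar> = snd p + snd q"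
      using s by (simp add: abs_mult right_diff_distrib[symmetric])
    have fne: "?f p \<noteq> ?f q" using pq(3) inj by (auto dest: injD)
    have "\<exists>J'. separated J' \<and> intervals (?f ` J i) \<subseteq> intervals J' \<and> card J' < card (?f ` J i) \<and>
        (\<Sum>p\<in>J'. snd p) = (\<Sum>p\<in>?f ` J i. snd p)"
    proof (cases "s * fst p \<le> s * fst q")
      case True
      show ?thesis
        by (rule merge_touching[OF sJ, of "?f p" i "?f q"]) (use pq fne touch True in auto)
    next
      case False
      show ?thesis
        by (rule merge_touching[OF sJ, of "?f q" i "?f p"]) (use pq fne touch False in auto)
    qed
    then obtain J' where J': "separated J'" "intervals (?f ` J i) \<subseteq> intervals J'" "card J' < card (?f ` J i)"
        "(\<Sum>p\<in>J'. snd p) = (\<Sum>p\<in>?f ` J i. snd p)" by blast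
    define J2 where "J2 j = (if j = i then J' else ?f ` J j)" for j
    have sumf: "(\<Sum>p\<in>?f ` J j. snd p) = (\<Sum>p\<in>J j. snd p)" for j
      by (subst sum.reindex) (use inj in \<open>auto intro: inj_on_subset\<close>)
    have cardf: "card (?f ` J j) = card (J j)" for j
      by (rule card_image) (use inj in \<open>auto intro: inj_on_subset\<close>)
    have J2: "separated (J2 j)" for j using sJ J' by (simp add: J2_def)
    have [measurable]: "Pi\<^sub>E UNIV (\<lambda>i. intervals (J2 i)) \<in> sets ?P"
      using J2 by (intro sets_PiE_UNIV intervals_borel) (auto simp: separated_def)
    have "emeasure ?P (K \<inter> Pi\<^sub>E UNIV (\<lambda>i. intervals (J i))) \<le> emeasure ?P (K \<inter> Pi\<^sub>E UNIV (\<lambda>j. intervals (?f ` J j)))"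
      by (rule emeasure_Int_intervals_slide[OF K conv less.prems s sJ])
    also have "\<dots> \<le> emeasure ?P (K \<inter> Pi\<^sub>E UNIV (\<lambda>j. intervals (J2 j)))"
    proof (rule emeasure_mono)
      have "intervals (?f ` J j) \<subseteq> intervals (J2 j)" for j using J'(2) by (simp add: J2_def)
      then have "Pi\<^sub>E UNIV (\<lambda>j. intervals (?f ` J j)) \<subseteq> Pi\<^sub>E UNIV (\<lambda>j. intervals (J2 j))"
        by (intro PiE_mono)
      then show "K \<inter> Pi\<^sub>E UNIV (\<lambda>j. intervals (?f ` J j)) \<subseteq> K \<inter> Pi\<^sub>E UNIV (\<lambda>j. intervals (J2 j))"
        by blast
    qed measurable
    also have "\<dots> \<le> emeasure ?P (K \<inter> Pi\<^sub>E UNIV (\<lambda>j. {x. \<bar>x\<bar> < (\<Sum>p\<in>J2 j. snd p)}))"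
    proof (rule less.hyps)
      show "(\<Sum>j\<in>UNIV. card (J2 j)) < (\<Sum>j\<in>UNIV. card (J j))"
        by (rule sum_strict_mono_ex1) (use J'(3) in \<open>auto simp: J2_def cardf\<close>)
    qed (rule J2)
    also have "(\<lambda>j. {x. \<bar>x\<bar> < (\<Sum>p\<in>J2 j. snd p)}) = (\<lambda>j. {x. \<bar>x\<bar> < (\<Sum>p\<in>J j. snd p)})"
      using J'(4) sumf by (auto simp: J2_def fun_eq_iff)
    finally show ?thesis .
  qed
qed

text \<open>Outer regularity covers \<open>A\<close> by countably many non-overlapping compact
  intervals with excess at most \<open>e\<close>; finitely many of them carry all but
  \<open>e\<close> of the total. So the excess length and the uncovered part of \<open>A\<close> are
  both at most \<open>e\<close>.\<close>

lemma approx_by_intervals: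
  fixes A :: "real set"
  assumes A[measurable]: "A \<in> sets borel" and bdd: "bounded A" and e: "0 < e"
  obtains J where "separated J" "emeasure lborel (A - intervals J) \<le> ennreal e"
    "2 * (\<Sum>p\<in>J. snd p) \<le> measure lborel A + e"
proof (cases "A = {}")
  case True
  show thesis by (rule that[of "{}"]) (use True e in \<open>auto simp: separated_def\<close>)
next
  case ne: False
  obtain r where r: "0 < r" "\<And>x. x \<in> A \<Longrightarrow> \<bar>x\<bar> \<le> r"
    using bdd by (auto simp: bounded_pos)
  have sub: "A \<subseteq> cbox (-r) r" using r by (auto simp: abs_le_iff minus_le_iff)
  have lm: "A \<in> lmeasurable" using bounded_set_imp_lmeasurable[OF bdd] A by simp
  obtain \<D> where cD: "countable \<D>" and D: "\<And>K. K \<in> \<D> \<Longrightarrow> K \<subseteq> cbox (-r) r \<and> K \<noteq> {} \<and> (\<exists>c d. K = cbox c d)"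
    and disj: "pairwise (\<lambda>A B. interior A \<inter> interior B = {}) \<D>"
    and ine: "\<And>K. K \<in> \<D> \<Longrightarrow> box (-r) r \<noteq> {} \<Longrightarrow> interior K \<noteq> {}"
    and cover: "A \<subseteq> \<Union>\<D>" and mD: "\<Union>\<D> \<in> lmeasurable" "measure lebesgue (\<Union>\<D>) \<le> measure lebesgue A + e"
    using measurable_outer_intervals_bounded[OF lm sub e] by metis
  have Dne: "\<D> \<noteq> {}" using cover ne by auto
  let ?K = "from_nat_into \<D>"
  have KD: "?K n \<in> \<D>" for n using from_nat_into[OF Dne] .
  have Kb[measurable]: "?K n \<in> sets borel" for n using D[OF KD[of n]] by auto
  have UK: "\<Union>\<D> = (\<Union>n. ?K n)" using range_from_nat_into[OF Dne cD] by simp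
  then have UDb[measurable]: "\<Union>\<D> \<in> sets borel" by (simp add: Kb sets.countable_UN)
  have fin: "emeasure lborel (\<Union>\<D>) \<noteq> \<infinity>"
  proof -
    have "emeasure lborel (\<Union>\<D>) \<le> emeasure lborel (cbox (-r) r)" using D by (intro emeasure_mono) auto
    then show ?thesis using r by (auto simp: top_unique)
  qed
  have ms: "measure lborel (\<Union>\<D>) \<le> measure lborel A + e" using mD(2) UDb A by simp
  have SUP: "(SUP n. emeasure lborel (\<Union>i\<le>n. ?K i)) = emeasure lborel (\<Union>\<D>)"
  proof -
    have "(SUP n. emeasure lborel (\<Union>i\<le>n. ?K i)) = emeasure lborel (\<Union>n. \<Union>i\<le>n. ?K i)"
    proof (rule SUP_emeasure_incseq)
      show "range (\<lambda>n. \<Union>i\<le>n. ?K i) \<subseteq> sets lborel" by auto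
      show "incseq (\<lambda>n. \<Union>i\<le>n. ?K i)" unfolding incseq_def by (intro allI impI UN_mono) auto
    qed
    also have "(\<Union>n. \<Union>i\<le>n. ?K i) = \<Union>\<D>" unfolding UK by auto
    finally show ?thesis .
  qed
  obtain n where "emeasure lborel (\<Union>\<D>) < emeasure lborel (\<Union>i\<le>n. ?K i) + ennreal e"
    using SUP_approx_ennreal[OF e UNIV_not_empty SUP[symmetric] fin] by blast
  then have n: "emeasure lborel (\<Union>\<D>) \<le> emeasure lborel (\<Union>i\<le>n. ?K i) + ennreal e" by (rule less_imp_le)
  define F where "F = ?K ` {..n}"
  have F: "finite F" "F \<subseteq> \<D>" "\<Union>F = (\<Union>i\<le>n. ?K i)" using KD by (auto simp: F_def)
  have interval: "\<exists>c d. c < d \<and> K = {c..d}" if KF: "K \<in> F" for K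
  proof -
    obtain c d where K: "K = cbox c d" using D[of K] F(2) KF by blast
    have "interior K \<noteq> {}" using ine[of K] F(2) KF r(1) by auto
    then have "c < d" by (simp add: K)
    then show ?thesis using K by auto
  qed
  then obtain lo hi where lohi: "\<And>K. K \<in> F \<Longrightarrow> lo K < hi K" "\<And>K. K \<in> F \<Longrightarrow> K = {lo K..hi K}"
    by metis
  define g where "g K = ((lo K + hi K) / 2, (hi K - lo K) / 2)" for K :: "real set"
  define J where "J = g ` F"
  have mem: "\<bar>x - fst (g K)\<bar> < snd (g K) \<longleftrightarrow> lo K < x \<and> x < hi K" for x K
    by (auto simp: g_def abs_less_iff field_simps)
  have int: "interior K = {lo K<..<hi K}" if "K \<in> F" for K
    using lohi(2)[OF that] by (metis interior_atLeastAtMost_real)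
  have J: "separated J"
    unfolding separated_def
  proof (intro conjI ballI impI)
    show "finite J" using F by (simp add: J_def)
    show "0 < snd p" if "p \<in> J" for p using that lohi(1) by (auto simp: J_def g_def)
    fix p q assume "p \<in> J" "q \<in> J" "p \<noteq> q"
    then obtain K K' where K: "K \<in> F" "K' \<in> F" "p = g K" "q = g K'" "K \<noteq> K'" by (auto simp: J_def)
    then have "interior K \<inter> interior K' = {}" using disj F(2) by (auto simp: pairwise_def)
    then have "{lo K<..<hi K} \<inter> {lo K'<..<hi K'} = {}" using int K by simp
    moreover have "lo K < hi K" "lo K' < hi K'" using lohi(1) K by auto
    ultimately have "hi K \<le> lo K' \<or> hi K' \<le> lo K"
    proof -
      have False if "\<not> (hi K \<le> lo K' \<or> hi K' \<le> lo K)"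
      proof -
        have "max (lo K) (lo K') < min (hi K) (hi K')"
          using that \<open>lo K < hi K\<close> \<open>lo K' < hi K'\<close> by auto
        then obtain x where "max (lo K) (lo K') < x" "x < min (hi K) (hi K')" using dense by blast
        then have "x \<in> {lo K<..<hi K} \<inter> {lo K'<..<hi K'}" by simp
        then show False using \<open>{lo K<..<hi K} \<inter> {lo K'<..<hi K'} = {}\<close> by blast
      qed
      then show ?thesis by blast
    qed
    then show "snd p + snd q \<le> \<bar>fst p - fst q\<bar>"
      using K by (auto simp: g_def field_simps abs_if)
  qed
  have sub1: "intervals J \<subseteq> \<Union>\<D>"
  proof
    fix x assume "x \<in> intervals J"
    then obtain K where K: "K \<in> F" "lo K < x" "x < hi K" by (auto simp: intervals_def J_def mem)
    then have "x \<in> K" by (subst lohi(2)[OF K(1)]) auto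
    then show "x \<in> \<Union>\<D>" using K F(2) by blast
  qed
  have [measurable]: "intervals J \<in> sets borel" "\<Union>F \<in> sets borel"
    using J F by (auto intro!: intervals_borel simp: separated_def)
  show thesis
  proof (rule that[OF J])
    have "2 * (\<Sum>p\<in>J. snd p) = measure lborel (intervals J)"
      using emeasure_intervals[OF J] J by (simp add: measure_def separated_def sum_nonneg less_imp_le)
    also have "\<dots> \<le> measure lborel (\<Union>\<D>)"
      using sub1 fin by (intro measure_mono_fmeasurable) (auto simp: fmeasurable_def less_top)
    finally show "2 * (\<Sum>p\<in>J. snd p) \<le> measure lborel A + e" using ms by simp
    \<comment> \<open>Passing from compact to open intervals loses only the endpoints, a finite and
      hence null set.\<close>
    let ?E = "lo ` F \<union> hi ` F"
    have Eb: "?E \<in> sets borel" using F(1) by (intro borel_closed finite_imp_closed) auto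
    have "\<Union>\<D> - \<Union>F \<in> sets borel" by measurable
    then have UE: "(\<Union>\<D> - \<Union>F) \<union> ?E \<in> sets borel" using Eb by (rule sets.Un)
    have E: "emeasure lborel ?E = 0" using F(1) by (intro emeasure_lborel_countable) (auto intro: countable_finite)
    have "A - intervals J \<subseteq> (\<Union>\<D> - \<Union>F) \<union> ?E"
    proof
      fix x assume x: "x \<in> A - intervals J"
      show "x \<in> (\<Union>\<D> - \<Union>F) \<union> ?E"
      proof (cases "x \<in> \<Union>F")
        case True
        then obtain K where K: "K \<in> F" "x \<in> K" by blast
        then have "x \<in> {lo K..hi K}" using lohi(2) by blast
        moreover have "\<not> (lo K < x \<and> x < hi K)" using x K(1) by (auto simp: intervals_def J_def mem)
        ultimately have "x = lo K \<or> x = hi K" by auto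
        then show ?thesis using K by auto
      qed (use x cover in auto)
    qed
    then have "emeasure lborel (A - intervals J) \<le> emeasure lborel ((\<Union>\<D> - \<Union>F) \<union> ?E)"
      using UE by (intro emeasure_mono) auto
    also have "\<dots> \<le> emeasure lborel (\<Union>\<D> - \<Union>F) + emeasure lborel ?E"
      using Eb by (intro emeasure_subadditive) auto
    also have "\<dots> = emeasure lborel (\<Union>\<D>) - emeasure lborel (\<Union>F)"
    proof -
      have "\<Union>F \<subseteq> \<Union>\<D>" using F(2) by blast
      moreover from this have "emeasure lborel (\<Union>F) \<noteq> \<infinity>"
        using fin emeasure_mono[of "\<Union>F" "\<Union>\<D>" lborel] by (auto simp: top_unique)
      ultimately show ?thesis unfolding E by (subst emeasure_Diff) auto
    qed
    also have "\<dots> \<le> ennreal e"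
      using n fin unfolding F(3) by (simp add: ennreal_minus_le_iff)
    finally show "emeasure lborel (A - intervals J) \<le> ennreal e" .
  qed
qed

text \<open>Two errors arise, one from covering \<open>A i\<close> by intervals and one from
  shrinking the centred interval of length \<open>m i + e\<close> back to length \<open>m i\<close>;
  the union bound on boxes controls both.\<close>

lemma brascamp_lieb_luttinger_sets_real:
  fixes K :: "('k::finite \<Rightarrow> real) set" and A :: "'k \<Rightarrow> real set"
  assumes K[measurable]: "K \<in> sets (Pi\<^sub>M UNIV (\<lambda>_. lborel))" and conv: "convex_family K" "symmetric_family K"
    and A[measurable]: "\<And>i. A i \<in> sets borel" and bdd: "\<And>i. bounded (A i)"
  shows "emeasure (Pi\<^sub>M UNIV (\<lambda>_. lborel)) (K \<inter> Pi\<^sub>E UNIV A)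
    \<le> emeasure (Pi\<^sub>M UNIV (\<lambda>_. lborel)) (K \<inter> Pi\<^sub>E UNIV (\<lambda>i. {x. 2 * \<bar>x\<bar> < measure lborel (A i)}))"
    (is "?L \<le> ?R")
proof (rule ennreal_le_epsilon)
  let ?P = "Pi\<^sub>M (UNIV::'k set) (\<lambda>_. lborel :: real measure)"
  fix e0 :: real assume e0: "0 < e0"
  define m where "m i = measure lborel (A i)" for i
  define M where "M = (\<Sum>i\<in>UNIV. m i) + 1"
  define N where "N = real CARD('k) * M ^ (CARD('k) - 1)"
  have m0: "0 \<le> m i" for i by (simp add: m_def)
  have mM: "m i + 1 \<le> M" for i using member_le_sum[of i UNIV m] m0 by (simp add: M_def)
  have mM': "m i \<le> M" for i using mM[of i] by simp
  have M0: "0 \<le> M" using m0 by (simp add: M_def sum_nonneg)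
  have N0: "0 \<le> N" using M0 by (simp add: N_def)
  \<comment> \<open>The quotient makes two errors of size \<open>N * e\<close> fit into
    \<open>e0\<close>, and \<open>e \<le> 1\<close> ensures that \<open>M\<close> also bounds the
    enlarged lengths.\<close>
  define e where "e = min 1 (e0 / (2 * N + 1))"
  have e: "0 < e" "e \<le> 1" "2 * (N * e) \<le> e0"
  proof -
    show "0 < e" "e \<le> 1" using e0 N0 by (auto simp: e_def)
    have "2 * (N * e) \<le> 2 * (N * (e0 / (2 * N + 1)))" using N0 by (intro mult_left_mono) (auto simp: e_def)
    also have "\<dots> \<le> e0" using N0 e0 by (simp add: field_simps)
    finally show "2 * (N * e) \<le> e0" .
  qed
  have emA: "emeasure lborel (A i) = ennreal (m i)" for i
    using emeasure_bounded_finite[OF bdd[of i]] by (simp add: m_def emeasure_eq_ennreal_measure less_top)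
  have "\<exists>J. separated J \<and> emeasure lborel (A i - intervals J) \<le> ennreal e \<and> 2 * (\<Sum>p\<in>J. snd p) \<le> m i + e" for i
    using approx_by_intervals[OF A bdd e(1), of i] unfolding m_def by metis
  then obtain J where J: "\<And>i. separated (J i)" "\<And>i. emeasure lborel (A i - intervals (J i)) \<le> ennreal e"
      "\<And>i. 2 * (\<Sum>p\<in>J i. snd p) \<le> m i + e" by metis
  have Jb[measurable]: "intervals (J i) \<in> sets borel" for i
    using J(1)[of i] by (intro intervals_borel) (simp add: separated_def)
  let ?I = "\<lambda>v. Pi\<^sub>E UNIV (\<lambda>i. {x. 2 * \<bar>x\<bar> < v i})"
  have I: "?I v \<in> sets ?P" for v by (intro sets_PiE_UNIV) measurable
  have "?L \<le> emeasure ?P (K \<inter> Pi\<^sub>E UNIV (\<lambda>i. intervals (J i))) + ennreal (real CARD('k) * (e * M ^ (CARD('k) - 1)))"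
    using e(1) M0 J(2) mM' by (intro emeasure_PiM_Int_PiE_le) (auto simp: emA intro!: ennreal_leI)
  also have "real CARD('k) * (e * M ^ (CARD('k) - 1)) = N * e" by (simp add: N_def)
  also have "emeasure ?P (K \<inter> Pi\<^sub>E UNIV (\<lambda>i. intervals (J i))) \<le> emeasure ?P (K \<inter> Pi\<^sub>E UNIV (\<lambda>i. {x. \<bar>x\<bar> < (\<Sum>p\<in>J i. snd p)}))"
    by (rule emeasure_Int_intervals_le[OF K conv J(1)])
  also have "\<dots> \<le> emeasure ?P (K \<inter> ?I (\<lambda>i. m i + e))"
  proof (rule emeasure_mono)
    have "{x. \<bar>x\<bar> < (\<Sum>p\<in>J i. snd p)} \<subseteq> {x. 2 * \<bar>x\<bar> < m i + e}" for i
      using J(3)[of i] by auto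
    then have "Pi\<^sub>E UNIV (\<lambda>i. {x. \<bar>x\<bar> < (\<Sum>p\<in>J i. snd p)}) \<subseteq> ?I (\<lambda>i. m i + e)" by (intro PiE_mono)
    then show "K \<inter> Pi\<^sub>E UNIV (\<lambda>i. {x. \<bar>x\<bar> < (\<Sum>p\<in>J i. snd p)}) \<subseteq> K \<inter> ?I (\<lambda>i. m i + e)" by blast
  qed (intro sets.Int K I)
  also have "\<dots> \<le> emeasure ?P (K \<inter> ?I m) + ennreal (real CARD('k) * (e * M ^ (CARD('k) - 1)))"
  proof (rule emeasure_PiM_Int_PiE_le)
    fix i
    have eq: "{x. 2 * \<bar>x\<bar> < m i + e} = {x. \<bar>x - 0\<bar> < (m i + e) / 2}" by auto
    have "emeasure lborel {x. 2 * \<bar>x\<bar> < m i + e} = ennreal (m i + e)"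
      unfolding eq using e m0[of i] by (subst emeasure_interval) (auto simp del: ennreal_plus)
    then show "emeasure lborel {x. 2 * \<bar>x\<bar> < m i + e} \<le> ennreal M"
      using mM[of i] e by (auto intro!: ennreal_leI)
    have "{x. 2 * \<bar>x\<bar> < m i + e} - {x. 2 * \<bar>x\<bar> < m i} \<subseteq> {- (m i + e) / 2..- m i / 2} \<union> {m i / 2..(m i + e) / 2}"
      by (auto simp: abs_if split: if_splits)
    then have "emeasure lborel ({x. 2 * \<bar>x\<bar> < m i + e} - {x. 2 * \<bar>x\<bar> < m i})
        \<le> emeasure lborel ({- (m i + e) / 2..- m i / 2} \<union> {m i / 2..(m i + e) / 2})"
      by (intro emeasure_mono) auto
    also have "\<dots> \<le> emeasure lborel {- (m i + e) / 2..- m i / 2} + emeasure lborel {m i / 2..(m i + e) / 2}"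
      by (intro emeasure_subadditive) auto
    also have "\<dots> = ennreal (e / 2) + ennreal (e / 2)"
    proof -
      have "- m i / 2 - (- (m i + e) / 2) = e / 2" "(m i + e) / 2 - m i / 2 = e / 2"
        by (simp_all add: field_simps)
      moreover have "- (m i + e) / 2 \<le> - m i / 2" "m i / 2 \<le> (m i + e) / 2" using e by auto
      ultimately show ?thesis by (simp only: emeasure_lborel_Icc)
    qed
    also have "\<dots> = ennreal e" using e by (simp add: ennreal_plus[symmetric] del: ennreal_plus)
    finally show "emeasure lborel ({x. 2 * \<bar>x\<bar> < m i + e} - {x. 2 * \<bar>x\<bar> < m i}) \<le> ennreal e" .
  qed (use M0 e K in auto)
  also have "real CARD('k) * (e * M ^ (CARD('k) - 1)) = N * e" by (simp add: N_def)
  finally have "?L \<le> emeasure ?P (K \<inter> ?I m) + ennreal (N * e) + ennreal (N * e)"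
    by (simp add: add_right_mono)
  also have "\<dots> = ?R + ennreal (2 * (N * e))"
    using N0 e by (simp add: m_def ennreal_plus[symmetric] add.assoc del: ennreal_plus)
  also have "\<dots> \<le> ?R + ennreal e0"
    using e(3) by (intro add_left_mono ennreal_leI)
  finally show "?L \<le> ?R + ennreal e0" .
qed

section \<open>Steiner symmetrization\<close>

text \<open>The section through \<open>x\<close> is measured in a coordinate starting at
  \<open>x\<close>, which does not affect its length. For sections of infinite length
  \<open>measure\<close> returns 0; volume preservation is accordingly stated for bounded
  sets.\<close>

definition steiner :: "'a::euclidean_space \<Rightarrow> 'a set \<Rightarrow> 'a set" where
  "steiner e A = {x. 2 * \<bar>x \<bullet> e\<bar> < measure lborel {s. x + s *\<^sub>R e \<in> A}}"

lemma steiner_borel [measurable]: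
  assumes [measurable]: "A \<in> sets borel"
  shows "steiner e A \<in> sets borel"
proof -
  have "measure lborel {s. x + s *\<^sub>R e \<in> A} = enn2real (\<integral>\<^sup>+s. indicator A (x + s *\<^sub>R e) \<partial>lborel)" for x
  proof -
    have "(\<integral>\<^sup>+s. indicator A (x + s *\<^sub>R e) \<partial>lborel) = (\<integral>\<^sup>+s. indicator {s. x + s *\<^sub>R e \<in> A} s \<partial>lborel)"
      by (intro nn_integral_cong) (simp add: indicator_def)
    also have "\<dots> = emeasure lborel {s. x + s *\<^sub>R e \<in> A}" by simp
    finally show ?thesis by (simp add: measure_def)
  qed
  then have "steiner e A = {x. 2 * \<bar>x \<bullet> e\<bar> < enn2real (\<integral>\<^sup>+s. indicator A (x + s *\<^sub>R e) \<partial>lborel)}"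
    by (simp add: steiner_def)
  also have "\<dots> \<in> sets borel" by measurable
  finally show ?thesis .
qed

lemma measure_lborel_shift:
  fixes A :: "real set"
  assumes [measurable]: "A \<in> sets borel"
  shows "emeasure lborel {s. t + s \<in> A} = emeasure lborel A" "measure lborel {s. t + s \<in> A} = measure lborel A"
  using emeasure_lborel_affine[of 1 A t] by (simp_all add: measure_def)

lemma emeasure_symmetric_interval: "0 \<le> a \<Longrightarrow> emeasure lborel {s::real. 2 * \<bar>s\<bar> < a} = ennreal a"
proof -
  assume a: "0 \<le> a"
  have "{s::real. 2 * \<bar>s\<bar> < a} = {s. \<bar>s - 0\<bar> < a / 2}" by auto
  then show ?thesis using a emeasure_interval[of "a / 2" 0] by simp
qed

text \<open>If \<open>A\<close> is no longer than \<open>I\<close>, then \<open>J\<close> lies in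
  \<open>I\<close> and nothing is left outside. Otherwise \<open>J - I\<close> has length
  \<open>a - b\<close>, and translation puts the second set into a copy of \<open>I - A\<close>, of
  length \<open>b - d\<close>; the sum is \<open>a - d\<close>, the length of
  \<open>A - I\<close>.\<close>

lemma symmetric_interval_gain:
  fixes A :: "real set"
  assumes A[measurable]: "A \<in> sets borel" and bdd: "bounded A" and b: "0 \<le> b"
  defines "I \<equiv> {s. 2 * \<bar>s\<bar> < b}" and "J \<equiv> {s. 2 * \<bar>s\<bar> < measure lborel A}"
  shows "emeasure lborel (J - I) + emeasure lborel {s. s \<in> A - I \<and> c + s \<in> I - A} \<le> emeasure lborel (A - I)"
proof -
  have [measurable]: "I \<in> sets borel" "J \<in> sets borel" unfolding I_def J_def by measurable
  define a d where "a = measure lborel A" and "d = measure lborel (A \<inter> I)"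
  have nn: "0 \<le> a" "0 \<le> d" by (auto simp: a_def d_def)
  have finA: "emeasure lborel A = ennreal a"
    using emeasure_bounded_finite[OF bdd] by (simp add: a_def emeasure_eq_ennreal_measure less_top)
  have finI: "emeasure lborel I = ennreal b"
    unfolding I_def using b by (rule emeasure_symmetric_interval)
  have finAI: "emeasure lborel (A \<inter> I) = ennreal d"
    using emeasure_bounded_finite[of "A \<inter> I"] bdd by (simp add: d_def emeasure_eq_ennreal_measure less_top bounded_Int)
  have da: "d \<le> a" using emeasure_mono[of "A \<inter> I" A lborel] nn unfolding finA finAI by simp
  have db: "d \<le> b" using emeasure_mono[of "A \<inter> I" I lborel] nn b unfolding finI finAI by simp
  have AI: "emeasure lborel (A - I) = ennreal (a - d)"
    using emeasure_Diff[of lborel "A \<inter> I" A] finA finAI nn by (simp add: Diff_Int ennreal_minus)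
  have IA: "emeasure lborel (I - A) = ennreal (b - d)"
    using emeasure_Diff[of lborel "A \<inter> I" I] finI finAI nn by (simp add: Diff_Int ennreal_minus)
  show ?thesis
  proof (cases "a \<le> b")
    case True
    then have "J - I = {}" by (auto simp: J_def I_def a_def)
    then have "emeasure lborel (J - I) = 0" by (simp only: emeasure_empty)
    moreover have "emeasure lborel {s. s \<in> A - I \<and> c + s \<in> I - A} \<le> emeasure lborel (A - I)"
      by (intro emeasure_mono) auto
    ultimately show ?thesis by simp
  next
    case False
    have "I \<subseteq> J" using False by (auto simp: I_def J_def a_def)
    then have "emeasure lborel (J - I) = ennreal a - ennreal b"
      using finI emeasure_symmetric_interval[OF nn(1)] by (subst emeasure_Diff) (auto simp: J_def a_def)
    also have "\<dots> = ennreal (a - b)" using b by (rule ennreal_minus)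
    finally have 1: "emeasure lborel (J - I) = ennreal (a - b)" .
    have "emeasure lborel {s. s \<in> A - I \<and> c + s \<in> I - A} \<le> emeasure lborel {s. c + s \<in> I - A}"
      by (intro emeasure_mono) auto
    also have "\<dots> = ennreal (b - d)" using IA by (subst measure_lborel_shift) auto
    finally have "emeasure lborel (J - I) + emeasure lborel {s. s \<in> A - I \<and> c + s \<in> I - A} \<le> ennreal (a - b) + ennreal (b - d)"
      unfolding 1 by (rule add_left_mono)
    also have "\<dots> = ennreal (a - d)" using False db by (simp add: ennreal_plus[symmetric] del: ennreal_plus)
    finally show ?thesis unfolding AI .
  qed
qed

lemma steiner_subset_ball:
  assumes e: "norm e = 1" and A: "A \<subseteq> ball 0 r" and [measurable]: "A \<in> sets borel"
  shows "steiner e A \<subseteq> ball 0 r"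
proof
  fix x assume x: "x \<in> steiner e A"
  have ee: "e \<bullet> e = 1" using e by (simp add: norm_eq_1)
  define t where "t = x \<bullet> e"
  \<comment> \<open>When positive, \<open>h\<close> is the squared half-length of the chord that the
    ball cuts from the line through \<open>x\<close>; the chord of \<open>A\<close> lies inside
    it.\<close>
  define h where "h = r\<^sup>2 - ((norm x)\<^sup>2 - t\<^sup>2)"
  let ?E = "{s. x + s *\<^sub>R e \<in> A}"
  have E: "(t + s)\<^sup>2 < h" "0 < r" if "s \<in> ?E" for s
  proof -
    have n: "norm (x + s *\<^sub>R e) < r" using A that by auto
    then show r: "0 < r" by (meson le_less_trans norm_ge_zero)
    have "(norm (x + s *\<^sub>R e))\<^sup>2 < r\<^sup>2" using n by (intro power_strict_mono) auto
    moreover have "(norm (x + s *\<^sub>R e))\<^sup>2 = (norm x)\<^sup>2 + 2 * s * t + s\<^sup>2"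
      unfolding power2_norm_eq_inner
      by (simp add: inner_add_left inner_add_right inner_commute[of e x] ee t_def power2_eq_square algebra_simps)
    ultimately show "(t + s)\<^sup>2 < h" by (simp add: h_def power2_eq_square algebra_simps)
  qed
  have pos: "0 < measure lborel ?E" using x by (auto simp: steiner_def intro: le_less_trans[of _ "2 * \<bar>x \<bullet> e\<bar>"])
  then have "?E \<noteq> {}" by (metis measure_empty less_irrefl)
  then obtain s0 where "s0 \<in> ?E" by blast
  from E[OF this] have h: "0 < h" and r: "0 < r" by (auto intro: le_less_trans[OF zero_le_power2])
  have "?E \<subseteq> {- sqrt h - t..sqrt h - t}"
  proof
    fix s assume "s \<in> ?E"
    then have "\<bar>t + s\<bar> < sqrt h" using E(1) real_less_rsqrt[of "\<bar>t + s\<bar>" h] by simp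
    then show "s \<in> {- sqrt h - t..sqrt h - t}" by auto
  qed
  then have "measure lborel ?E \<le> measure lborel {- sqrt h - t..sqrt h - t}"
  proof (rule measure_mono_fmeasurable)
    show "{- sqrt h - t..sqrt h - t} \<in> fmeasurable lborel"
      using emeasure_bounded_finite[OF bounded_closed_interval[of "- sqrt h - t" "sqrt h - t"]]
      by (intro fmeasurableI) auto
  qed measurable
  also have "\<dots> = 2 * sqrt h" using h by simp
  finally have "\<bar>t\<bar> < sqrt h" using x by (simp add: steiner_def t_def)
  then have "t\<^sup>2 < h" using h by (metis abs_ge_zero power2_abs power_strict_mono pos2 real_sqrt_pow2 less_imp_le)
  then have "(norm x)\<^sup>2 < r\<^sup>2" by (simp add: h_def)
  then have "norm x < r" using r by (auto intro: power2_less_imp_less[OF _ less_imp_le])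
  then show "x \<in> ball 0 r" by simp
qed

context line_split begin

lemma line_section_borel [measurable]:
  assumes [measurable]: "A \<in> sets borel"
  shows "{s. z + s *\<^sub>R e \<in> A} \<in> sets borel"
  by measurable

lemma line_section_bounded:
  assumes "bounded A"
  shows "bounded {s. \<phi> u + s *\<^sub>R e \<in> A}"
proof -
  obtain r where r: "\<And>x. x \<in> A \<Longrightarrow> norm x \<le> r" using assms by (auto simp: bounded_iff)
  have "\<bar>s\<bar> \<le> r" if "\<phi> u + s *\<^sub>R e \<in> A" for s
  proof -
    have "\<bar>(\<phi> u + s *\<^sub>R e) \<bullet> e\<bar> \<le> norm (\<phi> u + s *\<^sub>R e) * norm e" by (rule Cauchy_Schwarz_ineq2)
    also have "(\<phi> u + s *\<^sub>R e) \<bullet> e = s" by (simp add: inner_add_left \<phi>_inner e_inner_e)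
    finally show ?thesis using r[OF that] norm_e by simp
  qed
  then show ?thesis by (auto simp: bounded_iff)
qed

lemma emeasure_split:
  assumes [measurable]: "A \<in> sets borel"
  shows "emeasure lborel A = (\<integral>\<^sup>+u. emeasure lborel {s. \<phi> u + s *\<^sub>R e \<in> A} \<partial>Pi\<^sub>M U (\<lambda>_. lborel))"
proof -
  have "emeasure lborel A = (\<integral>\<^sup>+u. \<integral>\<^sup>+s. indicator A (\<phi> u + s *\<^sub>R e) \<partial>lborel \<partial>Pi\<^sub>M U (\<lambda>_. lborel))"
    using nn_integral_split[of "indicator A"] by simp
  also have "\<dots> = (\<integral>\<^sup>+u. \<integral>\<^sup>+s. indicator {s. \<phi> u + s *\<^sub>R e \<in> A} s \<partial>lborel \<partial>Pi\<^sub>M U (\<lambda>_. lborel))"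
    by (intro nn_integral_cong) (simp add: indicator_def)
  finally show ?thesis by simp
qed

lemma measurable_emeasure_section [measurable]:
  assumes [measurable]: "A \<in> sets borel"
  shows "(\<lambda>u. emeasure lborel {s. \<phi> u + s *\<^sub>R e \<in> A}) \<in> borel_measurable (Pi\<^sub>M U (\<lambda>_. lborel))"
proof -
  have "(\<lambda>u. \<integral>\<^sup>+s. indicator A (\<phi> u + s *\<^sub>R e) \<partial>lborel) \<in> borel_measurable (Pi\<^sub>M U (\<lambda>_. lborel))"
    by measurable
  moreover have "(\<integral>\<^sup>+s. indicator A (\<phi> u + s *\<^sub>R e) \<partial>lborel) = emeasure lborel {s. \<phi> u + s *\<^sub>R e \<in> A}" for u
  proof -
    have "(\<integral>\<^sup>+s. indicator A (\<phi> u + s *\<^sub>R e) \<partial>lborel) = (\<integral>\<^sup>+s. indicator {s. \<phi> u + s *\<^sub>R e \<in> A} s \<partial>lborel)"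
      by (intro nn_integral_cong) (simp add: indicator_def)
    then show ?thesis by simp
  qed
  ultimately show ?thesis by simp
qed

lemma steiner_section:
  assumes [measurable]: "A \<in> sets borel"
  shows "{s. \<phi> u + s *\<^sub>R e \<in> steiner e A} = {s. 2 * \<bar>s\<bar> < measure lborel {s. \<phi> u + s *\<^sub>R e \<in> A}}"
proof -
  have "(\<phi> u + s *\<^sub>R e) \<bullet> e = s" for s by (simp add: inner_add_left \<phi>_inner e_inner_e)
  moreover have "measure lborel {s'. \<phi> u + s *\<^sub>R e + s' *\<^sub>R e \<in> A} = measure lborel {s. \<phi> u + s *\<^sub>R e \<in> A}" for s
    using measure_lborel_shift(2)[of "{s. \<phi> u + s *\<^sub>R e \<in> A}" s] by (simp add: scaleR_left_distrib add.assoc)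
  ultimately show ?thesis by (simp add: steiner_def)
qed

lemma emeasure_steiner:
  assumes [measurable]: "A \<in> sets borel" and bdd: "bounded A"
  shows "emeasure lborel (steiner e A) = emeasure lborel A"
proof -
  have "emeasure lborel {s. \<phi> u + s *\<^sub>R e \<in> steiner e A} = emeasure lborel {s. \<phi> u + s *\<^sub>R e \<in> A}" for u
  proof -
    have "emeasure lborel {s. \<phi> u + s *\<^sub>R e \<in> A} = ennreal (measure lborel {s. \<phi> u + s *\<^sub>R e \<in> A})"
      using emeasure_bounded_finite[OF line_section_bounded[OF bdd, of u]]
      by (intro emeasure_eq_ennreal_measure) (simp add: less_top)
    then show ?thesis by (simp only: steiner_section[OF assms(1)] emeasure_symmetric_interval[OF measure_nonneg])
  qed
  then show ?thesis by (simp add: emeasure_split)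
qed

lemma ball_section: "\<exists>b\<ge>0. {s. \<phi> u + s *\<^sub>R e \<in> ball 0 r} = {s. 2 * \<bar>s\<bar> < b}"
proof -
  have n: "(norm (\<phi> u + s *\<^sub>R e))\<^sup>2 = (norm (\<phi> u))\<^sup>2 + s\<^sup>2" for s
    unfolding power2_norm_eq_inner
    by (simp add: inner_add_left inner_add_right inner_commute[of e "\<phi> u"] \<phi>_inner e_inner_e power2_eq_square)
  show ?thesis
  proof (cases "norm (\<phi> u) < r")
    case True
    then have r: "0 < r" by (meson le_less_trans norm_ge_zero)
    let ?h = "r\<^sup>2 - (norm (\<phi> u))\<^sup>2"
    have h: "0 < ?h" using True by (simp add: power_strict_mono)
    have "norm (\<phi> u + s *\<^sub>R e) < r \<longleftrightarrow> \<bar>s\<bar> < sqrt ?h" for s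
    proof -
      have "norm (\<phi> u + s *\<^sub>R e) < r \<longleftrightarrow> (norm (\<phi> u + s *\<^sub>R e))\<^sup>2 < r\<^sup>2"
        using r by (metis norm_ge_zero less_imp_le power2_less_imp_less power_strict_mono pos2)
      also have "\<dots> \<longleftrightarrow> s\<^sup>2 < ?h" unfolding n by linarith
      also have "\<dots> \<longleftrightarrow> \<bar>s\<bar> < sqrt ?h"
        by (metis real_sqrt_abs real_sqrt_less_iff)
      finally show ?thesis .
    qed
    then have "{s. \<phi> u + s *\<^sub>R e \<in> ball 0 r} = {s. 2 * \<bar>s\<bar> < 2 * sqrt ?h}" by auto
    then show ?thesis using h by (intro exI[of _ "2 * sqrt ?h"]) auto
  next
    case False
    have "norm (\<phi> u) \<le> norm (\<phi> u + s *\<^sub>R e)" for s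
      by (rule power2_le_imp_le) (simp_all add: n)
    then have "{s. \<phi> u + s *\<^sub>R e \<in> ball 0 r} = {s. 2 * \<bar>s\<bar> < 0}" using False by (auto simp: not_less intro: order_trans)
    then show ?thesis by blast
  qed
qed

text \<open>Integrates the one-dimensional gain over all lines parallel to \<open>e\<close>, each of
  which meets the ball in a centred interval. Mass outside the ball that a translation along
  \<open>e\<close> would carry into a hole of the ball is recovered by the symmetrization.\<close>

lemma steiner_gain:
  assumes A[measurable]: "A \<in> sets borel" and bdd: "bounded A"
  shows "emeasure lborel (steiner e A - ball 0 r) +
      emeasure lborel {x. x \<in> A - ball 0 r \<and> c *\<^sub>R e + x \<in> ball 0 r - A} \<le> emeasure lborel (A - ball 0 r)"
proof -
  let ?B = "ball (0::'a) r"
  let ?G = "{x. x \<in> A - ?B \<and> c *\<^sub>R e + x \<in> ?B - A}"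
  have [measurable]: "?B \<in> sets borel" by simp
  have G[measurable]: "?G \<in> sets borel" by measurable
  have "emeasure lborel (steiner e A - ?B) + emeasure lborel ?G =
    (\<integral>\<^sup>+u. emeasure lborel {s. \<phi> u + s *\<^sub>R e \<in> steiner e A - ?B} + emeasure lborel {s. \<phi> u + s *\<^sub>R e \<in> ?G} \<partial>Pi\<^sub>M U (\<lambda>_. lborel))"
    by (subst (1 2) emeasure_split) (auto intro!: nn_integral_add[symmetric] measurable_emeasure_section)
  also have "\<dots> \<le> (\<integral>\<^sup>+u. emeasure lborel {s. \<phi> u + s *\<^sub>R e \<in> A - ?B} \<partial>Pi\<^sub>M U (\<lambda>_. lborel))"
  proof (rule nn_integral_mono)
    fix u
    define E where "E = {s. \<phi> u + s *\<^sub>R e \<in> A}"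
    have E: "E \<in> sets borel" "bounded E" unfolding E_def using line_section_bounded[OF bdd] by measurable
    obtain b where b: "0 \<le> b" and I: "{s. \<phi> u + s *\<^sub>R e \<in> ?B} = {s. 2 * \<bar>s\<bar> < b}" using ball_section by blast
    have 1: "{s. \<phi> u + s *\<^sub>R e \<in> steiner e A - ?B} = {s. 2 * \<bar>s\<bar> < measure lborel E} - {s. 2 * \<bar>s\<bar> < b}"
      unfolding I[symmetric] E_def steiner_section[OF A, symmetric] by blast
    have 2: "{s. \<phi> u + s *\<^sub>R e \<in> A - ?B} = E - {s. 2 * \<bar>s\<bar> < b}"
      unfolding I[symmetric] E_def by blast
    have sh: "c *\<^sub>R e + (\<phi> u + s *\<^sub>R e) = \<phi> u + (c + s) *\<^sub>R e" for s by (simp add: algebra_simps)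
    have mem: "\<phi> u + s *\<^sub>R e \<in> ?B \<longleftrightarrow> 2 * \<bar>s\<bar> < b" "\<phi> u + s *\<^sub>R e \<in> A \<longleftrightarrow> s \<in> E" for s
      using I by (auto simp: E_def)
    have 3: "{s. \<phi> u + s *\<^sub>R e \<in> ?G} = {s. s \<in> E - {s. 2 * \<bar>s\<bar> < b} \<and> c + s \<in> {s. 2 * \<bar>s\<bar> < b} - E}"
      by (simp only: mem_Collect_eq sh Diff_iff mem)
    show "emeasure lborel {s. \<phi> u + s *\<^sub>R e \<in> steiner e A - ?B} + emeasure lborel {s. \<phi> u + s *\<^sub>R e \<in> ?G}
      \<le> emeasure lborel {s. \<phi> u + s *\<^sub>R e \<in> A - ?B}"
      unfolding 1 2 3 by (rule symmetric_interval_gain[OF E b])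
  qed
  also have "\<dots> = emeasure lborel (A - ?B)" by (rule emeasure_split[symmetric]) measurable
  finally show ?thesis .
qed

text \<open>With the feet \<open>\<phi> (Y i)\<close> fixed, the fibre of \<open>S\<close> is convex
  and symmetric in \<open>t\<close>, and the fibres of the Steiner sets are the centred intervals of
  the same lengths; the inequality on the line applies in every fibre.\<close>

lemma emeasure_Int_PiE_steiner:
  fixes S :: "('k::finite \<Rightarrow> 'a) set"
  assumes S[measurable]: "S \<in> sets (Pi\<^sub>M UNIV (\<lambda>_. lborel))"
    and conv: "\<And>y. (\<And>i. y i \<bullet> e = 0) \<Longrightarrow> convex_family {t. (\<lambda>i. y i + t i *\<^sub>R e) \<in> S}"
    and sym: "\<And>y. (\<And>i. y i \<bullet> e = 0) \<Longrightarrow> symmetric_family {t. (\<lambda>i. y i + t i *\<^sub>R e) \<in> S}"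
    and A[measurable]: "\<And>i. A i \<in> sets borel" and bdd: "\<And>i. bounded (A i)"
  shows "emeasure (Pi\<^sub>M UNIV (\<lambda>_. lborel)) (S \<inter> Pi\<^sub>E UNIV A)
    \<le> emeasure (Pi\<^sub>M UNIV (\<lambda>_. lborel)) (S \<inter> Pi\<^sub>E UNIV (\<lambda>i. steiner e (A i)))"
proof -
  let ?P = "Pi\<^sub>M (UNIV::'k set) (\<lambda>_. lborel :: real measure)"
  let ?M = "Pi\<^sub>M (UNIV::'k set) (\<lambda>_. Pi\<^sub>M U (\<lambda>_. lborel :: real measure))"
  define K where "K Y = {t. (\<lambda>i. \<phi> (Y i) + t i *\<^sub>R e) \<in> S}" for Y :: "'k \<Rightarrow> 'a \<Rightarrow> real"
  have Kb: "K Y \<in> sets ?P" for Y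
  proof -
    have "(\<lambda>t i. \<phi> (Y i) + t i *\<^sub>R e) \<in> measurable ?P (Pi\<^sub>M UNIV (\<lambda>_. lborel))"
      by (rule measurable_PiM_single') auto
    from measurable_sets[OF this S] show ?thesis by (simp add: K_def vimage_def space_PiM)
  qed
  have split: "emeasure (Pi\<^sub>M UNIV (\<lambda>_. lborel)) (S \<inter> Pi\<^sub>E UNIV B) =
      (\<integral>\<^sup>+Y. emeasure ?P (K Y \<inter> Pi\<^sub>E UNIV (\<lambda>i. {s. \<phi> (Y i) + s *\<^sub>R e \<in> B i})) \<partial>?M)"
    if B[measurable]: "\<And>i. B i \<in> sets borel" for B :: "'k \<Rightarrow> 'a set"
  proof -
    have SB: "S \<inter> Pi\<^sub>E UNIV B \<in> sets (Pi\<^sub>M UNIV (\<lambda>_. lborel))" using sets_PiE_UNIV[of B] B by (intro sets.Int S) auto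
    have "emeasure (Pi\<^sub>M UNIV (\<lambda>_. lborel)) (S \<inter> Pi\<^sub>E UNIV B) =
      (\<integral>\<^sup>+Y. \<integral>\<^sup>+t. indicator (S \<inter> Pi\<^sub>E UNIV B) (\<lambda>i. \<phi> (Y i) + t i *\<^sub>R e) \<partial>?P \<partial>?M)"
      using SB by (subst nn_integral_PiM_split[symmetric]) auto
    also have "\<dots> = (\<integral>\<^sup>+Y. \<integral>\<^sup>+t. indicator (K Y \<inter> Pi\<^sub>E UNIV (\<lambda>i. {s. \<phi> (Y i) + s *\<^sub>R e \<in> B i})) t \<partial>?P \<partial>?M)"
      by (intro nn_integral_cong) (simp add: indicator_def K_def PiE_UNIV_domain Pi_def)
    also have "\<dots> = (\<integral>\<^sup>+Y. emeasure ?P (K Y \<inter> Pi\<^sub>E UNIV (\<lambda>i. {s. \<phi> (Y i) + s *\<^sub>R e \<in> B i})) \<partial>?M)"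
      using Kb by (intro nn_integral_cong nn_integral_indicator sets.Int sets_PiE_UNIV line_section_borel B) auto
    finally show ?thesis .
  qed
  have "emeasure ?P (K Y \<inter> Pi\<^sub>E UNIV (\<lambda>i. {s. \<phi> (Y i) + s *\<^sub>R e \<in> A i}))
      \<le> emeasure ?P (K Y \<inter> Pi\<^sub>E UNIV (\<lambda>i. {s. \<phi> (Y i) + s *\<^sub>R e \<in> steiner e (A i)}))" for Y
    unfolding steiner_section[OF A]
    by (rule brascamp_lieb_luttinger_sets_real[OF Kb])
      (auto simp: K_def \<phi>_inner intro!: conv sym line_section_borel A line_section_bounded bdd)
  then show ?thesis
    by (simp add: split nn_integral_mono)
qed

end

text \<open>The feet \<open>y i\<close> are taken in the hyperplane orthogonal to \<open>e\<close>
  because the reflection behind the symmetry in \<open>t\<close> must fix them. All directions are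
  included, as the symmetrization argument chooses its own.\<close>

definition steiner_concave :: "('k \<Rightarrow> 'a::euclidean_space) set \<Rightarrow> bool" where
  "steiner_concave S \<longleftrightarrow> (\<forall>e y. norm e = 1 \<longrightarrow> (\<forall>i. y i \<bullet> e = 0) \<longrightarrow>
     convex_family {t. (\<lambda>i. y i + t i *\<^sub>R e) \<in> S} \<and> symmetric_family {t. (\<lambda>i. y i + t i *\<^sub>R e) \<in> S})"

text \<open>The overlap of \<open>V\<close> with translates of \<open>W\<close> integrates to the
  product of their measures and vanishes for \<open>w\<close> outside the ball of radius
  \<open>2 * R\<close>, so some \<open>w\<close> does about as well as the average. The factor 2
  turns the negation into a contradiction between finite positive numbers, without needing a strict
  inequality under the integral.\<close>

lemma exists_good_translation:
  fixes V W :: "'a::euclidean_space set"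
  assumes [measurable]: "V \<in> sets borel" "W \<in> sets borel" and sub: "V \<subseteq> ball 0 R" "W \<subseteq> ball 0 R"
    and pos: "0 < emeasure lborel V" "0 < emeasure lborel W"
  shows "\<exists>w. emeasure lborel V * emeasure lborel W \<le> 2 * emeasure lborel (ball (0::'a) (2 * R)) * emeasure lborel {x. x \<in> V \<and> w + x \<in> W}"
proof (rule ccontr)
  let ?B = "ball (0::'a) (2 * R)"
  let ?c = "emeasure lborel V * emeasure lborel W" and ?\<beta> = "emeasure lborel ?B"
  define g where "g w = (\<integral>\<^sup>+x. indicator V x * indicator W (w + x) \<partial>lborel)" for w
  have g: "g w = emeasure lborel {x. x \<in> V \<and> w + x \<in> W}" for w
  proof -
    have "{x. x \<in> V \<and> w + x \<in> W} \<in> sets borel" by measurable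
    moreover have "g w = (\<integral>\<^sup>+x. indicator {x. x \<in> V \<and> w + x \<in> W} x \<partial>lborel)"
      unfolding g_def by (intro nn_integral_cong) (simp add: indicator_def)
    ultimately show ?thesis by simp
  qed
  assume "\<not> ?thesis"
  then have less: "2 * ?\<beta> * g w \<le> ?c" for w unfolding g by (meson not_le less_imp_le)
  have [measurable]: "g \<in> borel_measurable borel" unfolding g_def by measurable
  have "(\<integral>\<^sup>+w. g w \<partial>lborel) = (\<integral>\<^sup>+x. \<integral>\<^sup>+w. indicator V x * indicator W (w + x) \<partial>lborel \<partial>lborel)"
    unfolding g_def by (rule lborel_pair.Fubini') measurable
  also have "\<dots> = (\<integral>\<^sup>+x. indicator V x * (\<integral>\<^sup>+w. indicator W (x + w) \<partial>lborel) \<partial>lborel)"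
    by (intro nn_integral_cong) (simp add: nn_integral_cmult add.commute)
  also have "\<dots> = (\<integral>\<^sup>+x. indicator V x * emeasure lborel W \<partial>lborel)"
    by (subst nn_integral_lborel_translate) auto
  also have "\<dots> = ?c" by (simp add: nn_integral_multc)
  finally have int: "(\<integral>\<^sup>+w. g w \<partial>lborel) = ?c" .
  have supp: "g w = 0" if "w \<notin> ?B" for w
  proof -
    have "\<not> (x \<in> V \<and> w + x \<in> W)" for x
    proof
      assume "x \<in> V \<and> w + x \<in> W"
      then have "norm x < R" "norm (w + x) < R" using sub by auto
      then have "norm w < 2 * R" using norm_triangle_ineq4[of "w + x" x] by simp
      then show False using that by simp
    qed
    then have "{x. x \<in> V \<and> w + x \<in> W} = {}" by blast
    then show ?thesis unfolding g by (simp only: emeasure_empty)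
  qed
  have "2 * ?\<beta> * ?c = (\<integral>\<^sup>+w. 2 * ?\<beta> * g w \<partial>lborel)"
    unfolding int[symmetric] by (rule nn_integral_cmult[symmetric]) measurable
  also have "\<dots> \<le> (\<integral>\<^sup>+w. ?c * indicator ?B w \<partial>lborel)"
    using less supp by (intro nn_integral_mono) (auto simp: indicator_def)
  also have "\<dots> = ?\<beta> * ?c"
    by (subst nn_integral_cmult_indicator) (auto simp: mult.commute)
  finally have le: "2 * (?\<beta> * ?c) \<le> ?\<beta> * ?c" by (simp add: mult.assoc)
  have VB: "emeasure lborel V \<le> ?\<beta>" "emeasure lborel W \<le> ?\<beta>"
  proof -
    have "ball (0::'a) R \<subseteq> ?B"
    proof
      fix x :: 'a assume "x \<in> ball 0 R"
      then have "norm x < R" by simp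
      then have "norm x < 2 * R" using norm_ge_zero[of x] by linarith
      then show "x \<in> ?B" by simp
    qed
    then show "emeasure lborel V \<le> ?\<beta>" "emeasure lborel W \<le> ?\<beta>"
      using sub by (auto intro!: emeasure_mono)
  qed
  have fin: "?\<beta> < top" using emeasure_bounded_finite[of ?B] by (simp add: less_top)
  have "?\<beta> * ?c < top" using fin VB by (auto simp: ennreal_mult_less_top intro: le_less_trans)
  moreover have "0 < ?\<beta> * ?c" using pos VB by (auto simp: ennreal_zero_less_mult_iff intro: less_le_trans)
  ultimately show False using le by (cases "?\<beta> * ?c") (auto simp: ennreal_mult[symmetric] ennreal_numeral[symmetric] simp del: ennreal_numeral)
qed

text \<open>If the infimum of the deviation \<open>D\<close> over all families satisfying
  \<open>Q\<close> were positive, one symmetrization of a nearly minimal family would go below it,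
  because the drop depends only on that infimum. Hence \<open>D\<close> becomes arbitrarily small,
  and the union bound compares such a family with the balls.\<close>

lemma emeasure_Int_PiE_ball_bounded:
  fixes S :: "('k::finite \<Rightarrow> 'a::euclidean_space) set"
  assumes S[measurable]: "S \<in> sets (Pi\<^sub>M UNIV (\<lambda>_. lborel))" and conc: "steiner_concave S"
    and A: "\<And>i. A i \<in> sets borel" "\<And>i. A i \<subseteq> ball 0 R" and r: "\<And>i. r i \<le> R"
    and le: "\<And>i. emeasure lborel (A i) \<le> emeasure lborel (ball (0::'a) (r i))"
  shows "emeasure (Pi\<^sub>M UNIV (\<lambda>_. lborel)) (S \<inter> Pi\<^sub>E UNIV A)
    \<le> emeasure (Pi\<^sub>M UNIV (\<lambda>_. lborel)) (S \<inter> Pi\<^sub>E UNIV (\<lambda>i. ball 0 (r i)))"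
proof -
  let ?J = "\<lambda>A. emeasure (Pi\<^sub>M UNIV (\<lambda>_. lborel)) (S \<inter> Pi\<^sub>E UNIV A)"
  let ?B = "\<lambda>i. ball (0::'a) (r i)"
  \<comment> \<open>Admits every family with the right size bounds and at least the original mass in
    \<open>S\<close>, not just iterated symmetrizations of \<open>A\<close>; one more symmetrization
    preserves this.\<close>
  define Q where "Q E \<longleftrightarrow> (\<forall>i. E i \<in> sets borel \<and> E i \<subseteq> ball 0 R \<and> emeasure lborel (E i) \<le> emeasure lborel (?B i))
    \<and> ?J A \<le> ?J E" for E
  define d where "d E i = measure lborel (E i - ?B i)" for E i
  define D where "D E = (\<Sum>i\<in>UNIV. d E i)" for E
  define \<beta> where "\<beta> = measure lborel (ball (0::'a) (2 * R))"
  have d0: "0 \<le> d E i" for E i by (simp add: d_def)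
  have D0: "0 \<le> D E" for E by (simp add: D_def d0 sum_nonneg)
  have bdd: "bounded E" if "E \<subseteq> ball 0 R" for E :: "'a set" using that bounded_subset bounded_ball by blast
  have em: "emeasure lborel E = ennreal (measure lborel E)" if "E \<subseteq> ball 0 \<rho>" for E :: "'a set" and \<rho>
    using emeasure_bounded_finite[of E] bounded_subset[OF bounded_ball that]
    by (intro emeasure_eq_ennreal_measure) (simp add: less_top)
  have QA: "Q A" using A le by (simp add: Q_def)
  have step: "\<exists>E'. Q E' \<and> D E' \<le> D E - (\<delta> / real CARD('k))\<^sup>2 / (2 * \<beta>)"
    if QE: "Q E" and \<delta>: "0 < \<delta>" "\<delta> \<le> D E" for E \<delta>
  proof -
    have E[measurable]: "\<And>i. E i \<in> sets borel" and ER: "\<And>i. E i \<subseteq> ball 0 R"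
      and EB: "\<And>i. emeasure lborel (E i) \<le> emeasure lborel (?B i)" and JE: "?J A \<le> ?J E"
      using QE by (auto simp: Q_def)
    \<comment> \<open>Pigeonhole: one of the sets carries at least the average share of the
      deviation. The direction is chosen for this set, and the others do not get worse.\<close>
    have "\<exists>i. \<delta> / real CARD('k) \<le> d E i"
    proof (rule ccontr)
      assume "\<not> ?thesis"
      then have "D E < (\<Sum>i\<in>(UNIV::'k set). \<delta> / real CARD('k))"
        unfolding D_def by (intro sum_strict_mono) (auto simp: not_le)
      then show False using \<delta> by simp
    qed
    then obtain i where i: "\<delta> / real CARD('k) \<le> d E i" by blast
    have c0: "0 < \<delta> / real CARD('k)" using \<delta> by simp
    let ?V = "E i - ?B i" and ?W = "?B i - E i"
    have V: "emeasure lborel ?V = ennreal (d E i)"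
      unfolding d_def using ER by (intro em) blast
    \<comment> \<open>Since \<open>E i\<close> is at most as large as its ball, the part sticking
      out is at most as large as the hole.\<close>
    have VW: "emeasure lborel ?V \<le> emeasure lborel ?W"
    proof -
      have 1: "emeasure lborel (E i \<inter> ?B i) + emeasure lborel ?V = emeasure lborel (E i)"
        by (subst plus_emeasure) (auto intro!: arg_cong[where f="emeasure lborel"])
      have 2: "emeasure lborel (E i \<inter> ?B i) + emeasure lborel ?W = emeasure lborel (?B i)"
        by (subst plus_emeasure) (auto intro!: arg_cong[where f="emeasure lborel"])
      have "emeasure lborel (E i \<inter> ?B i) + emeasure lborel ?V \<le> emeasure lborel (E i \<inter> ?B i) + emeasure lborel ?W"
        unfolding 1 2 by (rule EB)
      moreover have "emeasure lborel (E i \<inter> ?B i) \<noteq> \<infinity>"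
      proof -
        have "E i \<inter> ?B i \<subseteq> ball 0 R" using ER[of i] by blast
        from em[OF this] show ?thesis by (metis ennreal_neq_top infinity_ennreal_def)
      qed
      ultimately show ?thesis by (simp add: ennreal_add_left_cancel_le)
    qed
    have sub: "?V \<subseteq> ball 0 R" "?W \<subseteq> ball 0 R" using ER r[of i] by auto
    have pos: "0 < emeasure lborel ?V" using V i c0 by simp
    then obtain w where w: "emeasure lborel ?V * emeasure lborel ?W
        \<le> 2 * emeasure lborel (ball (0::'a) (2 * R)) * emeasure lborel {x. x \<in> ?V \<and> w + x \<in> ?W}"
      using exists_good_translation[OF _ _ sub] VW by (auto intro: less_le_trans)
    let ?G = "{x. x \<in> ?V \<and> w + x \<in> ?W}"
    have G: "emeasure lborel ?G = ennreal (measure lborel ?G)" using ER by (intro em) blast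
    have "ennreal ((d E i)\<^sup>2) = emeasure lborel ?V * emeasure lborel ?V"
      unfolding V using d0 by (simp add: ennreal_mult power2_eq_square)
    also have "\<dots> \<le> emeasure lborel ?V * emeasure lborel ?W" using VW by (rule mult_left_mono) simp
    also have "\<dots> \<le> 2 * emeasure lborel (ball (0::'a) (2 * R)) * emeasure lborel ?G" by (rule w)
    also have "\<dots> = ennreal (2 * \<beta> * measure lborel ?G)"
      unfolding G em[OF order_refl] \<beta>_def[symmetric] by (simp add: ennreal_mult \<beta>_def)
    finally have dG: "(d E i)\<^sup>2 \<le> 2 * \<beta> * measure lborel ?G" by (simp add: \<beta>_def ennreal_le_iff)
    have dpos: "0 < (d E i)\<^sup>2" using i c0 by simp
    then have "0 < 2 * \<beta> * measure lborel ?G" using dG by linarith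
    then have "\<beta> \<noteq> 0" "measure lborel ?G \<noteq> 0" by auto
    then have \<beta>: "0 < \<beta>" and G0: "0 < measure lborel ?G"
      using measure_nonneg[of lborel ?G] by (auto simp: \<beta>_def order_less_le)
    \<comment> \<open>The zero translation cannot carry \<open>?V\<close> into the disjoint set
      \<open>?W\<close>, so the translation has a direction to symmetrize in.\<close>
    have w0: "w \<noteq> 0"
    proof
      assume "w = 0"
      then have "?G = {}" by auto
      then show False using G0 by (metis measure_empty less_irrefl)
    qed
    have gain: "(\<delta> / real CARD('k))\<^sup>2 / (2 * \<beta>) \<le> measure lborel ?G"
    proof -
      have "(\<delta> / real CARD('k))\<^sup>2 \<le> (d E i)\<^sup>2" using i c0 by (intro power_mono) auto
      then show ?thesis using dG \<beta> by (simp add: divide_le_eq mult.commute)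
    qed
    define e where "e = w /\<^sub>R norm w"
    have e: "norm e = 1" "norm w *\<^sub>R e = w" using w0 by (auto simp: e_def)
    obtain U \<phi> where "line_split e U \<phi>" using line_split_exists[OF e(1)] by blast
    then interpret line_split e U \<phi> .
    let ?E = "\<lambda>i. steiner e (E i)"
    have st: "steiner e (E j) \<subseteq> ball 0 R" for j by (rule steiner_subset_ball[OF e(1) ER]) measurable
    have "?J E \<le> ?J ?E"
      using conc e(1) by (intro emeasure_Int_PiE_steiner S E bdd ER) (auto simp: steiner_concave_def)
    then have "Q ?E"
      using JE EB st by (auto simp: Q_def emeasure_steiner bdd ER)
    have gain_j: "ennreal (d ?E j) + emeasure lborel {x. x \<in> E j - ?B j \<and> norm w *\<^sub>R e + x \<in> ?B j - E j} \<le> ennreal (d E j)" for j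
    proof -
      have "ennreal (d ?E j) = emeasure lborel (?E j - ?B j)" "ennreal (d E j) = emeasure lborel (E j - ?B j)"
        unfolding d_def using st ER by (auto intro!: em[symmetric])
      then show ?thesis using steiner_gain[OF E bdd[OF ER], of j "r j" "norm w"] by simp
    qed
    have dj: "d ?E j \<le> d E j" for j
      using order_trans[OF add_increasing2[OF zero_le order_refl] gain_j] d0 by (simp add: ennreal_le_iff)
    have "ennreal (d ?E i + measure lborel ?G) \<le> ennreal (d E i)"
      using gain_j[of i] unfolding e(2) G by (simp only: ennreal_plus[OF d0 measure_nonneg])
    then have di: "d ?E i + measure lborel ?G \<le> d E i" by (simp only: ennreal_le_iff[OF d0])
    have "D ?E = d ?E i + (\<Sum>j\<in>UNIV - {i}. d ?E j)" unfolding D_def by (rule sum.remove) auto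
    also have "\<dots> \<le> (d E i - measure lborel ?G) + (\<Sum>j\<in>UNIV - {i}. d E j)"
      using di dj by (intro add_mono sum_mono) auto
    also have "\<dots> = D E - measure lborel ?G" unfolding D_def by (subst (2) sum.remove[of _ i]) auto
    finally have "D ?E \<le> D E - (\<delta> / real CARD('k))\<^sup>2 / (2 * \<beta>)" using gain by linarith
    then show ?thesis using \<open>Q ?E\<close> by blast
  qed
  have small: "\<exists>E. Q E \<and> D E < \<epsilon>" if \<epsilon>: "0 < \<epsilon>" for \<epsilon>
  proof (rule ccontr)
    assume no: "\<not> ?thesis"
    let ?X = "D ` {E. Q E}"
    define \<delta> where "\<delta> = Inf ?X"
    have ne: "?X \<noteq> {}" using QA by blast
    have bb: "bdd_below ?X" using D0 by (auto intro!: bdd_belowI)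
    have "\<epsilon> \<le> \<delta>" unfolding \<delta>_def using ne no by (intro cInf_greatest) (auto simp: not_less)
    then have \<delta>: "0 < \<delta>" using \<epsilon> by linarith
    define \<eta> where "\<eta> = (\<delta> / real CARD('k))\<^sup>2 / (2 * \<beta>)"
    have low: "\<delta> \<le> D E" if "Q E" for E unfolding \<delta>_def using that bb by (intro cInf_lower) auto
    \<comment> \<open>The drop would be meaningless if the ball of radius \<open>2 * R\<close> were
      null, but then \<open>A\<close> itself would have deviation zero.\<close>
    have "0 < \<eta>"
    proof -
      have "\<beta> \<noteq> 0"
      proof
        assume "\<beta> = 0"
        then have "emeasure lborel (ball (0::'a) (2 * R)) = 0" using em[OF order_refl] by (simp add: \<beta>_def)
        moreover have "A i - ?B i \<subseteq> ball 0 (2 * R)" for i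
        proof
          fix x assume "x \<in> A i - ?B i"
          then have "x \<in> ball 0 R" using A(2)[of i] by blast
          then have x: "norm x < R" by simp
          then have "0 \<le> R" using norm_ge_zero[of x] by linarith
          then have "norm x < 2 * R" using x by linarith
          then show "x \<in> ball 0 (2 * R)" by simp
        qed
        ultimately have "emeasure lborel (A i - ?B i) = 0" for i
          using emeasure_mono[of "A i - ?B i" "ball 0 (2 * R)" lborel] by simp
        then have "D A = 0" by (simp add: D_def d_def measure_def)
        then show False using low[OF QA] \<delta> by simp
      qed
      then have "0 < \<beta>" by (simp add: \<beta>_def order_less_le)
      then show ?thesis using \<delta> by (simp add: \<eta>_def)
    qed
    then have "Inf ?X < \<delta> + \<eta>" by (simp add: \<delta>_def)
    then obtain E where E: "Q E" "D E < \<delta> + \<eta>"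
      using cInf_less_iff[OF ne bb] by blast
    obtain E' where "Q E'" "D E' \<le> D E - \<eta>" using step[OF E(1) \<delta> low[OF E(1)]] by (auto simp: \<eta>_def)
    then show False using low[of E'] E(2) by linarith
  qed
  define M where "M = measure lborel (ball (0::'a) R)"
  define N where "N = real CARD('k) * M ^ (CARD('k) - 1)"
  have N0: "0 \<le> N" by (simp add: N_def M_def)
  show ?thesis
  proof (rule ennreal_le_epsilon)
    fix \<epsilon> :: real assume \<epsilon>: "0 < \<epsilon>"
    \<comment> \<open>The union bound multiplies the deviation by \<open>N\<close>; dividing by
      \<open>N + 1\<close> also covers \<open>N = 0\<close>.\<close>
    define \<epsilon>' where "\<epsilon>' = \<epsilon> / (N + 1)"
    have \<epsilon>': "0 < \<epsilon>'" "N * \<epsilon>' \<le> \<epsilon>" using \<epsilon> N0 by (auto simp: \<epsilon>'_def field_simps)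
    obtain E where E: "Q E" "D E < \<epsilon>'" using small[OF \<epsilon>'(1)] by blast
    have Eb: "\<And>i. E i \<in> sets borel" and ER: "\<And>i. E i \<subseteq> ball 0 R" and JE: "?J A \<le> ?J E"
      using E(1) by (auto simp: Q_def)
    have "?J E \<le> ?J ?B + ennreal (real CARD('k) * (\<epsilon>' * M ^ (CARD('k) - 1)))"
    proof (rule emeasure_PiM_Int_PiE_le[OF S _ Eb])
      fix i
      show "emeasure lborel (E i) \<le> ennreal M"
        unfolding M_def em[OF order_refl, symmetric] using ER by (intro emeasure_mono) auto
      have "d E i \<le> D E" unfolding D_def by (rule member_le_sum) (auto simp: d0)
      then have "d E i \<le> \<epsilon>'" using E(2) by linarith
      moreover have "emeasure lborel (E i - ?B i) = ennreal (d E i)"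
        unfolding d_def using ER by (intro em) blast
      ultimately show "emeasure lborel (E i - ?B i) \<le> ennreal \<epsilon>'" by (simp add: ennreal_leI)
    qed (use \<epsilon>' in \<open>auto simp: M_def\<close>)
    also have "real CARD('k) * (\<epsilon>' * M ^ (CARD('k) - 1)) = N * \<epsilon>'" by (simp add: N_def)
    also have "?J ?B + ennreal (N * \<epsilon>') \<le> ?J ?B + ennreal \<epsilon>"
      using \<epsilon>'(2) by (intro add_left_mono ennreal_leI)
    finally show "?J A \<le> ?J ?B + ennreal \<epsilon>" using JE by (rule order_trans[rotated])
  qed
qed

text \<open>Truncation shrinks the sets \<open>A i\<close> while the balls stay the same, which is
  why the comparison of measures is an inequality.\<close>

lemma emeasure_Int_PiE_ball:
  fixes S :: "('k::finite \<Rightarrow> 'a::euclidean_space) set"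
  assumes S[measurable]: "S \<in> sets (Pi\<^sub>M UNIV (\<lambda>_. lborel))" and conc: "steiner_concave S"
    and A[measurable]: "\<And>i. A i \<in> sets borel"
    and le: "\<And>i. emeasure lborel (A i) \<le> emeasure lborel (ball (0::'a) (r i))"
  shows "emeasure (Pi\<^sub>M UNIV (\<lambda>_. lborel)) (S \<inter> Pi\<^sub>E UNIV A)
    \<le> emeasure (Pi\<^sub>M UNIV (\<lambda>_. lborel)) (S \<inter> Pi\<^sub>E UNIV (\<lambda>i. ball 0 (r i)))"
proof -
  let ?P = "Pi\<^sub>M (UNIV::'k set) (\<lambda>_. lborel :: 'a measure)"
  let ?A = "\<lambda>m i. A i \<inter> ball 0 (real m)"
  have A': "?A m i \<in> sets borel" for m i by simp
  have eq: "S \<inter> Pi\<^sub>E UNIV A = (\<Union>m. S \<inter> Pi\<^sub>E UNIV (?A m))"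
  proof (intro equalityI subsetI)
    fix x assume x: "x \<in> S \<inter> Pi\<^sub>E UNIV A"
    obtain m where m: "Max (range (\<lambda>i. norm (x i))) < real m" using reals_Archimedean2 by blast
    have "norm (x i) < real m" for i
      using m by (rule le_less_trans[rotated]) (auto intro: Max_ge)
    then have "x \<in> S \<inter> Pi\<^sub>E UNIV (?A m)" using x by (simp add: PiE_UNIV_domain Pi_def)
    then show "x \<in> (\<Union>m. S \<inter> Pi\<^sub>E UNIV (?A m))" by blast
  qed (auto simp: PiE_UNIV_domain)
  have "emeasure ?P (S \<inter> Pi\<^sub>E UNIV A) = (SUP m. emeasure ?P (S \<inter> Pi\<^sub>E UNIV (?A m)))"
    unfolding eq
  proof (rule SUP_emeasure_incseq[symmetric])
    show "range (\<lambda>m. S \<inter> Pi\<^sub>E UNIV (?A m)) \<subseteq> sets ?P"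
      by (auto intro!: sets.Int S sets_PiE_UNIV)
    have "Pi\<^sub>E UNIV (?A m) \<subseteq> Pi\<^sub>E UNIV (?A n)" if "m \<le> n" for m n
      using that by (intro PiE_mono) auto
    then show "incseq (\<lambda>m. S \<inter> Pi\<^sub>E UNIV (?A m))" unfolding incseq_def by blast
  qed
  also have "\<dots> \<le> emeasure ?P (S \<inter> Pi\<^sub>E UNIV (\<lambda>i. ball 0 (r i)))"
  proof (rule SUP_least)
    fix m :: nat
    define R where "R = max (real m) (Max (range r))"
    show "emeasure ?P (S \<inter> Pi\<^sub>E UNIV (?A m)) \<le> emeasure ?P (S \<inter> Pi\<^sub>E UNIV (\<lambda>i. ball 0 (r i)))"
    proof (rule emeasure_Int_PiE_ball_bounded[OF S conc A'])
      fix i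
      show "?A m i \<subseteq> ball 0 R" by (auto simp: R_def)
      have "r i \<le> Max (range r)" by (rule Max_ge) auto
      then show "r i \<le> R" unfolding R_def by (rule max.coboundedI2)
      have "emeasure lborel (?A m i) \<le> emeasure lborel (A i)" by (intro emeasure_mono) auto
      then show "emeasure lborel (?A m i) \<le> emeasure lborel (ball (0::'a) (r i))" using le by (rule order_trans)
    qed
  qed
  finally show ?thesis .
qed

section \<open>Rearrangement of densities\<close>

text \<open>One independent level per factor. Keeping the sets \<open>A i t\<close> abstract lets
  the same formula serve the superlevel sets of the densities and the centred balls that replace
  them.\<close>

lemma layer_cake_PiM:
  fixes S :: "('k::finite \<Rightarrow> 'a::euclidean_space) set" and A :: "'k \<Rightarrow> real \<Rightarrow> 'a set"
  assumes S[measurable]: "S \<in> sets (Pi\<^sub>M UNIV (\<lambda>_. lborel))"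
    and A[measurable]: "\<And>i. (\<lambda>(x, t). indicator (A i t) x :: ennreal) \<in> borel_measurable (lborel \<Otimes>\<^sub>M lborel)"
    and Ab: "\<And>i t. A i t \<in> sets borel"
  shows "(\<integral>\<^sup>+x. indicator S x * (\<Prod>i\<in>UNIV. \<integral>\<^sup>+t\<in>{0<..}. indicator (A i t) (x i) \<partial>lborel) \<partial>Pi\<^sub>M UNIV (\<lambda>_. lborel)) =
    (\<integral>\<^sup>+t. (\<Prod>i\<in>UNIV. indicator {0<..} (t i)) * emeasure (Pi\<^sub>M UNIV (\<lambda>_. lborel)) (S \<inter> Pi\<^sub>E UNIV (\<lambda>i. A i (t i)))
      \<partial>Pi\<^sub>M UNIV (\<lambda>_. lborel))"
proof -
  let ?P = "Pi\<^sub>M (UNIV::'k set) (\<lambda>_. lborel :: 'a measure)" and ?K = "Pi\<^sub>M (UNIV::'k set) (\<lambda>_. lborel :: real measure)"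
  interpret P: finite_product_sigma_finite "\<lambda>_. lborel :: 'a measure" "UNIV :: 'k set" by standard simp
  interpret K: finite_product_sigma_finite "\<lambda>_. lborel :: real measure" "UNIV :: 'k set" by standard simp
  interpret PK: pair_sigma_finite ?P ?K ..
  let ?F = "\<lambda>x t. indicator S x * (\<Prod>i\<in>UNIV. indicator (A i (t i)) (x i) * indicator {0<..} (t i)) :: ennreal"
  have comp: "(\<lambda>p. indicator (A i (snd p i)) (fst p i) :: ennreal) \<in> borel_measurable (?P \<Otimes>\<^sub>M ?K)" for i
  proof -
    have 1: "(\<lambda>p. fst p i) \<in> measurable (?P \<Otimes>\<^sub>M ?K) lborel" by measurable
    have 2: "(\<lambda>p. snd p i) \<in> measurable (?P \<Otimes>\<^sub>M ?K) lborel" by measurable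
    have "(\<lambda>p. (fst p i, snd p i)) \<in> measurable (?P \<Otimes>\<^sub>M ?K) (lborel \<Otimes>\<^sub>M lborel)"
      by (rule measurable_Pair[OF 1 2])
    from measurable_compose[OF this A[of i]] show ?thesis by simp
  qed
  have F: "(\<lambda>(x, t). ?F x t) \<in> borel_measurable (?P \<Otimes>\<^sub>M ?K)"
  proof -
    have "(\<lambda>p. ?F (fst p) (snd p)) \<in> borel_measurable (?P \<Otimes>\<^sub>M ?K)"
      using comp by (intro borel_measurable_times_ennreal borel_measurable_prod_ennreal) measurable
    then show ?thesis by (simp add: case_prod_beta)
  qed
  have sect: "(\<lambda>t. indicator (A i t) y * indicator {0<..} t :: ennreal) \<in> borel_measurable lborel" for i y
    using measurable_compose[OF measurable_Pair1' A[of i], of y] by (intro borel_measurable_times_ennreal) auto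
  have "(\<integral>\<^sup>+x. indicator S x * (\<Prod>i\<in>UNIV. \<integral>\<^sup>+t\<in>{0<..}. indicator (A i t) (x i) \<partial>lborel) \<partial>?P) =
    (\<integral>\<^sup>+x. \<integral>\<^sup>+t. ?F x t \<partial>?K \<partial>?P)"
  proof (rule nn_integral_cong)
    fix x :: "'k \<Rightarrow> 'a" assume x: "x \<in> space ?P"
    have m: "(\<lambda>t. \<Prod>i\<in>UNIV. indicator (A i (t i)) (x i) * indicator {0<..} (t i) :: ennreal) \<in> borel_measurable ?K"
      using sect by (intro borel_measurable_prod_ennreal) (auto intro: measurable_compose[OF measurable_component_singleton])
    have "(\<Prod>i\<in>UNIV. \<integral>\<^sup>+t\<in>{0<..}. indicator (A i t) (x i) \<partial>lborel)
      = (\<integral>\<^sup>+t. (\<Prod>i\<in>UNIV. indicator (A i (t i)) (x i) * indicator {0<..} (t i)) \<partial>?K)"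
      by (rule lborel_PiM.product_nn_integral_prod[symmetric]) (use sect in auto)
    then show "indicator S x * (\<Prod>i\<in>UNIV. \<integral>\<^sup>+t\<in>{0<..}. indicator (A i t) (x i) \<partial>lborel) = (\<integral>\<^sup>+t. ?F x t \<partial>?K)"
      by (simp only: nn_integral_cmult[OF m])
  qed
  also have "\<dots> = (\<integral>\<^sup>+t. \<integral>\<^sup>+x. ?F x t \<partial>?P \<partial>?K)"
    by (rule PK.Fubini'[symmetric, OF F])
  also have "\<dots> = (\<integral>\<^sup>+t. (\<Prod>i\<in>UNIV. indicator {0<..} (t i)) * emeasure ?P (S \<inter> Pi\<^sub>E UNIV (\<lambda>i. A i (t i))) \<partial>?K)"
  proof (rule nn_integral_cong)
    fix t :: "'k \<Rightarrow> real"
    have B: "S \<inter> Pi\<^sub>E UNIV (\<lambda>i. A i (t i)) \<in> sets ?P" using Ab by (intro sets.Int S sets_PiE_UNIV)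
    have "?F x t = (\<Prod>i\<in>UNIV. indicator {0<..} (t i)) * indicator (S \<inter> Pi\<^sub>E UNIV (\<lambda>i. A i (t i))) x" for x
      unfolding prod.distrib by (auto simp: indicator_def PiE_UNIV_domain Pi_def)
    then show "(\<integral>\<^sup>+x. ?F x t \<partial>?P) = (\<Prod>i\<in>UNIV. indicator {0<..} (t i)) * emeasure ?P (S \<inter> Pi\<^sub>E UNIV (\<lambda>i. A i (t i)))"
      using B by (simp only: nn_integral_cmult_indicator)
  qed
  finally show ?thesis .
qed

text \<open>Explicit form of the radius implicit in \<open>set_rearrangement\<close>. At
  \<open>t \<le> 0\<close>, where the superlevel set may have infinite measure, the value 0 gives
  the empty open ball.\<close>

definition rearrangement_radius :: "('a::euclidean_space \<Rightarrow> real) \<Rightarrow> real \<Rightarrow> real" where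
  "rearrangement_radius f t =
    (if 0 < t then root DIM('a) (measure lborel {x. t < f x} / unit_ball_vol (real DIM('a))) else 0)"

context
  fixes f :: "'a::euclidean_space \<Rightarrow> real"
  assumes f: "prob_density f"
begin

lemma prob_density_borel [measurable]: "f \<in> borel_measurable borel"
  using f by (simp add: prob_density_def)

text \<open>Markov's inequality for total mass one.\<close>

lemma emeasure_superlevel_finite:
  assumes t: "0 < t"
  shows "emeasure lborel {x. t < f x} < \<infinity>"
proof -
  have "ennreal t * emeasure lborel {x. t < f x} = (\<integral>\<^sup>+x. ennreal t * indicator {x. t < f x} x \<partial>lborel)"
    by (subst nn_integral_cmult_indicator) auto
  also have "\<dots> \<le> (\<integral>\<^sup>+x. ennreal (f x) \<partial>lborel)"
    by (intro nn_integral_mono) (auto simp: indicator_def intro!: ennreal_leI)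
  also have "\<dots> = 1" using f by (simp add: prob_density_def)
  finally have "ennreal t * emeasure lborel {x. t < f x} < top" by (rule le_less_trans) simp
  then show ?thesis using t by (auto simp: ennreal_mult_less_top)
qed

lemma rearrangement_radius_nonneg: "0 \<le> rearrangement_radius f t"
  using unit_ball_vol_nonneg[of "real DIM('a)"] by (simp add: rearrangement_radius_def)

lemma emeasure_ball_rearrangement_radius:
  assumes t: "0 < t"
  shows "emeasure lborel (ball (0::'a) (rearrangement_radius f t)) = emeasure lborel {x. t < f x}"
proof -
  have u: "0 < unit_ball_vol (real DIM('a))" by (rule unit_ball_vol_pos) simp
  have "emeasure lborel (ball (0::'a) (rearrangement_radius f t)) =
      ennreal (unit_ball_vol (real DIM('a)) * rearrangement_radius f t ^ DIM('a))"
    by (rule emeasure_ball[OF rearrangement_radius_nonneg])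
  also have "unit_ball_vol (real DIM('a)) * rearrangement_radius f t ^ DIM('a) = measure lborel {x. t < f x}"
    using u t by (simp add: rearrangement_radius_def less_imp_neq[OF u, symmetric])
  also have "ennreal \<dots> = emeasure lborel {x. t < f x}"
    using emeasure_superlevel_finite[OF t] by (intro emeasure_eq_ennreal_measure[symmetric]) (simp add: less_top)
  finally show ?thesis .
qed

lemma set_rearrangement_superlevel:
  assumes t: "0 < t"
  shows "set_rearrangement {x. t < f x} = ball 0 (rearrangement_radius f t)"
proof -
  have u: "0 < unit_ball_vol (real DIM('a))" by (rule unit_ball_vol_pos) simp
  obtain r where r: "0 \<le> r" "set_rearrangement {x. t < f x} = ball 0 r"
    using set_rearrangement(1)[OF emeasure_superlevel_finite[OF t]] by blast
  let ?v = "\<lambda>r. unit_ball_vol (real DIM('a)) * r ^ DIM('a)"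
  have "ennreal (?v r) = emeasure lborel (set_rearrangement {x. t < f x})"
    unfolding r(2) by (rule emeasure_ball[OF r(1), symmetric])
  also have "\<dots> = emeasure lborel (ball (0::'a) (rearrangement_radius f t))"
    using set_rearrangement(2)[OF emeasure_superlevel_finite[OF t]] emeasure_ball_rearrangement_radius[OF t] by simp
  also have "\<dots> = ennreal (?v (rearrangement_radius f t))"
    by (rule emeasure_ball[OF rearrangement_radius_nonneg])
  finally have "?v r = ?v (rearrangement_radius f t)"
    by (rule ennreal_inj[THEN iffD1, rotated 2])
      (auto intro!: mult_nonneg_nonneg less_imp_le[OF u] zero_le_power r(1) rearrangement_radius_nonneg)
  then have "r ^ DIM('a) = rearrangement_radius f t ^ DIM('a)" using u by simp
  then have "r = rearrangement_radius f t"
    using r(1) rearrangement_radius_nonneg by (rule power_eq_imp_eq_base) simp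
  then show ?thesis using r by simp
qed

lemma rearrangement_radius_measurable [measurable]: "rearrangement_radius f \<in> borel_measurable borel"
proof -
  have "(\<lambda>t. enn2real (\<integral>\<^sup>+x. indicator {p. fst p < f (snd p)} (t, x) \<partial>lborel)) \<in> borel_measurable borel"
    by measurable
  moreover have "enn2real (\<integral>\<^sup>+x. indicator {p. fst p < f (snd p)} (t, x) \<partial>lborel) = measure lborel {x. t < f x}" for t
  proof -
    have "(\<integral>\<^sup>+x. indicator {p. fst p < f (snd p)} (t, x) \<partial>lborel) = (\<integral>\<^sup>+x. indicator {x. t < f x} x \<partial>lborel)"
      by (intro nn_integral_cong) (simp add: indicator_def)
    also have "\<dots> = emeasure lborel {x. t < f x}" by (subst nn_integral_indicator) auto
    finally show ?thesis by (simp add: measure_def)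
  qed
  ultimately have [measurable]: "(\<lambda>t. measure lborel {x. t < f x}) \<in> borel_measurable borel" by simp
  show ?thesis unfolding rearrangement_radius_def[abs_def] by measurable
qed

lemma sym_decr_rearrangement_eq:
  "sym_decr_rearrangement f x = (\<integral>\<^sup>+t\<in>{0<..}. indicator (ball 0 (rearrangement_radius f t)) x \<partial>lborel)"
  unfolding sym_decr_rearrangement_def
  by (intro nn_integral_cong) (auto simp: indicator_def set_rearrangement_superlevel)

lemma superlevel_integral_eq: "(\<integral>\<^sup>+t\<in>{0<..}. indicator {y. t < f y} x \<partial>lborel) = ennreal (f x)"
proof -
  have "(\<integral>\<^sup>+t\<in>{0<..}. indicator {y. t < f y} x \<partial>lborel) = (\<integral>\<^sup>+t. indicator {t. 0 < t \<and> ennreal t < ennreal (f x)} t \<partial>lborel)"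
    by (intro nn_integral_cong) (auto simp: indicator_def ennreal_less_iff)
  then show ?thesis by (simp add: nn_integral_Ioi_indicator_less)
qed

lemma superlevel_mass: "(\<integral>\<^sup>+t\<in>{0<..}. emeasure lborel {x. t < f x} \<partial>lborel) = 1"
proof -
  have "1 = (\<integral>\<^sup>+x. ennreal (f x) \<partial>lborel)" using f by (simp add: prob_density_def)
  also have "\<dots> = (\<integral>\<^sup>+t\<in>{0<..}. emeasure lborel {x\<in>space lborel. ennreal t < ennreal (f x)} \<partial>lborel)"
    by (rule lborel.layer_cake_less) measurable
  also have "\<dots> = (\<integral>\<^sup>+t\<in>{0<..}. emeasure lborel {x. t < f x} \<partial>lborel)"
    by (intro nn_integral_cong) (auto simp: indicator_def ennreal_less_iff)
  finally show ?thesis by simp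
qed

end

lemma rearrangement_inequality:
  fixes f :: "'k::finite \<Rightarrow> 'a::euclidean_space \<Rightarrow> real"
  assumes S[measurable]: "S \<in> sets (Pi\<^sub>M UNIV (\<lambda>_. lborel))" and conc: "steiner_concave S"
    and f: "\<And>i. prob_density (f i)"
  shows "(\<integral>\<^sup>+x. indicator S x * (\<Prod>i\<in>UNIV. ennreal (f i (x i))) \<partial>Pi\<^sub>M UNIV (\<lambda>_. lborel))
    \<le> (\<integral>\<^sup>+x. indicator S x * (\<Prod>i\<in>UNIV. sym_decr_rearrangement (f i) (x i)) \<partial>Pi\<^sub>M UNIV (\<lambda>_. lborel))"
proof -
  note [measurable] = prob_density_borel[OF f] rearrangement_radius_measurable[OF f]
  let ?A = "\<lambda>i t. {x. t < f i x}" and ?B = "\<lambda>i t. ball (0::'a) (rearrangement_radius (f i) t)"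
  have A: "(\<lambda>(x, t). indicator (?A i t) x :: ennreal) \<in> borel_measurable (lborel \<Otimes>\<^sub>M lborel)" for i
  proof -
    have "(\<lambda>(x, t). indicator {p. snd p < f i (fst p)} (x, t) :: ennreal) \<in> borel_measurable (lborel \<Otimes>\<^sub>M lborel)"
      by measurable
    then show ?thesis by (simp add: indicator_def)
  qed
  have B: "(\<lambda>(x, t). indicator (?B i t) x :: ennreal) \<in> borel_measurable (lborel \<Otimes>\<^sub>M lborel)" for i
  proof -
    have "(\<lambda>(x, t). indicator {p. norm (fst p) < rearrangement_radius (f i) (snd p)} (x, t) :: ennreal)
        \<in> borel_measurable (lborel \<Otimes>\<^sub>M lborel)"
      by measurable
    then show ?thesis by (simp add: indicator_def)
  qed
  show ?thesis
    unfolding sym_decr_rearrangement_eq[OF f] superlevel_integral_eq[OF f, symmetric]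
  proof (subst (1 2) layer_cake_PiM[OF S])
    show "(\<integral>\<^sup>+t. (\<Prod>i\<in>UNIV. indicator {0<..} (t i)) * emeasure (Pi\<^sub>M UNIV (\<lambda>_. lborel)) (S \<inter> Pi\<^sub>E UNIV (\<lambda>i. ?A i (t i))) \<partial>Pi\<^sub>M UNIV (\<lambda>_. lborel))
      \<le> (\<integral>\<^sup>+t. (\<Prod>i\<in>UNIV. indicator {0<..} (t i)) * emeasure (Pi\<^sub>M UNIV (\<lambda>_. lborel)) (S \<inter> Pi\<^sub>E UNIV (\<lambda>i. ?B i (t i))) \<partial>Pi\<^sub>M UNIV (\<lambda>_. lborel))"
    proof (rule nn_integral_mono)
      fix t :: "'k \<Rightarrow> real"
      show "(\<Prod>i\<in>UNIV. indicator {0<..} (t i)) * emeasure (Pi\<^sub>M UNIV (\<lambda>_. lborel)) (S \<inter> Pi\<^sub>E UNIV (\<lambda>i. ?A i (t i)))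
        \<le> (\<Prod>i\<in>UNIV. indicator {0<..} (t i)) * emeasure (Pi\<^sub>M UNIV (\<lambda>_. lborel)) (S \<inter> Pi\<^sub>E UNIV (\<lambda>i. ?B i (t i)))"
      proof (cases "\<forall>i. 0 < t i")
        case True
        then show ?thesis
          using emeasure_ball_rearrangement_radius[OF f]
          by (intro mult_left_mono emeasure_Int_PiE_ball[OF S conc]) auto
      next
        case False
        then obtain i where "(indicator {0<..} (t i) :: ennreal) = 0" by (auto simp: indicator_def)
        then have "(\<Prod>i\<in>UNIV. indicator {0<..} (t i) :: ennreal) = 0" by (intro prod_zero) auto
        then show ?thesis by (simp only: mult_zero_left order_refl)
      qed
    qed
  qed (use A B in auto)
qed

section \<open>Star-shaped sets\<close>

lemma emeasure_lborel_scale: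
  fixes A :: "'a::euclidean_space set"
  assumes c: "0 < c" and [measurable]: "A \<in> sets borel"
  shows "emeasure lborel A = ennreal (c ^ DIM('a)) * emeasure lborel {x. c *\<^sub>R x \<in> A}"
proof -
  have "emeasure lborel A = emeasure (density (distr lborel borel (\<lambda>x. 0 + c *\<^sub>R x)) (\<lambda>_. ennreal (\<bar>c\<bar> ^ DIM('a)))) A"
    using lborel_affine[of c "0::'a"] c by simp
  also have "\<dots> = (\<integral>\<^sup>+x. ennreal (c ^ DIM('a)) * indicator A (c *\<^sub>R x) \<partial>lborel)"
    using c by (subst emeasure_density) (auto simp: nn_integral_distr)
  also have "\<dots> = ennreal (c ^ DIM('a)) * (\<integral>\<^sup>+x. indicator A (c *\<^sub>R x) \<partial>lborel)"
    by (rule nn_integral_cmult) measurable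
  also have "(\<integral>\<^sup>+x. indicator A (c *\<^sub>R x) \<partial>lborel) = (\<integral>\<^sup>+x. indicator {x. c *\<^sub>R x \<in> A} x \<partial>lborel)"
    by (intro nn_integral_cong) (simp add: indicator_def)
  finally show ?thesis by simp
qed

lemma rearrangement_radius_eq_0:
  fixes f :: "'a::euclidean_space \<Rightarrow> real"
  assumes f: "prob_density f" and le: "esssup lborel (\<lambda>x. ennreal \<bar>f x\<bar>) \<le> 1" and t: "1 \<le> t"
  shows "rearrangement_radius f t = 0"
proof -
  note [measurable] = prob_density_borel[OF f]
  have "AE x in lborel. ennreal \<bar>f x\<bar> \<le> esssup lborel (\<lambda>x. ennreal \<bar>f x\<bar>)" by (rule esssup_AE)
  then have "AE x in lborel. \<not> (t < f x)"
  proof (rule eventually_mono)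
    fix x assume "ennreal \<bar>f x\<bar> \<le> esssup lborel (\<lambda>x. ennreal \<bar>f x\<bar>)"
    from order_trans[OF this le] have "ennreal \<bar>f x\<bar> \<le> ennreal 1" by (simp only: ennreal_1)
    then have "\<bar>f x\<bar> \<le> 1" by (subst (asm) ennreal_le_iff) auto
    then show "\<not> (t < f x)" using t by linarith
  qed
  then have "emeasure lborel {x. t < f x} = 0"
    by (subst (asm) AE_iff_measurable[of "{x. t < f x}"]) auto
  then show ?thesis by (simp add: rearrangement_radius_def measure_def)
qed

text \<open>Replacing \<open>E\<close> by the cone over its intersection with the sphere bounding the unit volume ball only
  increases the difference of the two sides, and on cones both sides agree.\<close>

lemma nn_integral_star_shaped_le:
  fixes f :: "'a::euclidean_space \<Rightarrow> real"
  assumes f: "prob_density f" and le: "esssup lborel (\<lambda>x. ennreal \<bar>f x\<bar>) \<le> 1"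
    and E[measurable]: "E \<in> sets borel" and star: "\<And>x r. x \<in> E \<Longrightarrow> 0 < r \<Longrightarrow> r \<le> 1 \<Longrightarrow> r *\<^sub>R x \<in> E"
  shows "(\<integral>\<^sup>+x. sym_decr_rearrangement f x * indicator E x \<partial>lborel)
    \<le> (\<integral>\<^sup>+x. indicator unit_volume_ball x * indicator E x \<partial>lborel)"
proof -
  note [measurable] = prob_density_borel[OF f] rearrangement_radius_measurable[OF f]
  let ?g = "sym_decr_rearrangement f" and ?\<rho> = "rearrangement_radius f"
  obtain R where R: "0 \<le> R" "(unit_volume_ball :: 'a set) = cball 0 R"
    using unit_volume_ball(1)[where 'a='a] by blast
  have u1: "ennreal (unit_ball_vol (real DIM('a)) * R ^ DIM('a)) = 1"
    using unit_volume_ball(2)[where 'a='a] emeasure_cball[OF R(1), of "0::'a"] unfolding R(2) by simp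
  then have b1: "emeasure lborel (ball (0::'a) R) = 1" by (simp only: emeasure_ball[OF R(1)])
  have R0: "0 < R"
  proof -
    have "R \<noteq> 0"
    proof
      assume "R = 0"
      then have "ball (0::'a) R = {}" by simp
      then have "emeasure lborel (ball (0::'a) R) = 0" by (simp only: emeasure_empty)
      then show False using b1 by simp
    qed
    then show ?thesis using R(1) by simp
  qed
  let ?B = "cball (0::'a) R"
  have [measurable]: "?B \<in> sets borel" by simp
  have g_borel[measurable]: "?g \<in> borel_measurable borel"
  proof -
    have "(\<lambda>x. \<integral>\<^sup>+t\<in>{0<..}. indicator {p. norm (fst p) < ?\<rho> (snd p)} (x, t) \<partial>lborel) \<in> borel_measurable borel"
      by measurable
    then show ?thesis unfolding sym_decr_rearrangement_eq[OF f, abs_def] by (simp add: indicator_def cong: if_cong)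
  qed
  have g1: "?g x \<le> 1" for x
  proof -
    have "?g x \<le> (\<integral>\<^sup>+t. indicator {0<..<1::real} t \<partial>lborel)"
      unfolding sym_decr_rearrangement_eq[OF f]
    proof (rule nn_integral_mono)
      fix t :: real
      show "indicator (ball 0 (?\<rho> t)) x * indicator {0<..} t \<le> (indicator {0<..<1} t :: ennreal)"
        using rearrangement_radius_eq_0[OF f le, of t] by (cases "1 \<le> t") (auto simp: indicator_def)
    qed
    then show ?thesis by simp
  qed
  \<comment> \<open>Membership depends only on the direction of \<open>x\<close>. Star-shapedness
    puts \<open>Q\<close> inside \<open>E\<close> within the ball and \<open>E\<close> inside
    \<open>Q\<close> beyond it.\<close>
  define Q where "Q = {x. x \<noteq> 0 \<and> (R / norm x) *\<^sub>R x \<in> E}"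
  have Q[measurable]: "Q \<in> sets borel" unfolding Q_def by measurable
  have QE: "x \<in> E" if "x \<in> Q" "norm x \<le> R" for x
  proof -
    have x: "x \<noteq> 0" "(R / norm x) *\<^sub>R x \<in> E" using that by (auto simp: Q_def)
    have "(norm x / R) *\<^sub>R ((R / norm x) *\<^sub>R x) \<in> E" by (rule star[OF x(2)]) (use x R0 that(2) in auto)
    then show ?thesis using x R0 by simp
  qed
  have EQ: "x \<in> Q" if "x \<in> E" "R < norm x" for x
  proof -
    have n: "0 < norm x" using that(2) R0 by linarith
    have "(R / norm x) *\<^sub>R x \<in> E" by (rule star[OF that(1)]) (use n R0 that(2) in auto)
    then show ?thesis using n by (simp add: Q_def)
  qed
  define \<kappa> where "\<kappa> = emeasure lborel (Q \<inter> ball 0 R)"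
  \<comment> \<open>The fraction is taken over the open ball while the unit volume ball is closed;
    only this inequality between the two is used.\<close>
  have \<kappa>_le: "\<kappa> \<le> emeasure lborel (Q \<inter> ?B)" unfolding \<kappa>_def by (intro emeasure_mono) auto
  have fin: "emeasure lborel (Q \<inter> ?B) \<noteq> top"
    using emeasure_bounded_finite[of "Q \<inter> ?B"] by (auto simp: bounded_Int less_top[symmetric])
  \<comment> \<open>A cone occupies the same fraction of every centred ball; it is
    \<open>\<kappa>\<close> because the ball of radius \<open>R\<close> has volume one. Therefore
    every mixture of centred balls of total mass one gives \<open>Q\<close> the mass
    \<open>\<kappa>\<close>.\<close>
  have scale: "emeasure lborel (Q \<inter> ball 0 \<rho>) = \<kappa> * emeasure lborel (ball (0::'a) \<rho>)" if \<rho>: "0 \<le> \<rho>" for \<rho>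
  proof (cases "\<rho> = 0")
    case False
    then have \<rho>: "0 < \<rho>" using that by simp
    let ?c = "\<rho> / R"
    have c: "0 < ?c" using \<rho> R0 by simp
    have Qc: "?c *\<^sub>R x \<in> Q \<longleftrightarrow> x \<in> Q" for x
    proof -
      have "(R / norm (?c *\<^sub>R x)) *\<^sub>R (?c *\<^sub>R x) = (R / norm x) *\<^sub>R x" using \<rho> R0 by simp
      moreover have "?c *\<^sub>R x \<noteq> 0 \<longleftrightarrow> x \<noteq> 0" using \<rho> R0 by simp
      ultimately show ?thesis unfolding Q_def by (simp only: mem_Collect_eq)
    qed
    have bc: "?c *\<^sub>R x \<in> ball 0 \<rho> \<longleftrightarrow> x \<in> ball 0 R" for x :: 'a
      using \<rho> R0 by (simp add: field_simps)
    have 1: "{x. ?c *\<^sub>R x \<in> Q \<inter> ball 0 \<rho>} = Q \<inter> ball 0 R" using Qc bc by blast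
    have 2: "{x::'a. ?c *\<^sub>R x \<in> ball 0 \<rho>} = ball 0 R" using bc by blast
    have "emeasure lborel (Q \<inter> ball 0 \<rho>) = ennreal (?c ^ DIM('a)) * \<kappa>"
      unfolding \<kappa>_def 1[symmetric] by (rule emeasure_lborel_scale[OF c]) auto
    moreover have "emeasure lborel (ball (0::'a) \<rho>) = ennreal (?c ^ DIM('a)) * 1"
      unfolding b1[symmetric] 2[symmetric] by (rule emeasure_lborel_scale[OF c]) auto
    ultimately show ?thesis by (simp add: mult.commute)
  qed simp
  have "(\<integral>\<^sup>+x. ?g x * indicator Q x \<partial>lborel) =
    (\<integral>\<^sup>+x. \<integral>\<^sup>+t. indicator {0<..} t * indicator {p. fst p \<in> Q \<and> norm (fst p) < ?\<rho> (snd p)} (x, t) \<partial>lborel \<partial>lborel)"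
    unfolding sym_decr_rearrangement_eq[OF f]
    by (intro nn_integral_cong, subst nn_integral_multc[symmetric]) (auto intro!: nn_integral_cong simp: indicator_def)
  also have "\<dots> = (\<integral>\<^sup>+t. \<integral>\<^sup>+x. indicator {0<..} t * indicator {p. fst p \<in> Q \<and> norm (fst p) < ?\<rho> (snd p)} (x, t) \<partial>lborel \<partial>lborel)"
    by (rule lborel_pair.Fubini'[symmetric]) measurable
  also have "\<dots> = (\<integral>\<^sup>+t. \<kappa> * (emeasure lborel {x. t < f x} * indicator {0<..} t) \<partial>lborel)"
  proof (rule nn_integral_cong)
    fix t :: real
    have "(\<integral>\<^sup>+x. indicator {0<..} t * indicator {p. fst p \<in> Q \<and> norm (fst p) < ?\<rho> (snd p)} (x, t) \<partial>lborel) =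
      (\<integral>\<^sup>+x. indicator {0<..} t * indicator (Q \<inter> ball 0 (?\<rho> t)) x \<partial>lborel)"
      by (intro nn_integral_cong) (simp add: indicator_def)
    also have "\<dots> = indicator {0<..} t * emeasure lborel (Q \<inter> ball 0 (?\<rho> t))"
      by (rule nn_integral_cmult_indicator) simp
    also have "\<dots> = \<kappa> * (emeasure lborel {x. t < f x} * indicator {0<..} t)"
      unfolding scale[OF rearrangement_radius_nonneg[OF f]]
      by (cases "0 < t") (simp_all add: emeasure_ball_rearrangement_radius[OF f])
    finally show "(\<integral>\<^sup>+x. indicator {0<..} t * indicator {p. fst p \<in> Q \<and> norm (fst p) < ?\<rho> (snd p)} (x, t) \<partial>lborel) =
      \<kappa> * (emeasure lborel {x. t < f x} * indicator {0<..} t)" .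
  qed
  also have "\<dots> = \<kappa> * (\<integral>\<^sup>+t\<in>{0<..}. emeasure lborel {x. t < f x} \<partial>lborel)"
  proof (rule nn_integral_cmult)
    have "(\<lambda>t. \<integral>\<^sup>+x. indicator {p. fst p < f (snd p)} (t, x) \<partial>lborel) \<in> borel_measurable borel" by measurable
    moreover have "(\<integral>\<^sup>+x. indicator {p. fst p < f (snd p)} (t, x) \<partial>lborel) = emeasure lborel {x. t < f x}" for t
    proof -
      have "(\<integral>\<^sup>+x. indicator {p. fst p < f (snd p)} (t, x) \<partial>lborel) = (\<integral>\<^sup>+x. indicator {x. t < f x} x \<partial>lborel)"
        by (intro nn_integral_cong) (simp add: indicator_def)
      then show ?thesis by simp
    qed
    ultimately have [measurable]: "(\<lambda>t. emeasure lborel {x. t < f x}) \<in> borel_measurable borel" by simp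
    show "(\<lambda>t. emeasure lborel {x. t < f x} * indicator {0<..} t) \<in> borel_measurable lborel" by measurable
  qed
  also have "\<dots> = \<kappa>" by (simp add: superlevel_mass[OF f])
  finally have cone: "(\<integral>\<^sup>+x. ?g x * indicator Q x \<partial>lborel) = \<kappa>" .
  have "(\<integral>\<^sup>+x. ?g x * indicator E x \<partial>lborel) + emeasure lborel (Q \<inter> ?B) =
      (\<integral>\<^sup>+x. ?g x * indicator E x + indicator (Q \<inter> ?B) x \<partial>lborel)"
    by (subst nn_integral_add) auto
  \<comment> \<open>Pointwise comparison: within the ball a point of \<open>E\<close> outside
    \<open>Q\<close> costs \<open>?g x\<close>, at most one, against a gain of one; beyond the ball
    \<open>E\<close> lies in \<open>Q\<close>.\<close>
  also have "\<dots> \<le> (\<integral>\<^sup>+x. ?g x * indicator Q x + indicator ?B x * indicator E x \<partial>lborel)"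
  proof (rule nn_integral_mono)
    fix x
    show "?g x * indicator E x + indicator (Q \<inter> ?B) x \<le> ?g x * indicator Q x + indicator ?B x * indicator E x"
      using QE[of x] EQ[of x] g1[of x]
      by (cases "x \<in> E"; cases "x \<in> Q"; cases "norm x \<le> R") auto
  qed
  also have "\<dots> = \<kappa> + (\<integral>\<^sup>+x. indicator ?B x * indicator E x \<partial>lborel)"
    by (subst nn_integral_add) (auto simp: cone)
  also have "\<dots> \<le> (\<integral>\<^sup>+x. indicator ?B x * indicator E x \<partial>lborel) + emeasure lborel (Q \<inter> ?B)"
    using \<kappa>_le by (simp add: add.commute add_left_mono)
  finally show ?thesis
    unfolding R(2) using fin by (simp add: add.commute[of _ "emeasure lborel (Q \<inter> ?B)"] ennreal_add_left_cancel_le)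
qed

text \<open>Factors are exchanged one at a time, \<open>q J\<close> being the mixed family with
  \<open>h\<close> on \<open>J\<close> and \<open>g\<close> elsewhere. With the other coordinates
  frozen, the section of \<open>S\<close> is star-shaped, so the one-factor comparison applies under
  the integral.\<close>

lemma nn_integral_PiM_replace:
  fixes g h :: "'k::finite \<Rightarrow> 'a::euclidean_space \<Rightarrow> ennreal"
  assumes S[measurable]: "S \<in> sets (Pi\<^sub>M UNIV (\<lambda>_. lborel))"
    and star: "\<And>x i r. x \<in> S \<Longrightarrow> 0 < r \<Longrightarrow> r \<le> 1 \<Longrightarrow> x(i := r *\<^sub>R x i) \<in> S"
    and g[measurable]: "\<And>i. g i \<in> borel_measurable borel" and h[measurable]: "\<And>i. h i \<in> borel_measurable borel"
    and le: "\<And>i E. E \<in> sets borel \<Longrightarrow> (\<And>x r. x \<in> E \<Longrightarrow> 0 < r \<Longrightarrow> r \<le> 1 \<Longrightarrow> r *\<^sub>R x \<in> E) \<Longrightarrow>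
      (\<integral>\<^sup>+x. g i x * indicator E x \<partial>lborel) \<le> (\<integral>\<^sup>+x. h i x * indicator E x \<partial>lborel)"
  shows "(\<integral>\<^sup>+x. indicator S x * (\<Prod>i\<in>UNIV. g i (x i)) \<partial>Pi\<^sub>M UNIV (\<lambda>_. lborel))
    \<le> (\<integral>\<^sup>+x. indicator S x * (\<Prod>i\<in>UNIV. h i (x i)) \<partial>Pi\<^sub>M UNIV (\<lambda>_. lborel))"
proof -
  let ?P = "\<lambda>I. Pi\<^sub>M I (\<lambda>_. lborel :: 'a measure)"
  define q where "q J i = (if i \<in> J then h i else g i)" for J i
  have q[measurable]: "q J i \<in> borel_measurable borel" for J i by (simp add: q_def)
  have F: "(\<lambda>x. indicator S x * (\<Prod>j\<in>UNIV. q J j (x j))) \<in> borel_measurable (?P UNIV)" for J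
    by (intro borel_measurable_times_ennreal borel_measurable_prod_ennreal) measurable
  have "(\<integral>\<^sup>+x. indicator S x * (\<Prod>j\<in>UNIV. q {} j (x j)) \<partial>?P UNIV)
    \<le> (\<integral>\<^sup>+x. indicator S x * (\<Prod>j\<in>UNIV. q J j (x j)) \<partial>?P UNIV)" if "finite J" for J
    using that
  proof (induction J rule: finite_induct)
    case (insert i J)
    have UN: "insert i (UNIV - {i}) = (UNIV :: 'k set)" by auto
    have split: "(\<integral>\<^sup>+x. indicator S x * (\<Prod>j\<in>UNIV. q L j (x j)) \<partial>?P UNIV) =
      (\<integral>\<^sup>+x. (\<Prod>j\<in>UNIV - {i}. q L j (x j)) * (\<integral>\<^sup>+y. q L i y * indicator {y. x(i := y) \<in> S} y \<partial>lborel) \<partial>?P (UNIV - {i}))"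
      (is "_ = ?rhs L") and mS: "\<And>x. x \<in> space (?P (UNIV - {i})) \<Longrightarrow> {y. x(i := y) \<in> S} \<in> sets borel" for L
    proof -
      have upd: "(\<lambda>y. x(i := y)) \<in> measurable lborel (?P UNIV)" if "x \<in> space (?P (UNIV - {i}))" for x
        by (rule measurable_PiM_single') (auto simp: fun_upd_def)
      show mS: "{y. x(i := y) \<in> S} \<in> sets borel" if "x \<in> space (?P (UNIV - {i}))" for x
        using measurable_sets[OF upd[OF that] S] by (simp add: vimage_def)
      have "(\<integral>\<^sup>+x. indicator S x * (\<Prod>j\<in>UNIV. q L j (x j)) \<partial>?P UNIV) =
        (\<integral>\<^sup>+x. \<integral>\<^sup>+y. indicator S (x(i := y)) * (\<Prod>j\<in>UNIV. q L j ((x(i := y)) j)) \<partial>lborel \<partial>?P (UNIV - {i}))"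
        by (subst (1) UN[symmetric], rule lborel_PiM.product_nn_integral_insert) (use F[of L] in \<open>auto simp: UN\<close>)
      also have "\<dots> = ?rhs L"
      proof (rule nn_integral_cong)
        fix x assume x: "x \<in> space (?P (UNIV - {i}))"
        have "indicator S (x(i := y)) * (\<Prod>j\<in>UNIV. q L j ((x(i := y)) j)) =
          (\<Prod>j\<in>UNIV - {i}. q L j (x j)) * (q L i y * indicator {y. x(i := y) \<in> S} y)" for y
        proof -
          have "(\<Prod>j\<in>UNIV. q L j ((x(i := y)) j)) = q L i y * (\<Prod>j\<in>UNIV - {i}. q L j (x j))"
            by (subst prod.remove[of _ i]) auto
          then show ?thesis by (simp add: indicator_def mult_ac)
        qed
        moreover have "(\<lambda>y. q L i y * indicator {y. x(i := y) \<in> S} y) \<in> borel_measurable lborel"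
          using mS[OF x] by (intro borel_measurable_times_ennreal) auto
        ultimately show "(\<integral>\<^sup>+y. indicator S (x(i := y)) * (\<Prod>j\<in>UNIV. q L j ((x(i := y)) j)) \<partial>lborel) =
          (\<Prod>j\<in>UNIV - {i}. q L j (x j)) * (\<integral>\<^sup>+y. q L i y * indicator {y. x(i := y) \<in> S} y \<partial>lborel)"
          by (simp only: nn_integral_cmult)
      qed
      finally show "(\<integral>\<^sup>+x. indicator S x * (\<Prod>j\<in>UNIV. q L j (x j)) \<partial>?P UNIV) = ?rhs L" .
    qed
    have "(\<integral>\<^sup>+x. indicator S x * (\<Prod>j\<in>UNIV. q J j (x j)) \<partial>?P UNIV)
      \<le> (\<integral>\<^sup>+x. indicator S x * (\<Prod>j\<in>UNIV. q (insert i J) j (x j)) \<partial>?P UNIV)"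
      unfolding split
    proof (rule nn_integral_mono)
      fix x assume x: "x \<in> space (?P (UNIV - {i}))"
      have "(\<Prod>j\<in>UNIV - {i}. q J j (x j)) = (\<Prod>j\<in>UNIV - {i}. q (insert i J) j (x j))"
        by (intro prod.cong) (auto simp: q_def)
      moreover have "(\<integral>\<^sup>+y. g i y * indicator {y. x(i := y) \<in> S} y \<partial>lborel) \<le> (\<integral>\<^sup>+y. h i y * indicator {y. x(i := y) \<in> S} y \<partial>lborel)"
      proof (rule le[OF mS[OF x]])
        fix y :: 'a and r :: real assume "y \<in> {y. x(i := y) \<in> S}" "0 < r" "r \<le> 1"
        then show "r *\<^sub>R y \<in> {y. x(i := y) \<in> S}" using star[of "x(i := y)" r i] by simp
      qed
      moreover have "q J i = g i" "q (insert i J) i = h i" using insert.hyps by (auto simp: q_def)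
      ultimately show "(\<Prod>j\<in>UNIV - {i}. q J j (x j)) * (\<integral>\<^sup>+y. q J i y * indicator {y. x(i := y) \<in> S} y \<partial>lborel)
        \<le> (\<Prod>j\<in>UNIV - {i}. q (insert i J) j (x j)) * (\<integral>\<^sup>+y. q (insert i J) i y * indicator {y. x(i := y) \<in> S} y \<partial>lborel)"
        by (simp add: mult_left_mono)
    qed
    with insert.IH show ?case by (rule order_trans)
  qed simp
  from this[of UNIV] show ?thesis by (simp add: q_def)
qed

section \<open>Random sets\<close>

text \<open>Extracts from the joint independence of all three groups of vectors the independence
  within each group, the groups being the images of injections into the sum type.\<close>

lemma (in prob_space) indep_vars_inj_reindex:
  assumes indep: "indep_vars M' X UNIV" and h: "inj h"
  shows "indep_vars (\<lambda>i. M' (h i)) (\<lambda>i. X (h i)) UNIV"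
proof -
  let ?F = "\<lambda>i. {X i -` A \<inter> space M |A. A \<in> sets (M' i)}"
  have rv: "\<And>i. random_variable (M' i) (X i)" and ind: "indep_sets ?F UNIV"
    using indep by (auto simp: indep_vars_def2)
  have "indep_sets (\<lambda>i. ?F (h i)) UNIV"
    unfolding indep_sets_def
  proof (intro conjI ballI allI impI)
    show "?F (h i) \<subseteq> events" for i using ind by (auto simp: indep_sets_def)
    fix J A assume J: "J \<subseteq> UNIV" "J \<noteq> {}" "finite J" and A: "A \<in> (\<Pi> i\<in>J. ?F (h i))"
    let ?A = "\<lambda>k. A (inv h k)"
    have "prob (\<Inter>k\<in>h ` J. ?A k) = (\<Prod>k\<in>h ` J. prob (?A k))"
    proof (rule indep_setsD[OF ind])
      show "\<forall>k\<in>h ` J. ?A k \<in> ?F k"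
      proof
        fix k assume "k \<in> h ` J"
        then obtain i where i: "i \<in> J" "k = h i" by blast
        then have "?A k = A i" using h by (simp add: inv_f_f)
        moreover have "A i \<in> ?F (h i)" by (rule Pi_mem[OF A i(1)])
        ultimately show "?A k \<in> ?F k" using i(2) by simp
      qed
    qed (use J in auto)
    then show "prob (\<Inter>j\<in>J. A j) = (\<Prod>j\<in>J. prob (A j))"
      using h by (simp add: prod.reindex[OF inj_on_subset[OF h subset_UNIV]] inv_f_f)
  qed
  then show ?thesis using rv by (auto simp: indep_vars_def2)
qed

lemma PiM_density:
  fixes F :: "'k::finite \<Rightarrow> 'a::euclidean_space \<Rightarrow> ennreal"
  assumes F[measurable]: "\<And>i. F i \<in> borel_measurable borel"
    and sf: "\<And>i. sigma_finite_measure (density lborel (F i))"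
  shows "Pi\<^sub>M UNIV (\<lambda>i. density lborel (F i)) = density (Pi\<^sub>M UNIV (\<lambda>_. lborel)) (\<lambda>x. \<Prod>i\<in>UNIV. F i (x i))"
proof -
  let ?P = "Pi\<^sub>M (UNIV::'k set) (\<lambda>_. lborel :: 'a measure)"
  interpret D: product_sigma_finite "\<lambda>i. density lborel (F i)" by (intro product_sigma_finite.intro sf)
  have Fm: "(\<lambda>x. \<Prod>i\<in>UNIV. F i (x i)) \<in> borel_measurable ?P"
    by (intro borel_measurable_prod_ennreal) measurable
  have "density ?P (\<lambda>x. \<Prod>i\<in>UNIV. F i (x i)) = Pi\<^sub>M UNIV (\<lambda>i. density lborel (F i))"
  proof (rule D.PiM_eqI)
    show "sets (density ?P (\<lambda>x. \<Prod>i\<in>UNIV. F i (x i))) = sets (Pi\<^sub>M UNIV (\<lambda>i. density lborel (F i)))"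
      unfolding sets_density by (rule sets_PiM_cong) auto
    fix A :: "'k \<Rightarrow> 'a set" assume "\<And>i. i \<in> UNIV \<Longrightarrow> A i \<in> sets (density lborel (F i))"
    then have A[measurable]: "A i \<in> sets borel" for i by simp
    have "emeasure (density ?P (\<lambda>x. \<Prod>i\<in>UNIV. F i (x i))) (Pi\<^sub>E UNIV A)
      = (\<integral>\<^sup>+x. (\<Prod>i\<in>UNIV. F i (x i)) * indicator (Pi\<^sub>E UNIV A) x \<partial>?P)"
      by (rule emeasure_density[OF Fm sets_PiE_UNIV[OF A]])
    also have "\<dots> = (\<integral>\<^sup>+x. (\<Prod>i\<in>UNIV. F i (x i) * indicator (A i) (x i)) \<partial>?P)"
      unfolding prod.distrib
      by (intro nn_integral_cong arg_cong2[where f="(*)"] refl) (auto simp: indicator_def PiE_UNIV_domain Pi_def)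
    also have "\<dots> = (\<Prod>i\<in>UNIV. \<integral>\<^sup>+y. F i y * indicator (A i) y \<partial>lborel)"
      by (rule lborel_PiM.product_nn_integral_prod) auto
    also have "\<dots> = (\<Prod>i\<in>UNIV. emeasure (density lborel (F i)) (A i))"
      by (intro prod.cong refl emeasure_density[symmetric]) auto
    finally show "emeasure (density ?P (\<lambda>x. \<Prod>i\<in>UNIV. F i (x i))) (Pi\<^sub>E UNIV A) = (\<Prod>i\<in>UNIV. emeasure (density lborel (F i)) (A i))" .
  qed simp
  then show ?thesis by simp
qed

lemma (in prob_space) emeasure_joint_density:
  fixes F :: "'k::finite \<Rightarrow> 'b::euclidean_space \<Rightarrow> ennreal" and X :: "'k \<Rightarrow> 'a \<Rightarrow> 'b"
  assumes F: "\<And>i. F i \<in> borel_measurable borel" and X: "\<And>i. distr M borel (X i) = density lborel (F i)"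
    and indep: "indep_vars (\<lambda>_. borel) X UNIV" and S: "S \<in> sets (Pi\<^sub>M UNIV (\<lambda>_. lborel))"
  shows "emeasure M {\<omega>\<in>space M. (\<lambda>i. X i \<omega>) \<in> S} =
    (\<integral>\<^sup>+x. indicator S x * (\<Prod>i\<in>UNIV. F i (x i)) \<partial>Pi\<^sub>M UNIV (\<lambda>_. lborel))"
proof -
  have rv: "random_variable borel (X i)" for i using indep by (auto simp: indep_vars_def2)
  have m: "(\<lambda>\<omega> i. X i \<omega>) \<in> measurable M (Pi\<^sub>M UNIV (\<lambda>_. borel))"
    using rv by (intro measurable_PiM_single') auto
  have S': "S \<in> sets (Pi\<^sub>M UNIV (\<lambda>_. borel))" using S by (simp only: sets_PiM_lborel)
  \<comment> \<open>Each density measure is the law of a random vector, hence a probability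
    measure.\<close>
  have sf: "sigma_finite_measure (density lborel (F i))" for i
  proof -
    interpret D: prob_space "distr M borel (X i)" by (rule prob_space_distr[OF rv])
    show ?thesis unfolding X[symmetric] by unfold_locales
  qed
  have "distr M (Pi\<^sub>M UNIV (\<lambda>_. borel)) (\<lambda>\<omega>. \<lambda>i\<in>UNIV. X i \<omega>) = Pi\<^sub>M UNIV (\<lambda>i. distr M borel (X i))"
    using indep rv by (subst indep_vars_iff_distr_eq_PiM[symmetric]) auto
  then have "distr M (Pi\<^sub>M UNIV (\<lambda>_. borel)) (\<lambda>\<omega> i. X i \<omega>) = density (Pi\<^sub>M UNIV (\<lambda>_. lborel)) (\<lambda>x. \<Prod>i\<in>UNIV. F i (x i))"
    unfolding X PiM_density[OF F sf] by (simp add: restrict_UNIV)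
  then have "emeasure M {\<omega>\<in>space M. (\<lambda>i. X i \<omega>) \<in> S} = emeasure (density (Pi\<^sub>M UNIV (\<lambda>_. lborel)) (\<lambda>x. \<Prod>i\<in>UNIV. F i (x i))) S"
    using emeasure_distr[OF m S'] by (simp add: vimage_def Int_def conj_commute)
  also have "\<dots> = (\<integral>\<^sup>+x. (\<Prod>i\<in>UNIV. F i (x i)) * indicator S x \<partial>Pi\<^sub>M UNIV (\<lambda>_. lborel))"
  proof (intro emeasure_density S borel_measurable_prod_ennreal)
    note [measurable] = F
    show "(\<lambda>x. F i (x i)) \<in> borel_measurable (Pi\<^sub>M UNIV (\<lambda>_. lborel))" for i by measurable
  qed
  finally show ?thesis by (simp add: mult.commute)
qed

text \<open>With \<open>j = n + 1\<close> the maps \<open>z powr (- j)\<close> and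
  \<open>z powr (- 1 / j)\<close> are mutually inverse and decreasing on positive reals. So
  \<open>1 / p ^ j < \<psi> v\<close> bounds the transformed value at \<open>v\<close> by
  \<open>p\<close>, convexity averages such bounds, and inverting gives the level of the
  mean.\<close>

lemma neg_concave_imp_power_mean_le:
  fixes \<psi> :: "'a::euclidean_space \<Rightarrow> real"
  assumes conc: "neg_concave (- 1 / (real DIM('a) + 1)) \<psi>" and \<mu>: "0 < \<mu>" "\<mu> < 1"
  shows "power_mean_le (Suc DIM('a)) \<mu> (ennreal (\<psi> v)) (ennreal (\<psi> w)) (ennreal (\<psi> ((1 - \<mu>) *\<^sub>R v + \<mu> *\<^sub>R w)))"
  unfolding power_mean_le_def
proof (intro allI impI)
  let ?j = "Suc DIM('a)" and ?g = "- 1 / (real DIM('a) + 1)"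
  fix p q :: real
  assume pq: "0 < p" "0 < q" and p: "ennreal (1 / p ^ ?j) < ennreal (\<psi> v)" and q: "ennreal (1 / q ^ ?j) < ennreal (\<psi> w)"
  have gj: "- real ?j * ?g = 1"
  proof -
    have eq: "real ?j = real DIM('a) + 1" by simp
    have "- x * (- 1 / x) = 1" if "x \<noteq> 0" for x :: real using that by simp
    from this[of "real DIM('a) + 1"] show ?thesis unfolding eq by linarith
  qed
  have conv: "convex_on {x. 0 < \<psi> x} (\<lambda>x. \<psi> x powr ?g)" using conc by (simp add: neg_concave_def)
  have pw: "(1 / z ^ ?j) powr ?g = z" if "0 < z" for z
  proof -
    have "1 / z ^ ?j = z powr (- real ?j)" using that by (simp only: powr_minus_divide powr_realpow)
    then have "(1 / z ^ ?j) powr ?g = z powr (- real ?j * ?g)" by (simp only: powr_powr)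
    also have "- real ?j * ?g = 1" by (rule gj)
    finally show ?thesis using that by simp
  qed
  have bound: "0 < \<psi> u \<and> \<psi> u powr ?g \<le> z" if u: "ennreal (1 / z ^ ?j) < ennreal (\<psi> u)" and z: "0 < z" for u z
  proof -
    have pos: "0 < 1 / z ^ ?j" using z by simp
    then have less: "1 / z ^ ?j < \<psi> u" using u by (subst (asm) ennreal_less_iff) (simp_all only: less_imp_le)
    then have "\<psi> u powr ?g \<le> (1 / z ^ ?j) powr ?g"
      using pos by (intro powr_mono2') (auto simp: divide_nonpos_pos)
    then have "\<psi> u powr ?g \<le> z" by (simp only: pw[OF z])
    moreover have "0 < \<psi> u" using less pos by linarith
    ultimately show ?thesis by blast
  qed
  have v: "0 < \<psi> v" "\<psi> v powr ?g \<le> p" and w: "0 < \<psi> w" "\<psi> w powr ?g \<le> q"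
    using bound[OF p pq(1)] bound[OF q pq(2)] by auto
  let ?u = "(1 - \<mu>) *\<^sub>R v + \<mu> *\<^sub>R w" and ?W = "(1 - \<mu>) * p + \<mu> * q"
  have W: "0 < ?W" using pq \<mu> by (simp add: add_pos_pos)
  have "\<psi> ?u powr ?g \<le> (1 - \<mu>) * (\<psi> v powr ?g) + \<mu> * (\<psi> w powr ?g)"
    using convex_onD[OF conv, of \<mu> v w] \<mu> v w by simp
  also have "\<dots> \<le> ?W" using v w \<mu> by (intro add_mono mult_left_mono) auto
  finally have le: "\<psi> ?u powr ?g \<le> ?W" .
  have "convex {x. 0 < \<psi> x}" using conv by (rule convex_on_imp_convex)
  then have u: "0 < \<psi> ?u" using convexD[of "{x. 0 < \<psi> x}" v w "1 - \<mu>" \<mu>] v w \<mu> by simp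
  have "1 / ?W ^ ?j = ?W powr (- real ?j)" using W by (simp only: powr_minus_divide powr_realpow)
  also have "\<dots> \<le> (\<psi> ?u powr ?g) powr (- real ?j)"
    using le u by (intro powr_mono2') auto
  also have "\<dots> = \<psi> ?u powr (?g * - real ?j)" by (simp only: powr_powr)
  also have "?g * - real ?j = 1" using gj by (simp only: mult.commute)
  finally have "1 / ?W ^ ?j \<le> \<psi> ?u" using u by simp
  then show "ennreal (1 / ?W ^ ?j) \<le> ennreal (\<psi> ?u)" by (rule ennreal_leI)
qed

section \<open>The polar of the random set as a slab condition\<close>

definition column_polar :: "(real^'k) set \<Rightarrow> ('k::finite \<Rightarrow> real) set" where
  "column_polar C = {z. \<forall>c\<in>C. (\<Sum>i\<in>UNIV. c $ i * z i) \<le> 1}"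

lemma polar_columns_image: "polar (columns_image x C) = {v. (\<lambda>i. x i \<bullet> v) \<in> column_polar C}"
  by (auto simp: polar_def columns_image_def column_polar_def inner_sum_left)

text \<open>The intersection of half-spaces over \<open>C\<close> equals the one over a countable
  dense subset, because each constraint is closed in \<open>c\<close>.\<close>

lemma column_polar_measurable:
  fixes C :: "(real^'k::finite) set"
  shows "column_polar C \<in> sets (Pi\<^sub>M UNIV (\<lambda>_. borel))"
proof -
  obtain T where T: "countable T" "T \<subseteq> C" "C \<subseteq> closure T" using separable by blast
  have "(\<Sum>i\<in>UNIV. c $ i * z i) \<le> 1" if "\<forall>c\<in>T. (\<Sum>i\<in>UNIV. c $ i * z i) \<le> 1" "c \<in> C" for z :: "'k \<Rightarrow> real" and c
  proof -
    have "closed {c::real^'k. (\<Sum>i\<in>UNIV. c $ i * z i) \<le> 1}"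
      by (intro closed_Collect_le continuous_intros)
    then have "closure T \<subseteq> {c. (\<Sum>i\<in>UNIV. c $ i * z i) \<le> 1}" using that(1) by (intro closure_minimal) auto
    then show ?thesis using T(3) that(2) by blast
  qed
  then have "column_polar C = {z\<in>space (Pi\<^sub>M UNIV (\<lambda>_. borel)). \<forall>c\<in>T. (\<Sum>i\<in>UNIV. c $ i * z i) \<le> 1}"
    using T(2) unfolding column_polar_def by (auto simp: space_PiM)
  also have "\<dots> \<in> sets (Pi\<^sub>M UNIV (\<lambda>_. borel))"
  proof (cases "T = {}")
    case False
    have "{z\<in>space (Pi\<^sub>M UNIV (\<lambda>_. borel)). \<forall>c\<in>T. (\<Sum>i\<in>UNIV. c $ i * z i) \<le> 1} =
      (\<Inter>c\<in>T. {z\<in>space (Pi\<^sub>M UNIV (\<lambda>_. borel)). (\<Sum>i\<in>UNIV. c $ i * z i) \<le> 1})"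
      using False by auto
    also have "\<dots> \<in> sets (Pi\<^sub>M UNIV (\<lambda>_. borel))"
    proof (rule sets.countable_INT''[OF _ T(1)])
      show "UNIV \<in> sets (Pi\<^sub>M (UNIV::'k set) (\<lambda>_. borel :: real measure))"
        using sets.top[of "Pi\<^sub>M (UNIV::'k set) (\<lambda>_. borel :: real measure)"] by (simp add: space_PiM)
    qed measurable
    finally show ?thesis .
  qed simp
  finally show ?thesis .
qed

lemma convex_family_column_polar: "convex_family (column_polar C)"
  unfolding convex_family_def
proof (intro ballI allI impI)
  fix z w :: "'a \<Rightarrow> real" and \<mu> :: real
  assume z: "z \<in> column_polar C" and w: "w \<in> column_polar C" and \<mu>: "0 < \<mu>" "\<mu> < 1"
  have "(\<Sum>i\<in>UNIV. c $ i * ((1 - \<mu>) * z i + \<mu> * w i)) \<le> 1" if "c \<in> C" for c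
  proof -
    have "(\<Sum>i\<in>UNIV. c $ i * ((1 - \<mu>) * z i + \<mu> * w i)) =
      (1 - \<mu>) * (\<Sum>i\<in>UNIV. c $ i * z i) + \<mu> * (\<Sum>i\<in>UNIV. c $ i * w i)"
      by (simp add: sum_distrib_left sum.distrib[symmetric] algebra_simps)
    also have "\<dots> \<le> 1" using z w that \<mu> by (intro convex_bound_le) (auto simp: column_polar_def)
    finally show ?thesis .
  qed
  then show "(\<lambda>i. (1 - \<mu>) * z i + \<mu> * w i) \<in> column_polar C" by (simp add: column_polar_def)
qed

lemma symmetric_family_column_polar:
  assumes "origin_symmetric C"
  shows "symmetric_family (column_polar C)"
  unfolding symmetric_family_def
proof
  fix z assume z: "z \<in> column_polar C"
  have "(\<Sum>i\<in>UNIV. c $ i * - z i) \<le> 1" if "c \<in> C" for c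
  proof -
    have "- c \<in> C" using assms that unfolding origin_symmetric_def by (metis image_eqI)
    then have "(\<Sum>i\<in>UNIV. (- c) $ i * z i) \<le> 1" using z by (simp only: column_polar_def mem_Collect_eq)
    then show ?thesis by simp
  qed
  then show "(\<lambda>i. - z i) \<in> column_polar C" by (simp add: column_polar_def)
qed

text \<open>Unconditionality lets the sign of one coordinate be flipped inside the polar, and
  \<open>r * z i\<close> is a convex combination of \<open>z i\<close> and
  \<open>- z i\<close>.\<close>

lemma column_polar_shrink:
  assumes C: "one_unconditional C" and z: "z \<in> column_polar C" and r: "0 < r" "r \<le> 1"
  shows "z(i := r * z i) \<in> column_polar C"
proof (cases "r = 1")
  case False
  have flip: "z(i := - z i) \<in> column_polar C"
    unfolding column_polar_def mem_Collect_eq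
  proof
    fix c assume c: "c \<in> C"
    let ?s = "\<lambda>j. if j = i then - 1 else 1 :: real"
    have "(\<chi> j. ?s j * c $ j) \<in> C" using C c by (simp add: one_unconditional_def)
    then have "(\<Sum>j\<in>UNIV. (\<chi> j. ?s j * c $ j) $ j * z j) \<le> 1"
      using z by (simp only: column_polar_def mem_Collect_eq)
    also have "(\<Sum>j\<in>UNIV. (\<chi> j. ?s j * c $ j) $ j * z j) = (\<Sum>j\<in>UNIV. c $ j * (z(i := - z i)) j)"
      by (intro sum.cong) auto
    finally show "(\<Sum>j\<in>UNIV. c $ j * (z(i := - z i)) j) \<le> 1" .
  qed
  define \<mu> where "\<mu> = (1 - r) / 2"
  have \<mu>: "0 < \<mu>" "\<mu> < 1" using r False by (auto simp: \<mu>_def)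
  have "(\<lambda>j. (1 - \<mu>) * z j + \<mu> * (z(i := - z i)) j) \<in> column_polar C"
    by (rule convex_familyD[OF convex_family_column_polar z flip \<mu>])
  also have "(\<lambda>j. (1 - \<mu>) * z j + \<mu> * (z(i := - z i)) j) = z(i := r * z i)"
    by (rule ext) (auto simp: \<mu>_def field_simps)
  finally show ?thesis .
qed (use z in simp)

lemma slab_mass_measurable:
  fixes L :: "('k::finite \<Rightarrow> real) set" and \<psi> :: "'a::euclidean_space \<Rightarrow> ennreal"
  assumes [measurable]: "\<psi> \<in> borel_measurable borel" and L[measurable]: "L \<in> sets (Pi\<^sub>M UNIV (\<lambda>_. borel))"
  shows "slab_mass \<psi> L \<in> borel_measurable (Pi\<^sub>M UNIV (\<lambda>_. lborel))"
proof -
  have [measurable]: "(\<lambda>p i. fst p i \<bullet> snd p) \<in> measurable (Pi\<^sub>M (UNIV::'k set) (\<lambda>_. lborel :: 'a measure) \<Otimes>\<^sub>M lborel) (Pi\<^sub>M UNIV (\<lambda>_. borel))"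
    by (rule measurable_PiM_single') (auto intro!: borel_measurable_inner)
  have "(\<lambda>p. \<psi> (snd p) * indicator L (\<lambda>i. fst p i \<bullet> snd p)) \<in> borel_measurable (Pi\<^sub>M UNIV (\<lambda>_. lborel) \<Otimes>\<^sub>M lborel)"
    by measurable
  then show ?thesis unfolding slab_mass_def[abs_def]
    by (intro lborel.borel_measurable_nn_integral) (simp add: case_prod_beta)
qed

lemma steiner_concave_slab_mass:
  fixes L :: "('k::finite \<Rightarrow> real) set" and \<psi> :: "'a::euclidean_space \<Rightarrow> ennreal"
  assumes \<psi>: "\<psi> \<in> borel_measurable borel" and Lb: "L \<in> sets (Pi\<^sub>M UNIV (\<lambda>_. borel))"
    and L: "convex_family L" "symmetric_family L"
    and inv: "\<And>T v. orthogonal_transformation T \<Longrightarrow> \<psi> (T v) = \<psi> v"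
    and conc: "\<And>\<mu> v w. 0 < \<mu> \<Longrightarrow> \<mu> < 1 \<Longrightarrow>
      power_mean_le (Suc DIM('a)) \<mu> (\<psi> v) (\<psi> w) (\<psi> ((1 - \<mu>) *\<^sub>R v + \<mu> *\<^sub>R w))"
  shows "steiner_concave {x. \<alpha> < slab_mass \<psi> L x}"
  unfolding steiner_concave_def
proof (intro allI impI conjI)
  fix e :: 'a and y :: "'k \<Rightarrow> 'a"
  assume e: "norm e = 1" and y: "\<forall>i. y i \<bullet> e = 0"
  obtain U \<phi> where "line_split e U \<phi>" using line_split_exists[OF e] by blast
  then interpret line_split e U \<phi> .
  have even: "\<psi> (- v) = \<psi> v" for v
    using inv[of uminus v] by (simp add: orthogonal_transformation_def linear_uminus)
  show "convex_family {t. (\<lambda>i. y i + t i *\<^sub>R e) \<in> {x. \<alpha> < slab_mass \<psi> L x}}"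
    unfolding convex_family_def
  proof (intro ballI allI impI)
    fix t t' and \<mu> :: real
    assume t: "t \<in> {t. (\<lambda>i. y i + t i *\<^sub>R e) \<in> {x. \<alpha> < slab_mass \<psi> L x}}"
        "t' \<in> {t. (\<lambda>i. y i + t i *\<^sub>R e) \<in> {x. \<alpha> < slab_mass \<psi> L x}}" and \<mu>: "0 < \<mu>" "\<mu> < 1"
    then have "\<alpha> < min (slab_mass \<psi> L (\<lambda>i. y i + t i *\<^sub>R e)) (slab_mass \<psi> L (\<lambda>i. y i + t' i *\<^sub>R e))" by simp
    also have "\<dots> \<le> slab_mass \<psi> L (\<lambda>i. y i + ((1 - \<mu>) * t i + \<mu> * t' i) *\<^sub>R e)"
      by (rule slab_mass_quasi_concave[OF \<psi> Lb L even conc \<mu>])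
    finally show "(\<lambda>i. (1 - \<mu>) * t i + \<mu> * t' i) \<in> {t. (\<lambda>i. y i + t i *\<^sub>R e) \<in> {x. \<alpha> < slab_mass \<psi> L x}}" by simp
  qed
  have "reflect_along e (y i + s *\<^sub>R e) = y i + (- s) *\<^sub>R e" for i s
  proof -
    have "(y i + s *\<^sub>R e) \<bullet> e = s" using y by (simp add: inner_add_left e_inner_e)
    then show ?thesis by (simp add: reflect_along_def e_inner_e scaleR_left_distrib[symmetric] add_diff_eq[symmetric]
      scaleR_left_diff_distrib[symmetric] del: scaleR_minus_left)
  qed
  then have "slab_mass \<psi> L (\<lambda>i. y i + (- t i) *\<^sub>R e) = slab_mass \<psi> L (\<lambda>i. y i + t i *\<^sub>R e)" for t
    using slab_mass_orthogonal[OF orthogonal_reflect_along inv[OF orthogonal_reflect_along] \<psi> Lb,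
        of e "\<lambda>i. y i + t i *\<^sub>R e"] by simp
  then show "symmetric_family {t. (\<lambda>i. y i + t i *\<^sub>R e) \<in> {x. \<alpha> < slab_mass \<psi> L x}}"
    unfolding symmetric_family_def by (simp del: scaleR_minus_left)
qed

theorem theorem5p2:
  fixes P :: "'w measure"
    and f :: "'N::finite \<Rightarrow> real^'n::finite \<Rightarrow> real"
    and X Xs Z :: "'N \<Rightarrow> 'w \<Rightarrow> real^'n"
    and C :: "(real^'N) set"
    and \<nu> :: "(real^'n) measure"
    and \<psi> :: "real^'n \<Rightarrow> real"
  assumes "prob_space P"
    and "\<And>i. prob_density (f i)"
    and "\<And>i. distributed P lborel (X i) (\<lambda>x. ennreal (f i x))"
    and "\<And>i. distributed P lborel (Xs i) (sym_decr_rearrangement (f i))"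
    and "\<And>i. distr P lborel (Z i) = uniform_measure lborel unit_volume_ball"
    and "prob_space.indep_vars P (\<lambda>_. borel)
           (\<lambda>k :: 'N + 'N + 'N. case k of
              Inl i \<Rightarrow> X i
            | Inr (Inl i) \<Rightarrow> Xs i
            | Inr (Inr i) \<Rightarrow> Z i) UNIV"
    and "convex_body C" and "origin_symmetric C"
    and "\<psi> \<in> borel_measurable borel"
    and "rotation_invariant \<psi>"
    and "neg_concave (- 1 / (real CARD('n) + 1)) \<psi>"
    and "\<nu> = density lborel (\<lambda>x. ennreal (\<psi> x))"
  shows "(\<forall>\<alpha>::real. \<alpha> \<ge> 0 \<longrightarrow>
            measure P {\<omega> \<in> space P. emeasure \<nu> (polar (columns_image (\<lambda>i. X i \<omega>) C)) > ennreal \<alpha>}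
          \<le> measure P {\<omega> \<in> space P. emeasure \<nu> (polar (columns_image (\<lambda>i. Xs i \<omega>) C)) > ennreal \<alpha>})
       \<and> (one_unconditional C \<and> (\<forall>i. esssup lborel (\<lambda>x. ennreal \<bar>f i x\<bar>) \<le> 1) \<longrightarrow>
          (\<forall>\<alpha>::real. \<alpha> \<ge> 0 \<longrightarrow>
            measure P {\<omega> \<in> space P. emeasure \<nu> (polar (columns_image (\<lambda>i. X i \<omega>) C)) > ennreal \<alpha>}
          \<le> measure P {\<omega> \<in> space P. emeasure \<nu> (polar (columns_image (\<lambda>i. Z i \<omega>) C)) > ennreal \<alpha>}))"
proof -
  interpret P: prob_space P by fact
  note f = assms(2) and [measurable] = assms(9)
  let ?\<psi> = "\<lambda>x. ennreal (\<psi> x)" and ?L = "column_polar C"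
  let ?M = "Pi\<^sub>M (UNIV::'N set) (\<lambda>_. lborel :: (real^'n) measure)"
  have \<psi>: "?\<psi> \<in> borel_measurable borel" by measurable
  have L: "?L \<in> sets (Pi\<^sub>M UNIV (\<lambda>_. borel))" by (rule column_polar_measurable)
  have mass: "emeasure \<nu> (polar (columns_image x C)) = slab_mass ?\<psi> ?L x" for x
  proof -
    have "{v. (\<lambda>i. x i \<bullet> v) \<in> ?L} \<in> sets borel"
      using measurable_sets[OF measurable_inner_family L, of x] by (simp add: vimage_def)
    then have "emeasure \<nu> (polar (columns_image x C)) = (\<integral>\<^sup>+v. ?\<psi> v * indicator {v. (\<lambda>i. x i \<bullet> v) \<in> ?L} v \<partial>lborel)"
      unfolding assms(12) polar_columns_image by (intro emeasure_density) auto
    then show ?thesis by (simp add: slab_mass_def indicator_def)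
  qed
  define S where "S \<alpha> = {x. ennreal \<alpha> < slab_mass ?\<psi> ?L x}" for \<alpha>
  have S: "S \<alpha> \<in> sets ?M" for \<alpha>
  proof -
    have "{x\<in>space ?M. ennreal \<alpha> < slab_mass ?\<psi> ?L x} \<in> sets ?M"
      using slab_mass_measurable[OF \<psi> L] by measurable
    then show ?thesis by (simp add: S_def space_PiM)
  qed
  have conc: "steiner_concave (S \<alpha>)" for \<alpha>
    unfolding S_def
  proof (rule steiner_concave_slab_mass[OF \<psi> L convex_family_column_polar symmetric_family_column_polar[OF assms(8)]])
    show "?\<psi> (T v) = ?\<psi> v" if "orthogonal_transformation T" for T v
      using assms(10) that by (simp add: rotation_invariant_def)
    show "power_mean_le (Suc DIM(real^'n)) \<mu> (?\<psi> v) (?\<psi> w) (?\<psi> ((1 - \<mu>) *\<^sub>R v + \<mu> *\<^sub>R w))"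
      if "0 < \<mu>" "\<mu> < 1" for \<mu> v w
      using assms(11) that by (intro neg_concave_imp_power_mean_le) simp_all
  qed
  \<comment> \<open>Each of the three groups of vectors is obtained from the joint family by
    composition with one injection.\<close>
  have reindex: "P.indep_vars (\<lambda>_. borel) (\<lambda>i. Y (h i)) UNIV"
    if "Y = (\<lambda>k. case k of Inl i \<Rightarrow> X i | Inr (Inl i) \<Rightarrow> Xs i | Inr (Inr i) \<Rightarrow> Z i)" "inj h"
    for Y and h :: "'N \<Rightarrow> 'N + 'N + 'N"
    using P.indep_vars_inj_reindex[OF assms(6) that(2)] that(1) by simp
  have indX: "P.indep_vars (\<lambda>_. borel) X UNIV" using reindex[OF refl, of Inl] by simp
  have indXs: "P.indep_vars (\<lambda>_. borel) Xs UNIV" using reindex[OF refl, of "\<lambda>i. Inr (Inl i)"] by (simp add: inj_def)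
  have indZ: "P.indep_vars (\<lambda>_. borel) Z UNIV" using reindex[OF refl, of "\<lambda>i. Inr (Inr i)"] by (simp add: inj_def)
  have distr_borel: "distr P borel V = distr P lborel V" for V :: "'w \<Rightarrow> real^'n"
    by (rule distr_cong) auto
  let ?fs = "\<lambda>i. sym_decr_rearrangement (f i)" and ?h = "\<lambda>i::'N. indicator unit_volume_ball :: real^'n \<Rightarrow> ennreal"
  have fb: "(\<lambda>x. ennreal (f i x)) \<in> borel_measurable borel" for i
    using assms(3)[of i] by (simp add: distributed_def)
  have fsb: "?fs i \<in> borel_measurable borel" for i
    using assms(4)[of i] by (simp add: distributed_def)
  have hb: "?h i \<in> borel_measurable borel" for i
  proof (rule borel_measurable_indicator)
    obtain r where r: "(unit_volume_ball :: (real^'n) set) = cball 0 r"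
      using unit_volume_ball(1)[where 'a="real^'n"] by blast
    show "(unit_volume_ball :: (real^'n) set) \<in> sets borel"
      unfolding r by (intro borel_closed closed_cball)
  qed
  have probX: "emeasure P {\<omega>\<in>space P. emeasure \<nu> (polar (columns_image (\<lambda>i. X i \<omega>) C)) > ennreal \<alpha>} =
      (\<integral>\<^sup>+x. indicator (S \<alpha>) x * (\<Prod>i\<in>UNIV. ennreal (f i (x i))) \<partial>?M)" for \<alpha>
    using P.emeasure_joint_density[OF fb _ indX S[of \<alpha>]] assms(3)
    by (simp add: mass S_def distributed_def distr_borel)
  have probXs: "emeasure P {\<omega>\<in>space P. emeasure \<nu> (polar (columns_image (\<lambda>i. Xs i \<omega>) C)) > ennreal \<alpha>} =
      (\<integral>\<^sup>+x. indicator (S \<alpha>) x * (\<Prod>i\<in>UNIV. ?fs i (x i)) \<partial>?M)" for \<alpha>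
    using P.emeasure_joint_density[OF fsb _ indXs S[of \<alpha>]] assms(4)
    by (simp add: mass S_def distributed_def distr_borel)
  have probZ: "emeasure P {\<omega>\<in>space P. emeasure \<nu> (polar (columns_image (\<lambda>i. Z i \<omega>) C)) > ennreal \<alpha>} =
      (\<integral>\<^sup>+x. indicator (S \<alpha>) x * (\<Prod>i\<in>UNIV. ?h i (x i)) \<partial>?M)" for \<alpha>
  proof -
    \<comment> \<open>The ball has volume one, so the normalizing constant of the uniform measure is
      one and the density is the bare indicator.\<close>
    have "distr P borel (Z i) = density lborel (?h i)" for i
      unfolding distr_borel assms(5) uniform_measure_def unit_volume_ball(2) by (simp add: divide_ennreal_def)
    from P.emeasure_joint_density[OF hb this indZ S[of \<alpha>]] show ?thesis by (simp add: mass S_def)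
  qed
  have rearr: "(\<integral>\<^sup>+x. indicator (S \<alpha>) x * (\<Prod>i\<in>UNIV. ennreal (f i (x i))) \<partial>?M)
      \<le> (\<integral>\<^sup>+x. indicator (S \<alpha>) x * (\<Prod>i\<in>UNIV. ?fs i (x i)) \<partial>?M)" for \<alpha>
    by (rule rearrangement_inequality[OF S conc f])
  have uncond: "(\<integral>\<^sup>+x. indicator (S \<alpha>) x * (\<Prod>i\<in>UNIV. ?fs i (x i)) \<partial>?M)
      \<le> (\<integral>\<^sup>+x. indicator (S \<alpha>) x * (\<Prod>i\<in>UNIV. ?h i (x i)) \<partial>?M)"
    if C: "one_unconditional C" and le: "\<forall>i. esssup lborel (\<lambda>x. ennreal \<bar>f i x\<bar>) \<le> 1" for \<alpha>
  proof (rule nn_integral_PiM_replace[OF S _ fsb hb])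
    fix x :: "'N \<Rightarrow> real^'n" and i and r :: real
    assume x: "x \<in> S \<alpha>" and r: "0 < r" "r \<le> 1"
    \<comment> \<open>Shrinking one column towards the origin enlarges the polar: every
      \<open>v\<close> in the old polar stays in the new one, so superlevel sets of the mass are
      star-shaped in each column.\<close>
    have "slab_mass ?\<psi> ?L x \<le> slab_mass ?\<psi> ?L (x(i := r *\<^sub>R x i))"
      unfolding slab_mass_def
    proof (rule nn_integral_mono)
      fix v
      have eq: "(\<lambda>j. (x(i := r *\<^sub>R x i)) j \<bullet> v) = (\<lambda>j. x j \<bullet> v)(i := r * (x i \<bullet> v))" by auto
      show "?\<psi> v * indicator ?L (\<lambda>j. x j \<bullet> v) \<le> ?\<psi> v * indicator ?L (\<lambda>j. (x(i := r *\<^sub>R x i)) j \<bullet> v)"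
        unfolding eq using column_polar_shrink[OF C _ r, of "\<lambda>j. x j \<bullet> v" i]
        by (intro mult_left_mono) (auto simp: indicator_def)
    qed
    then show "x(i := r *\<^sub>R x i) \<in> S \<alpha>" using x by (auto simp: S_def intro: less_le_trans)
  qed (use le in \<open>auto intro: nn_integral_star_shaped_le[OF f]\<close>)
  have mono: "measure P A \<le> measure P B" if "emeasure P A \<le> emeasure P B" for A B
    using that by (simp add: P.emeasure_eq_measure)
  \<comment> \<open>The comparison with the uniform vectors is reached through the rearranged ones,
    by chaining the two integral inequalities.\<close>
  show ?thesis
    using rearr uncond order_trans[OF rearr uncond] by (auto intro!: mono simp: probX probXs probZ)
qed

end
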